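(* Let $\mathcal{T}$ be a $d$-regular tree with $d\ge 3$, let $F\le \mathrm{Sym}\{1,\dots,d\}$ be primitive, let $\mathbb{G}:=U(F)^+$ be the Burger--Mozes universal group, and let $\xi\in\partial\mathcal{T}$. Let $H$ be a closed subgroup of $\mathbb{G}$ stabilizing $\xi$, and let $(\sigma,\mathcal{K})$ be a unitary representation of $H$. Then the induced unitary representation $(\pi_\sigma,\mathcal{H}_\sigma)$ of $\mathbb{G}$ is $C_0$.
   Context: Universal group: fix a map $i$ from the set of (unoriented) edges of $\mathcal{T}$ to $\{1,\dots,d\}$ whose restriction to the star $E(x)$ (the set of edges containing $x$) of every vertex $x$ is a bijection (legal colouring). $U(F)$ is the group of all $g\in\mathrm{Aut}(\mathcal{T})$ such that $i|_{E(g(x))}\circ g\circ (i|_{E(x)})^{-1}\in F$ for every vertex $x$. $U(F)^+$ is the subgroup of $U(F)$ generated by the pointwise stabilizers in $U(F)$ of edges of $\mathcal{T}$. $\mathrm{Aut}(\mathcal{T})$ carries the topology of pointwise convergence on vertices; $\mathbb{G}$ is a closed subgroup, hence locally compact. $\partial\mathcal{T}$ is the set of ends of $\mathcal{T}$. Unitary representations are strongly continuous, on complex Hilbert spaces. A unitary representation $(\pi,\mathcal{H})$ of a locally compact group $G$ is $C_0$ if for all $v,w\in\mathcal{H}$ and all $\epsilon>0$ the set $\{g\in G : |\langle \pi(g)v,w\rangle|\ge\epsilon\}$ is compact. Induced representation: let $G$ be locally compact, $H\le G$ closed, with left Haar measures $dx$, $dh$ and modular functions $\Delta_G,\Delta_H$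 (convention: $m(Ag)=\Delta(g)m(A)$ for left Haar measure $m$). A rho-function is a continuous $\rho:G\to(0,\infty)$ with $\rho(xh)=\frac{\Delta_H(h)}{\Delta_G(h)}\rho(x)$ for $x\in G$, $h\in H$; it determines a regular Borel measure $\mu$ on $G/H$ by $\int_G f(x)\rho(x)\,dx=\int_{G/H}\int_H f(xh)\,dh\,d\mu(xH)$ for $f\in C_c(G)$. Rho-functions always exist. Given a unitary representation $(\sigma,\mathcal{K})$ of $H$, let $\mathcal{A}$ be the space of continuous $\eta:G\to\mathcal{K}$ with $\eta(xh)=\sigma(h^{-1})\eta(x)$ for all $x\in G,h\in H$, whose support has compact image in $G/H$, with inner product $\langle\eta,\eta'\rangle=\int_{G/H}\langle\eta(x),\eta'(x)\rangle_{\mathcal{K}}\,d\mu(xH)$. $\mathcal{H}_\sigma$ is the completion of $\mathcal{A}$ and $(\pi_\sigma(g)\eta)(x)=\left(\frac{\rho(g^{-1}x)}{\rho(x)}\right)^{1/2}\eta(g^{-1}x)$. Up to unitary equivalence this does not depend on $\rho$. *)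

theory Defs
  imports
    "HOL-Analysis.Analysis"
    "HOL-Algebra.Left_Coset"
    "HOL-Algebra.Generated_Groups"
    "HOL-Algebra.Sym_Groups"
begin

section \<open>Complex Hilbert spaces\<close>

text \<open>
  The norm and topology are those of the underlying real Hilbert space, whose inner product is
  the real part of \<open>cinner\<close>. \<open>cinner\<close> is linear in its first argument.
\<close>

class complex_hilbert = real_inner + complete_space +
  fixes scaleC :: "complex \<Rightarrow> 'a \<Rightarrow> 'a" (infixr \<open>*\<^sub>C\<close> 75)
    and cinner :: "'a \<Rightarrow> 'a \<Rightarrow> complex"
  assumes scaleC_add_right: "a *\<^sub>C (x + y) = a *\<^sub>C x + a *\<^sub>C y"
    and scaleC_add_left: "(a + b) *\<^sub>C x = a *\<^sub>C x + b *\<^sub>C x"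
    and scaleC_scaleC: "a *\<^sub>C (b *\<^sub>C x) = (a * b) *\<^sub>C x"
    and scaleC_of_real: "complex_of_real r *\<^sub>C x = r *\<^sub>R x"
    and cinner_commute: "cinner x y = cnj (cinner y x)"
    and cinner_add_left: "cinner (x + y) z = cinner x z + cinner y z"
    and cinner_scaleC_left: "cinner (a *\<^sub>C x) y = a * cinner x y"
    and inner_eq_Re_cinner: "inner x y = Re (cinner x y)"

instantiation complex :: complex_hilbert
begin

definition scaleC_complex :: "complex \<Rightarrow> complex \<Rightarrow> complex"
  where "scaleC_complex a x = a * x"

definition cinner_complex :: "complex \<Rightarrow> complex \<Rightarrow> complex"
  where "cinner_complex x y = x * cnj y"

instance
  by standard
    (auto simp: scaleC_complex_def cinner_complex_def inner_complex_def algebra_simps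
      scaleR_conv_of_real)

end

definition clinear :: "('a::complex_hilbert \<Rightarrow> 'b::complex_hilbert) \<Rightarrow> bool"
  where "clinear f \<longleftrightarrow>
    (\<forall>x y. f (x + y) = f x + f y) \<and> (\<forall>a x. f (a *\<^sub>C x) = a *\<^sub>C f x)"

section \<open>Unitary representations of topological groups\<close>

text \<open>
  A topological group is given by a group \<open>G\<close> together with a topology \<open>T\<close> on \<open>carrier G\<close>; a
  subgroup \<open>H\<close> is the topological group \<open>G\<lparr>carrier := H\<rparr>\<close>, \<open>subtopology T H\<close>.
\<close>

definition unitary_rep ::
    "('g, 'b) monoid_scheme \<Rightarrow> 'g topology \<Rightarrow> ('g \<Rightarrow> 'h \<Rightarrow> 'h::complex_hilbert) \<Rightarrow> bool"
  where "unitary_rep G T \<pi> \<longleftrightarrow>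
    (\<forall>g\<in>carrier G. clinear (\<pi> g) \<and> surj (\<pi> g) \<and>
       (\<forall>v w. cinner (\<pi> g v) (\<pi> g w) = cinner v w)) \<and>
    (\<forall>g\<in>carrier G. \<forall>h\<in>carrier G. \<pi> (g \<otimes>\<^bsub>G\<^esub> h) = \<pi> g \<circ> \<pi> h) \<and>
    (\<forall>v. continuous_map T euclidean (\<lambda>g. \<pi> g v))"

definition C0_rep ::
    "('g, 'b) monoid_scheme \<Rightarrow> 'g topology \<Rightarrow> ('g \<Rightarrow> 'h \<Rightarrow> 'h::complex_hilbert) \<Rightarrow> bool"
  where "C0_rep G T \<pi> \<longleftrightarrow>
    unitary_rep G T \<pi> \<and>
    (\<forall>v w. \<forall>\<epsilon>>0. compactin T {g \<in> carrier G. cmod (cinner (\<pi> g v) w) \<ge> \<epsilon>})"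

section \<open>Haar measures, modular functions and rho-functions\<close>

definition borel_of :: "'a topology \<Rightarrow> 'a measure"
  where "borel_of X = sigma (topspace X) {U. openin X U}"

definition regular_borel_measure :: "'a topology \<Rightarrow> 'a measure \<Rightarrow> bool"
  where "regular_borel_measure X M \<longleftrightarrow>
    sets M = sets (borel_of X) \<and>
    (\<forall>K. compactin X K \<longrightarrow> emeasure M K < \<infinity>) \<and>
    (\<forall>A\<in>sets M. emeasure M A = (INF U\<in>{U. openin X U \<and> A \<subseteq> U}. emeasure M U)) \<and>
    (\<forall>U. openin X U \<longrightarrow> emeasure M U = (SUP K\<in>{K. compactin X K \<and> K \<subseteq> U}. emeasure M K))"

definition left_haar_measure ::
    "('g, 'b) monoid_scheme \<Rightarrow> 'g topology \<Rightarrow> 'g measure \<Rightarrow> bool"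
  where "left_haar_measure G T m \<longleftrightarrow>
    regular_borel_measure T m \<and>
    emeasure m (carrier G) \<noteq> 0 \<and>
    (\<forall>g\<in>carrier G. \<forall>A\<in>sets m. emeasure m (g <#\<^bsub>G\<^esub> A) = emeasure m A)"

definition modular_function ::
    "('g, 'b) monoid_scheme \<Rightarrow> 'g measure \<Rightarrow> ('g \<Rightarrow> real) \<Rightarrow> bool"
  where "modular_function G m \<Delta> \<longleftrightarrow>
    (\<forall>g\<in>carrier G. \<Delta> g > 0 \<and>
       (\<forall>A\<in>sets m. emeasure m (A #>\<^bsub>G\<^esub> g) = ennreal (\<Delta> g) * emeasure m A))"

definition rho_function ::
    "('g, 'b) monoid_scheme \<Rightarrow> 'g topology \<Rightarrow> 'g set \<Rightarrow> ('g \<Rightarrow> real) \<Rightarrow> ('g \<Rightarrow> real) \<Rightarrow>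
      ('g \<Rightarrow> real) \<Rightarrow> bool"
  where "rho_function G T H \<Delta>\<^sub>G \<Delta>\<^sub>H \<rho> \<longleftrightarrow>
    continuous_map T euclideanreal \<rho> \<and>
    (\<forall>x\<in>carrier G. \<rho> x > 0) \<and>
    (\<forall>x\<in>carrier G. \<forall>h\<in>H. \<rho> (x \<otimes>\<^bsub>G\<^esub> h) = \<Delta>\<^sub>H h / \<Delta>\<^sub>G h * \<rho> x)"

section \<open>The quotient space and its measure\<close>

definition coset_topology ::
    "('g, 'b) monoid_scheme \<Rightarrow> 'g topology \<Rightarrow> 'g set \<Rightarrow> 'g set topology"
  where "coset_topology G T H =
    topology (\<lambda>U. U \<subseteq> lcosets\<^bsub>G\<^esub> H \<and> openin T {x \<in> topspace T. x <#\<^bsub>G\<^esub> H \<in> U})"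

lemma openin_coset_topology:
  "openin (coset_topology G T H) U \<longleftrightarrow>
    U \<subseteq> lcosets\<^bsub>G\<^esub> H \<and> openin T {x \<in> topspace T. x <#\<^bsub>G\<^esub> H \<in> U}"
proof -
  let ?P = "\<lambda>U. U \<subseteq> lcosets\<^bsub>G\<^esub> H \<and> openin T {x \<in> topspace T. x <#\<^bsub>G\<^esub> H \<in> U}"
  have "?P (U \<inter> V)" if "?P U" "?P V" for U V
  proof -
    have "{x \<in> topspace T. x <#\<^bsub>G\<^esub> H \<in> U \<inter> V} =
        {x \<in> topspace T. x <#\<^bsub>G\<^esub> H \<in> U} \<inter> {x \<in> topspace T. x <#\<^bsub>G\<^esub> H \<in> V}" by auto
    then show ?thesis using that by auto
  qed
  moreover have "?P (\<Union>\<U>)" if "\<forall>U\<in>\<U>. ?P U" for \<U>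
  proof -
    have "{x \<in> topspace T. x <#\<^bsub>G\<^esub> H \<in> \<Union>\<U>} =
        (\<Union>U\<in>\<U>. {x \<in> topspace T. x <#\<^bsub>G\<^esub> H \<in> U})" by auto
    moreover have "openin T (\<Union>U\<in>\<U>. {x \<in> topspace T. x <#\<^bsub>G\<^esub> H \<in> U})"
      using that by (intro openin_Union) auto
    ultimately show ?thesis using that by auto
  qed
  ultimately have "istopology ?P"
    unfolding istopology_def by blast
  then show ?thesis
    unfolding coset_topology_def by (simp add: topology_inverse')
qed

text \<open>
  A function on \<open>G\<close> that is constant on the cosets \<open>xH\<close> is regarded as a function on \<open>G/H\<close> by
  evaluating it at an arbitrary representative of the coset.
\<close>

definition coset_rep :: "'g set \<Rightarrow> 'g"
  where "coset_rep X = (SOME x. x \<in> X)"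

definition Cc :: "'g topology \<Rightarrow> ('g \<Rightarrow> complex) set"
  where "Cc T = {f. continuous_map T euclidean f \<and>
    compactin T (T closure_of {x \<in> topspace T. f x \<noteq> 0})}"

definition rho_measure ::
    "('g, 'b) monoid_scheme \<Rightarrow> 'g topology \<Rightarrow> 'g set \<Rightarrow> 'g measure \<Rightarrow> 'g measure \<Rightarrow>
      ('g \<Rightarrow> real) \<Rightarrow> 'g set measure \<Rightarrow> bool"
  where "rho_measure G T H m\<^sub>G m\<^sub>H \<rho> \<mu> \<longleftrightarrow>
    regular_borel_measure (coset_topology G T H) \<mu> \<and>
    (\<forall>f\<in>Cc T. (\<integral>x. f x * complex_of_real (\<rho> x) \<partial>m\<^sub>G) =
       (\<integral>X. (\<integral>h. f (coset_rep X \<otimes>\<^bsub>G\<^esub> h) \<partial>m\<^sub>H) \<partial>\<mu>))"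

section \<open>Induced representations\<close>

text \<open>Functions on \<open>G\<close> are extended by \<open>0\<close> to the whole type, so that they add pointwise.\<close>

definition ind_space ::
    "('g, 'b) monoid_scheme \<Rightarrow> 'g topology \<Rightarrow> 'g set \<Rightarrow> ('g \<Rightarrow> 'k \<Rightarrow> 'k::complex_hilbert) \<Rightarrow>
      ('g \<Rightarrow> 'k) set"
  where "ind_space G T H \<sigma> = {\<eta>.
    (\<forall>x. x \<notin> carrier G \<longrightarrow> \<eta> x = 0) \<and>
    continuous_map T euclidean \<eta> \<and>
    (\<forall>x\<in>carrier G. \<forall>h\<in>H. \<eta> (x \<otimes>\<^bsub>G\<^esub> h) = \<sigma> (inv\<^bsub>G\<^esub> h) (\<eta> x)) \<and>
    compactin (coset_topology G T H)
      ((\<lambda>x. x <#\<^bsub>G\<^esub> H) ` (T closure_of {x \<in> carrier G. \<eta> x \<noteq> 0}))}"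

definition ind_inner ::
    "'g set measure \<Rightarrow> ('g \<Rightarrow> 'k::complex_hilbert) \<Rightarrow> ('g \<Rightarrow> 'k) \<Rightarrow> complex"
  where "ind_inner \<mu> \<eta> \<eta>' = (\<integral>X. cinner (\<eta> (coset_rep X)) (\<eta>' (coset_rep X)) \<partial>\<mu>)"

definition ind_act ::
    "('g, 'b) monoid_scheme \<Rightarrow> ('g \<Rightarrow> real) \<Rightarrow> 'g \<Rightarrow> ('g \<Rightarrow> 'k::complex_hilbert) \<Rightarrow> 'g \<Rightarrow> 'k"
  where "ind_act G \<rho> g \<eta> x =
    (if x \<in> carrier G
     then sqrt (\<rho> (inv\<^bsub>G\<^esub> g \<otimes>\<^bsub>G\<^esub> x) / \<rho> x) *\<^sub>R \<eta> (inv\<^bsub>G\<^esub> g \<otimes>\<^bsub>G\<^esub> x)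
     else 0)"

text \<open>
  A completion of a pre-Hilbert space is a Hilbert space with a linear isometric map \<open>J\<close> of dense
  range into it, and an isometry of the pre-Hilbert space acts on the completion by continuous
  extension. The representation is thereby fixed up to unitary equivalence; that it
  is unitary is not part of the definition.
\<close>

definition induced_rep ::
    "('g, 'b) monoid_scheme \<Rightarrow> 'g topology \<Rightarrow> 'g set \<Rightarrow> ('g \<Rightarrow> real) \<Rightarrow> 'g set measure \<Rightarrow>
      ('g \<Rightarrow> 'k \<Rightarrow> 'k::complex_hilbert) \<Rightarrow> (('g \<Rightarrow> 'k) \<Rightarrow> 'h::complex_hilbert) \<Rightarrow>
      ('g \<Rightarrow> 'h \<Rightarrow> 'h) \<Rightarrow> bool"
  where "induced_rep G T H \<rho> \<mu> \<sigma> J \<pi> \<longleftrightarrow>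
    (\<forall>\<eta>\<in>ind_space G T H \<sigma>. \<forall>\<eta>'\<in>ind_space G T H \<sigma>. J (\<lambda>x. \<eta> x + \<eta>' x) = J \<eta> + J \<eta>') \<and>
    (\<forall>\<eta>\<in>ind_space G T H \<sigma>. \<forall>a. J (\<lambda>x. a *\<^sub>C \<eta> x) = a *\<^sub>C J \<eta>) \<and>
    (\<forall>\<eta>\<in>ind_space G T H \<sigma>. \<forall>\<eta>'\<in>ind_space G T H \<sigma>. cinner (J \<eta>) (J \<eta>') = ind_inner \<mu> \<eta> \<eta>') \<and>
    closure (J ` ind_space G T H \<sigma>) = UNIV \<and>
    (\<forall>g\<in>carrier G. continuous_on UNIV (\<pi> g) \<and>
       (\<forall>\<eta>\<in>ind_space G T H \<sigma>. \<pi> g (J \<eta>) = J (ind_act G \<rho> g \<eta>)))"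

section \<open>Regular trees and their ends\<close>

text \<open>
  A simple graph with vertex set \<open>UNIV :: 'v set\<close> is given by its set of unoriented edges, which
  are two-element sets of vertices.
\<close>

definition star :: "'v set set \<Rightarrow> 'v \<Rightarrow> 'v set set"
  where "star E x = {e \<in> E. x \<in> e}"

definition simple_graph :: "'v set set \<Rightarrow> bool"
  where "simple_graph E \<longleftrightarrow> (\<forall>e\<in>E. card e = 2)"

definition connected_graph :: "'v set set \<Rightarrow> bool"
  where "connected_graph E \<longleftrightarrow> (\<forall>x y. (x, y) \<in> {(u, v). {u, v} \<in> E}\<^sup>*)"

definition graph_cycle :: "'v set set \<Rightarrow> 'v list \<Rightarrow> bool"
  where "graph_cycle E xs \<longleftrightarrow>
    length xs \<ge> 3 \<and> distinct xs \<and> successively (\<lambda>u v. {u, v} \<in> E) xs \<and> {last xs, hd xs} \<in> E"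

definition tree :: "'v set set \<Rightarrow> bool"
  where "tree E \<longleftrightarrow> simple_graph E \<and> connected_graph E \<and> (\<nexists>xs. graph_cycle E xs)"

definition regular_tree :: "nat \<Rightarrow> 'v set set \<Rightarrow> bool"
  where "regular_tree d E \<longleftrightarrow> tree E \<and> (\<forall>x. finite (star E x) \<and> card (star E x) = d)"

text \<open>In a tree, the geodesic rays are the injective ones; two of them define the same end iff
  they eventually coincide up to a shift.\<close>

definition rays :: "'v set set \<Rightarrow> (nat \<Rightarrow> 'v) set"
  where "rays E = {r. inj r \<and> (\<forall>n. {r n, r (Suc n)} \<in> E)}"

definition cofinal_rel :: "'v set set \<Rightarrow> ((nat \<Rightarrow> 'v) \<times> (nat \<Rightarrow> 'v)) set"
  where "cofinal_rel E = {(r, s). r \<in> rays E \<and> s \<in> rays E \<and> (\<exists>m n. \<forall>k. r (m + k) = s (n + k))}"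

definition ends :: "'v set set \<Rightarrow> (nat \<Rightarrow> 'v) set set"
  where "ends E = rays E // cofinal_rel E"

section \<open>Universal groups\<close>

definition legal_colouring :: "nat \<Rightarrow> 'v set set \<Rightarrow> ('v set \<Rightarrow> nat) \<Rightarrow> bool"
  where "legal_colouring d E i \<longleftrightarrow> (\<forall>x. bij_betw i (star E x) {1..d})"

definition tree_aut :: "'v set set \<Rightarrow> ('v \<Rightarrow> 'v) set"
  where "tree_aut E = {g. bij g \<and> (\<forall>x y. {g x, g y} \<in> E \<longleftrightarrow> {x, y} \<in> E)}"

text \<open>The local permutation at \<open>x\<close>, extended by the identity outside \<open>{1..d}\<close> as required of the
  elements of \<^const>\<open>sym_group\<close>.\<close>

definition local_perm ::
    "nat \<Rightarrow> 'v set set \<Rightarrow> ('v set \<Rightarrow> nat) \<Rightarrow> ('v \<Rightarrow> 'v) \<Rightarrow> 'v \<Rightarrow> nat \<Rightarrow> nat"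
  where "local_perm d E i g x k =
    (if k \<in> {1..d} then i (g ` inv_into (star E x) i k) else k)"

definition universal_group ::
    "nat \<Rightarrow> 'v set set \<Rightarrow> ('v set \<Rightarrow> nat) \<Rightarrow> (nat \<Rightarrow> nat) set \<Rightarrow> ('v \<Rightarrow> 'v) monoid"
  where "universal_group d E i F =
    \<lparr>carrier = {g \<in> tree_aut E. \<forall>x. local_perm d E i g x \<in> F}, mult = (\<circ>), one = id\<rparr>"

definition universal_group_plus ::
    "nat \<Rightarrow> 'v set set \<Rightarrow> ('v set \<Rightarrow> nat) \<Rightarrow> (nat \<Rightarrow> nat) set \<Rightarrow> ('v \<Rightarrow> 'v) monoid"
  where "universal_group_plus d E i F =
    (universal_group d E i F)\<lparr>carrier := generate (universal_group d E i F)
      (\<Union>e\<in>E. {g \<in> carrier (universal_group d E i F). \<forall>x\<in>e. g x = x})\<rparr>"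

text \<open>The topology of pointwise convergence, the set of vertices being discrete.\<close>

definition pointwise_topology :: "('v \<Rightarrow> 'v, 'b) monoid_scheme \<Rightarrow> ('v \<Rightarrow> 'v) topology"
  where "pointwise_topology G =
    subtopology (product_topology (\<lambda>_. discrete_topology UNIV) UNIV) (carrier G)"

definition primitive_perm_group :: "nat \<Rightarrow> (nat \<Rightarrow> nat) set \<Rightarrow> bool"
  where "primitive_perm_group d F \<longleftrightarrow>
    subgroup F (sym_group d) \<and>
    (\<forall>a\<in>{1..d}. \<forall>b\<in>{1..d}. \<exists>p\<in>F. p a = b) \<and>
    (\<forall>R. equiv {1..d} R \<and> (\<forall>p\<in>F. \<forall>(a, b)\<in>R. (p a, p b) \<in> R) \<longrightarrow>
       R = Id_on {1..d} \<or> R = {1..d} \<times> {1..d})"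

end

theory Submission
  imports Defs
begin

text \<open>
  The matrix coefficients of the induced representation are dominated by integrals that depend only
  on the quasi-invariant measure \<open>\<mu>\<close> on \<open>G/H\<close>. If \<open>\<eta>, \<eta>'\<close> are continuous sections supported over a
  compact set \<open>A \<subseteq> G/H\<close>, then \<open>\<bar>\<langle>\<pi>(g)\<eta>, \<eta>'\<rangle>\<bar>\<close> is at most a constant times the coefficient
  \<open>\<langle>\<tau>(g) 1\<^sub>A, 1\<^sub>A\<rangle>\<close> of the quasi-regular representation \<open>\<tau>\<close> of \<open>G\<close> on \<open>L\<^sup>2(G/H, \<mu>)\<close>. By density of
  such sections it suffices that this nonnegative number tends to \<open>0\<close> as \<open>g\<close> leaves compact sets
  (\<open>C0_criterion\<close>). The sets \<open>A\<close> can be taken to be compact and open, and invariant under a compact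
  open subgroup.

  As \<open>H\<close> fixes the end \<open>\<xi>\<close>, a coset \<open>xH\<close> determines the end \<open>x\<xi>\<close>. Fix a vertex \<open>z\<close> and suppose that
  \<open>g\<close> moves \<open>z\<close> very far. Put \<open>y = g\<inverse>z\<close> and cut the tree at an edge in the middle of the geodesic from
  \<open>z\<close> to \<open>y\<close>. This splits \<open>G/H\<close> into the set \<open>D\<close> of the cosets whose end lies on the side of \<open>z\<close> and the
  set \<open>D'\<close> of those whose end lies on the side of \<open>y\<close>. There are many elements that fix a large ball
  around \<open>z\<close> and move the side of \<open>y\<close> onto pairwise disjoint half-trees, and likewise with \<open>y\<close> and \<open>z\<close>
  exchanged (\<open>disjoint_half_translates\<close>). This is used twice (\<open>coef_decay\<close>).
  The elements \<open>w\<close> of the first kind preserve \<open>A\<close> and change \<open>\<mu>\<close> on \<open>A\<close> by at most a constant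
  factor, so the disjoint sets \<open>w(A \<inter> D')\<close> show that \<open>\<mu>(A \<inter> D')\<close> is small.
  The elements \<open>u\<close> of the second kind are conjugated by \<open>g\<close> into elements that fix a large ball around
  \<open>z\<close> and hence change \<open>1\<^sub>A\<close> little; therefore \<open>\<langle>\<tau>(g) 1\<^sub>A, 1\<^sub>A\<rangle>\<close> is at most twice
  \<open>\<langle>\<tau>(u) 1\<^sub>A, \<tau>(g\<inverse>) 1\<^sub>A\<rangle>\<close>, also after averaging over all these \<open>u\<close>. The functions \<open>\<tau>(u) 1\<close> of
  \<open>A \<inter> D\<close> have disjoint supports, so that their average is small in \<open>L\<^sup>2\<close>, and the contribution of
  \<open>A \<inter> D'\<close> is small by the first step.

  The elements needed exist because \<open>F\<close> is primitive (\<open>primitive_dichotomy\<close>). Either \<open>F\<close> acts freely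
  on the colours; then an element of \<open>U(F)\<close> fixing an edge is trivial, \<open>U(F)\<^sup>+\<close> is trivial and there is
  nothing to prove. Or for any two colours \<open>c \<noteq> c'\<close> some \<open>f \<in> F\<close> fixes \<open>c\<close> and moves \<open>c'\<close>. Applying
  \<open>f\<close> to all colours beyond an edge of colour \<open>c\<close>, and fixing the rest of the tree, gives an element of
  \<open>U(F)\<^sup>+\<close> (Tits' independence property) that separates a half-tree behind this edge from its image;
  doing this along a path doubles the number of disjoint images at every step.

  That the representation is unitary rests on the transformation rule of \<open>\<mu>\<close> under \<open>G\<close>
  (\<open>quasi_invariance\<close>). It is derived from the defining formula of \<open>\<mu>\<close> by testing it on indicator
  functions of cosets of compact open subgroups, whose images form a countable base of \<open>G/H\<close> in which
  any two members are nested or disjoint.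
\<close>

section \<open>Complex Hilbert spaces\<close>

lemma cinner_add_right: "cinner x (y + z) = cinner x y + cinner x (z::'a::complex_hilbert)"
  using arg_cong [OF cinner_add_left [of y z x], of cnj]
  by (simp add: cinner_commute [symmetric])

lemma cinner_scaleC_right: "cinner x (a *\<^sub>C y) = cnj a * cinner x (y::'a::complex_hilbert)"
  using arg_cong [OF cinner_scaleC_left [of a y x], of cnj]
  by (simp add: cinner_commute [symmetric])

lemma cinner_scaleR_left: "cinner (r *\<^sub>R x) y = complex_of_real r * cinner x (y::'a::complex_hilbert)"
  by (simp add: scaleC_of_real [symmetric] cinner_scaleC_left)

lemma cinner_scaleR_right: "cinner x (r *\<^sub>R y) = complex_of_real r * cinner x (y::'a::complex_hilbert)"
  by (simp add: scaleC_of_real [symmetric] cinner_scaleC_right)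

lemma cinner_self: "cinner x x = complex_of_real ((norm (x::'a::complex_hilbert))\<^sup>2)"
proof -
  have "cnj (cinner x x) = cinner x x" by (metis cinner_commute)
  then have "Im (cinner x x) = 0" by (simp add: complex_eq_iff)
  then show ?thesis
    by (simp add: complex_eq_iff inner_eq_Re_cinner [symmetric] power2_norm_eq_inner)
qed

lemma scaleC_zero_right [simp]: "a *\<^sub>C (0::'a::complex_hilbert) = 0"
  using scaleC_add_right [of a 0 0] by simp

lemma scaleC_minus_one: "(- 1) *\<^sub>C x = - (x::'a::complex_hilbert)"
  using scaleC_of_real [of "-1" x] by simp

lemma scaleC_scaleR: "a *\<^sub>C (r *\<^sub>R x) = r *\<^sub>R (a *\<^sub>C (x::'a::complex_hilbert))"
  by (simp add: scaleC_of_real [symmetric] scaleC_scaleC mult.commute)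

lemma norm_scaleC: "norm (a *\<^sub>C x) = cmod a * norm (x::'a::complex_hilbert)"
proof -
  have "complex_of_real ((norm (a *\<^sub>C x))\<^sup>2) = complex_of_real ((cmod a * norm x)\<^sup>2)"
    unfolding cinner_self [symmetric] cinner_scaleC_left cinner_scaleC_right
    unfolding cinner_self power_mult_distrib of_real_mult complex_norm_square by simp
  then have "(norm (a *\<^sub>C x))\<^sup>2 = (cmod a * norm x)\<^sup>2"
    unfolding of_real_eq_iff .
  then show ?thesis by (rule power2_eq_imp_eq) auto
qed

text \<open>Multiplying \<open>x\<close> by a suitable phase makes \<open>cinner x y\<close> real and nonnegative, which reduces the
  inequality to the real one.\<close>

lemma cmod_cinner_le: "cmod (cinner x y) \<le> norm x * norm (y::'a::complex_hilbert)"
proof (cases "cinner x y = 0")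
  case False
  define a where "a = cnj (cinner x y) / complex_of_real (cmod (cinner x y))"
  have "cmod a = 1" using False by (simp add: a_def norm_divide)
  have "cinner (a *\<^sub>C x) y = complex_of_real (cmod (cinner x y))"
    using False by (simp add: a_def cinner_scaleC_left complex_norm_square [symmetric]
        power2_eq_square mult.commute)
  then have "cmod (cinner x y) = inner (a *\<^sub>C x) y"
    by (simp add: inner_eq_Re_cinner)
  also have "\<dots> \<le> norm (a *\<^sub>C x) * norm y" by (rule norm_cauchy_schwarz)
  finally show ?thesis using \<open>cmod a = 1\<close> by (simp add: norm_scaleC)
qed simp

lemma bounded_bilinear_cinner: "bounded_bilinear (cinner :: 'a::complex_hilbert \<Rightarrow> 'a \<Rightarrow> complex)"
proof
  show "\<exists>K. \<forall>a b. norm (cinner a b) \<le> norm (a::'a) * norm b * K"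
    using cmod_cinner_le by (intro exI [of _ 1]) auto
qed (auto simp: cinner_add_left cinner_add_right cinner_scaleR_left cinner_scaleR_right
      scaleR_conv_of_real)

lemma bounded_linear_scaleC: "bounded_linear (\<lambda>x::'a::complex_hilbert. a *\<^sub>C x)"
  by (intro bounded_linear_intro [of _ "cmod a"])
    (auto simp: scaleC_add_right scaleC_scaleR norm_scaleC)

lemma clinear_add: "clinear f \<Longrightarrow> f (x + y) = f x + f y"
  and clinear_scaleC: "clinear f \<Longrightarrow> f (a *\<^sub>C x) = a *\<^sub>C f x"
  by (simp_all add: clinear_def)

lemma clinear_scaleR: "clinear f \<Longrightarrow> f (r *\<^sub>R x) = r *\<^sub>R f x"
  using clinear_scaleC [of f "complex_of_real r" x] by (simp add: scaleC_of_real)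

lemma clinear_diff:
  assumes "clinear f" shows "f (x - y) = f x - f y"
  using clinear_add [OF assms, of x "- y"] clinear_scaleR [OF assms, of "-1" y] by simp

lemma cinner_preserving_norm:
  assumes "\<And>v w. cinner (f v) (f w) = cinner v w" shows "norm (f v) = norm v"
  using assms [of v v] unfolding cinner_self of_real_eq_iff by simp

section \<open>Continuous maps into topological vector spaces\<close>

lemma continuous_map_binop:
  assumes "continuous_map X euclidean f" "continuous_map X euclidean g"
    and "continuous_on UNIV (\<lambda>p. F (fst p) (snd p))"
  shows "continuous_map X euclidean (\<lambda>x. F (f x) (g x))"
proof -
  have "continuous_map X (prod_topology euclidean euclidean) (\<lambda>x. (f x, g x))"
    using assms(1,2) by (rule continuous_map_pairedI)
  moreover have "continuous_map (prod_topology euclidean euclidean) euclidean (\<lambda>p. F (fst p) (snd p))"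
    using assms(3) by simp
  ultimately have "continuous_map X euclidean ((\<lambda>p. F (fst p) (snd p)) \<circ> (\<lambda>x. (f x, g x)))"
    by (rule continuous_map_compose)
  then show ?thesis by (simp add: o_def)
qed

lemma continuous_map_unop:
  assumes "continuous_map X euclidean f" and "continuous_on UNIV F"
  shows "continuous_map X euclidean (\<lambda>x. F (f x))"
  using continuous_map_binop [OF assms(1,1), of "\<lambda>a b. F a"] assms(2)
  by (simp add: continuous_on_compose2 continuous_on_fst)

lemma continuous_map_euclidean_scaleR:
  fixes g :: "'a \<Rightarrow> 'b::real_normed_vector"
  assumes "continuous_map X euclideanreal f" "continuous_map X euclidean g"
  shows "continuous_map X euclidean (\<lambda>x. f x *\<^sub>R g x)"
  by (rule continuous_map_binop [OF assms]) (intro continuous_intros)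

lemma continuous_map_euclidean_add:
  fixes g :: "'a \<Rightarrow> 'b::real_normed_vector"
  assumes "continuous_map X euclidean f" "continuous_map X euclidean g"
  shows "continuous_map X euclidean (\<lambda>x. f x + g x)"
  by (rule continuous_map_binop [OF assms]) (intro continuous_intros)

lemma continuous_map_cinner:
  assumes "continuous_map X euclidean f" "continuous_map X euclidean g"
  shows "continuous_map X euclidean (\<lambda>x. cinner (f x) (g x))"
  by (rule continuous_map_binop [OF assms])
    (intro bounded_bilinear.continuous_on [OF bounded_bilinear_cinner] continuous_intros)

lemma continuous_map_scaleC:
  fixes f :: "'a \<Rightarrow> 'b::complex_hilbert"
  assumes "continuous_map X euclidean f"
  shows "continuous_map X euclidean (\<lambda>x. a *\<^sub>C f x)"
  by (rule continuous_map_unop [OF assms])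
    (intro linear_continuous_on bounded_linear_scaleC)

lemma bounded_on_compact:
  fixes \<phi> :: "'x \<Rightarrow> 'y::real_normed_vector"
  assumes "continuous_map X euclidean \<phi>" "compactin X A"
  obtains B where "B \<ge> 0" "\<And>x. x \<in> A \<Longrightarrow> norm (\<phi> x) \<le> B"
proof -
  have "compact (\<phi> ` A)" using image_compactin [OF assms(2,1)] by simp
  then have "bounded (\<phi> ` A)" by (rule compact_imp_bounded)
  then obtain B where "\<forall>y\<in>\<phi> ` A. norm y \<le> B" by (auto simp: bounded_iff)
  then show ?thesis by (intro that [of "max B 0"]) force+
qed

section \<open>Totally disconnected groups\<close>

text \<open>
  A second countable totally disconnected locally compact group, given by a decreasing sequence
  \<open>K 0, K 1, \<dots>\<close> of compact open subgroups that is a base of neighbourhoods of the identity. Second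
  countability enters through the countable index of these subgroups.
\<close>

locale tdlc_group = group G for G :: "('g, 'b) monoid_scheme" (structure) +
  fixes T :: "'g topology" and K :: "nat \<Rightarrow> 'g set"
  assumes topspace_eq: "topspace T = carrier G"
    and continuous_mult: "continuous_map (prod_topology T T) T (\<lambda>(x, y). x \<otimes> y)"
    and continuous_inv: "continuous_map T T (\<lambda>x. inv x)"
    and K_subgroup: "subgroup (K n) G"
    and K_openin: "openin T (K n)"
    and K_compactin: "compactin T (K n)"
    and K_decseq: "decseq K"
    and K_basis: "openin T U \<Longrightarrow> \<one> \<in> U \<Longrightarrow> \<exists>n. K n \<subseteq> U"
    and K_index: "\<exists>C. countable C \<and> C \<subseteq> carrier G \<and> carrier G = (\<Union>x\<in>C. K n #> x)"
begin

lemma K_carrier: "k \<in> K n \<Longrightarrow> k \<in> carrier G"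
  by (rule subgroup.mem_carrier [OF K_subgroup])

lemma K_mono: "m \<le> n \<Longrightarrow> K n \<subseteq> K m"
  using K_decseq by (simp add: decseq_def)

lemma K_closed:
  "\<one> \<in> K n" "k \<in> K n \<Longrightarrow> l \<in> K n \<Longrightarrow> k \<otimes> l \<in> K n" "k \<in> K n \<Longrightarrow> inv k \<in> K n"
  using K_subgroup [of n] by (simp_all add: subgroup.one_closed subgroup.m_closed subgroup.m_inv_closed)

lemma continuous_map_mult:
  assumes "continuous_map X T f" "continuous_map X T g"
  shows "continuous_map X T (\<lambda>x. f x \<otimes> g x)"
proof -
  have "continuous_map X T ((\<lambda>(x, y). x \<otimes> y) \<circ> (\<lambda>x. (f x, g x)))"
    by (rule continuous_map_compose [OF continuous_map_pairedI [OF assms] continuous_mult])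
  then show ?thesis by (simp add: o_def)
qed

lemma continuous_map_inv:
  assumes "continuous_map X T f" shows "continuous_map X T (\<lambda>x. inv (f x))"
  using continuous_map_compose [OF assms continuous_inv] by (simp add: o_def)

text \<open>Continuity is proved for functions of two variables, since \<open>tube_at_identity\<close> needs it jointly; a
  single translate is the special case of a fixed first variable.\<close>

lemma continuous_map_fix_left:
  assumes "continuous_map (prod_topology T T) Y (\<lambda>(k, x). \<Phi> k x)" "g \<in> carrier G"
  shows "continuous_map T Y (\<Phi> g)"
proof -
  have "continuous_map T (prod_topology T T) (\<lambda>x. (g, x))"
    using assms(2) by (intro continuous_map_pairedI) (auto simp: topspace_eq)
  from continuous_map_compose [OF this assms(1)] show ?thesis by (simp add: o_def)
qed

lemma continuous_map_translate:
  assumes "a \<in> carrier G"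
  shows "continuous_map T T (\<lambda>x. a \<otimes> x)" "continuous_map T T (\<lambda>x. x \<otimes> a)"
  using assms by (auto intro!: continuous_map_mult simp: topspace_eq)

lemma mem_r_coset_iff: "U \<subseteq> carrier G \<Longrightarrow> a \<in> carrier G \<Longrightarrow>
    x \<in> U #> a \<longleftrightarrow> x \<in> carrier G \<and> x \<otimes> inv a \<in> U"
  unfolding r_coset_def by (force simp: m_assoc subset_eq intro: bexI [of _ "x \<otimes> inv a"])

lemma mem_l_coset_iff: "U \<subseteq> carrier G \<Longrightarrow> a \<in> carrier G \<Longrightarrow>
    x \<in> a <# U \<longleftrightarrow> x \<in> carrier G \<and> inv a \<otimes> x \<in> U"
  unfolding l_coset_def by (force simp: m_assoc [symmetric] subset_eq intro: bexI [of _ "inv a \<otimes> x"])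

lemma openin_carrier: "openin T U \<Longrightarrow> U \<subseteq> carrier G"
  using openin_subset [of T U] topspace_eq by simp

lemma openin_r_coset:
  assumes "openin T U" "a \<in> carrier G" shows "openin T (U #> a)"
proof -
  have "U #> a = {x \<in> topspace T. x \<otimes> inv a \<in> U}"
    using mem_r_coset_iff [OF openin_carrier [OF assms(1)] assms(2)] by (auto simp: topspace_eq)
  then show ?thesis
    using openin_continuous_map_preimage [OF continuous_map_translate(2) assms(1)] assms(2) by simp
qed

lemma openin_l_coset:
  assumes "openin T U" "a \<in> carrier G" shows "openin T (a <# U)"
proof -
  have "a <# U = {x \<in> topspace T. inv a \<otimes> x \<in> U}"
    using mem_l_coset_iff [OF openin_carrier [OF assms(1)] assms(2)] by (auto simp: topspace_eq)
  then show ?thesis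
    using openin_continuous_map_preimage [OF continuous_map_translate(1) assms(1)] assms(2) by simp
qed

lemma r_coset_image: "U #> a = (\<lambda>x. x \<otimes> a) ` U"
  by (auto simp: r_coset_def)

lemma l_coset_image: "a <# U = (\<lambda>x. a \<otimes> x) ` U"
  by (auto simp: l_coset_def)

lemma compactin_r_coset: "compactin T U \<Longrightarrow> a \<in> carrier G \<Longrightarrow> compactin T (U #> a)"
  unfolding r_coset_image by (rule image_compactin [OF _ continuous_map_translate(2)])

lemma compactin_l_coset: "compactin T U \<Longrightarrow> a \<in> carrier G \<Longrightarrow> compactin T (a <# U)"
  unfolding l_coset_image by (rule image_compactin [OF _ continuous_map_translate(1)])

lemma mem_K_coset_self: "x \<in> carrier G \<Longrightarrow> x \<in> K n #> x"
  by (simp add: K_subgroup rcos_self)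

lemma K_coset_carrier: "x \<in> carrier G \<Longrightarrow> K n #> x \<subseteq> carrier G"
  by (rule openin_carrier [OF openin_r_coset [OF K_openin]])

lemma K_coset_absorb:
  assumes "x \<in> carrier G" "y \<in> K n #> x" shows "K n #> y = K n #> x"
  using repr_independence [OF assms(2,1) K_subgroup] by simp

lemma closedin_K_coset:
  assumes "x \<in> carrier G" shows "closedin T (K n #> x)"
proof -
  have "topspace T - (K n #> x) = (\<Union>y\<in>carrier G - (K n #> x). K n #> y)"
  proof (intro equalityI subsetI)
    fix z assume "z \<in> (\<Union>y\<in>carrier G - (K n #> x). K n #> y)"
    then obtain y where y: "y \<in> carrier G" "y \<notin> K n #> x" "z \<in> K n #> y" by auto
    then have "z \<in> carrier G" using K_coset_carrier by blast
    moreover have "z \<notin> K n #> x"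
      using y K_coset_absorb [OF assms, of z] K_coset_absorb [OF y(1,3)]
        mem_K_coset_self [OF y(1)] by auto
    ultimately show "z \<in> topspace T - (K n #> x)" by (simp add: topspace_eq)
  qed (auto simp: topspace_eq intro: mem_K_coset_self)
  moreover have "openin T (\<Union>y\<in>carrier G - (K n #> x). K n #> y)"
    by (intro openin_Union) (auto intro: openin_r_coset K_openin)
  ultimately show ?thesis
    using assms K_coset_carrier by (auto simp: closedin_def topspace_eq)
qed

text \<open>
  An estimate that holds for the identity and all points of a compact set \<open>L\<close> still holds for all
  \<open>k\<close> in a small compact open subgroup, uniformly on \<open>L\<close>: this is the tube lemma for \<open>{\<one>} \<times> L\<close>.
\<close>

lemma tube_at_identity:
  assumes L: "compactin T L"
    and cont: "continuous_map (prod_topology T T) euclideanreal (\<lambda>(k, x). \<Phi> k x)"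
    and less: "\<And>x. x \<in> L \<Longrightarrow> \<Phi> \<one> x < e"
  shows "\<exists>n. \<forall>k\<in>K n. \<forall>x\<in>L. \<Phi> k x < e"
proof -
  define W where "W = {p \<in> topspace (prod_topology T T). (case p of (k, x) \<Rightarrow> \<Phi> k x) \<in> {..<e}}"
  have LG: "L \<subseteq> carrier G" using L compactin_subset_topspace topspace_eq by blast
  have W: "openin (prod_topology T T) W"
    unfolding W_def by (rule openin_continuous_map_preimage [OF cont]) simp
  have "compactin T {\<one>}" by (simp add: topspace_eq)
  moreover have "{\<one>} \<times> L \<subseteq> W" using less LG by (auto simp: W_def topspace_eq)
  ultimately have "\<exists>U V. openin T U \<and> openin T V \<and> {\<one>} \<subseteq> U \<and> L \<subseteq> V \<and> U \<times> V \<subseteq> W"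
    using Wallace_theorem_prod_topology [OF _ L W] by metis
  then obtain U V where UV: "openin T U" "\<one> \<in> U" "L \<subseteq> V" "U \<times> V \<subseteq> W" by auto
  from K_basis [OF UV(1,2)] obtain n where n: "K n \<subseteq> U" ..
  have "\<Phi> k x < e" if "k \<in> K n" "x \<in> L" for k x
  proof -
    have "(k, x) \<in> W" using UV n that by auto
    then show ?thesis by (simp add: W_def)
  qed
  then show ?thesis by blast
qed

end

section \<open>Borel sets of a topological space\<close>

lemma sets_borel_of: "sets (borel_of X) = sigma_sets (topspace X) {U. openin X U}"
  and space_borel_of: "space (borel_of X) = topspace X"
proof -
  have "{U. openin X U} \<subseteq> Pow (topspace X)" by (auto dest: openin_subset)
  then show "sets (borel_of X) = sigma_sets (topspace X) {U. openin X U}"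
    "space (borel_of X) = topspace X"
    by (simp_all add: borel_of_def space_measure_of sets_measure_of)
qed

lemma openin_borel_of: "openin X U \<Longrightarrow> U \<in> sets (borel_of X)"
  by (auto simp: sets_borel_of)

lemma continuous_map_measurable_borel_of:
  assumes f: "continuous_map X Y f" and M: "sets M = sets (borel_of X)" and N: "sets N = sets (borel_of Y)"
  shows "f \<in> measurable M N"
proof -
  have sp: "space M = topspace X" "space N = topspace Y"
    using sets_eq_imp_space_eq [OF M] sets_eq_imp_space_eq [OF N] by (simp_all add: space_borel_of)
  have "f \<in> measurable M (sigma (topspace Y) {U. openin Y U})"
  proof (rule measurable_sigma_sets [where A = "{U. openin Y U}" and \<Omega> = "topspace Y"])
    fix U assume "U \<in> {U. openin Y U}"
    then have "openin X {x \<in> topspace X. f x \<in> U}" using openin_continuous_map_preimage [OF f] by simp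
    moreover have "f -` U \<inter> space M = {x \<in> topspace X. f x \<in> U}" using sp by auto
    ultimately show "f -` U \<inter> space M \<in> sets M" by (simp add: M openin_borel_of)
  next
    show "f \<in> space M \<rightarrow> topspace Y" using f sp(1) by (simp add: continuous_map_def)
    show "sets (sigma (topspace Y) {U. openin Y U}) = sigma_sets (topspace Y) {U. openin Y U}"
      using sets_borel_of [of Y] by (simp add: borel_of_def)
  qed (auto dest: openin_subset)
  then show ?thesis
    using N by (metis borel_of_def measurable_cong_sets)
qed

lemma sets_borel_euclidean: "sets borel = sets (borel_of euclidean)"
  by (simp add: sets_borel_of borel_def)

lemma continuous_map_borel_measurable:
  "continuous_map X euclidean f \<Longrightarrow> sets M = sets (borel_of X) \<Longrightarrow> f \<in> borel_measurable M"
  by (rule continuous_map_measurable_borel_of [OF _ _ sets_borel_euclidean])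

lemma continuous_map_indicator:
  assumes "openin X B" "closedin X B"
  shows "continuous_map X euclideanreal (indicator B)"
proof -
  have "openin X {x \<in> topspace X. indicator B x \<in> U}" for U :: "real set"
  proof -
    have "{x \<in> topspace X. indicator B x \<in> U} =
        (if 1 \<in> U then B else {}) \<union> (if 0 \<in> U then topspace X - B else {})"
      using openin_subset [OF assms(1)] by (auto simp: indicator_def)
    moreover have "openin X (if 1 \<in> U then B else {})" "openin X (if 0 \<in> U then topspace X - B else {})"
      using assms by (auto simp: closedin_def)
    ultimately show ?thesis by (metis openin_Un)
  qed
  then show ?thesis by (simp add: continuous_map_def)
qed

section \<open>The coset space\<close>

locale coset_space = tdlc_group G T K
  for G :: "('g, 'b) monoid_scheme" (structure) and T :: "'g topology" and K :: "nat \<Rightarrow> 'g set" +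
  fixes H :: "'g set"
  assumes H_subgroup: "subgroup H G"
begin

abbreviation GH :: "'g set topology"
  where "GH \<equiv> coset_topology G T H"

lemma H_carrier: "h \<in> H \<Longrightarrow> h \<in> carrier G"
  by (rule subgroup.mem_carrier [OF H_subgroup])

lemma H_closed:
  "\<one> \<in> H" "h \<in> H \<Longrightarrow> k \<in> H \<Longrightarrow> h \<otimes> k \<in> H" "h \<in> H \<Longrightarrow> inv h \<in> H"
  using H_subgroup by (simp_all add: subgroup.one_closed subgroup.m_closed subgroup.m_inv_closed)

lemma H_subset: "H \<subseteq> carrier G"
  using H_carrier by blast

lemma coset_in: "x \<in> carrier G \<Longrightarrow> x <# H \<in> lcosets H"
  by (auto simp: LCOSETS_def)

lemma coset_cases:
  assumes "X \<in> lcosets H" obtains x where "x \<in> carrier G" "X = x <# H"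
  using assms by (auto simp: LCOSETS_def)

lemma coset_mult_right:
  assumes "x \<in> carrier G" "h \<in> H" shows "(x \<otimes> h) <# H = x <# H"
proof -
  have "x \<otimes> h \<in> x <# H" using assms(2) by (auto simp: l_coset_def)
  then show ?thesis using l_repr_independence [OF _ assms(1) H_subgroup] by simp
qed

lemma coset_eqD:
  assumes "y \<in> carrier G" "x <# H = y <# H" "x \<in> carrier G" shows "\<exists>h\<in>H. x = y \<otimes> h"
proof -
  have "x \<in> y <# H" using lcos_self [OF assms(3) H_subgroup] assms(2) by simp
  then show ?thesis by (auto simp: l_coset_def)
qed

lemma coset_rep_mem: "X \<in> lcosets H \<Longrightarrow> coset_rep X \<in> X"
  by (erule coset_cases) (auto simp: coset_rep_def intro: someI2 lcos_self [OF _ H_subgroup])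

lemma coset_rep:
  assumes "X \<in> lcosets H"
  shows "coset_rep X \<in> carrier G" "coset_rep X <# H = X"
proof -
  obtain x where x: "x \<in> carrier G" "X = x <# H" using assms by (rule coset_cases)
  have "coset_rep X \<in> x <# H" using coset_rep_mem [OF assms] x by simp
  then obtain h where "h \<in> H" "coset_rep X = x \<otimes> h" by (auto simp: l_coset_def)
  then show "coset_rep X \<in> carrier G" "coset_rep X <# H = X"
    using x by (simp_all add: coset_mult_right H_carrier)
qed

lemma coset_rep_of:
  assumes "x \<in> carrier G" obtains h where "h \<in> H" "coset_rep (x <# H) = x \<otimes> h"
  using coset_eqD [OF assms coset_rep(2) coset_rep(1)] coset_in [OF assms] by blast

lemma translate_coset:
  "g \<in> carrier G \<Longrightarrow> x \<in> carrier G \<Longrightarrow> g <# (x <# H) = (g \<otimes> x) <# H"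
  by (rule lcos_m_assoc [OF H_subset])

lemma translate_in:
  assumes "g \<in> carrier G" "X \<in> lcosets H" shows "g <# X \<in> lcosets H"
  using assms(2) by (rule coset_cases) (simp add: assms(1) translate_coset coset_in)

lemma coset_carrier: "X \<in> lcosets H \<Longrightarrow> X \<subseteq> carrier G"
  using lcosets_part_G [OF H_subgroup] by blast

lemma translate_translate:
  assumes "g \<in> carrier G" "g' \<in> carrier G" "X \<in> lcosets H"
  shows "g <# (g' <# X) = (g \<otimes> g') <# X"
  using coset_carrier [OF assms(3)] assms(1,2) by (rule lcos_m_assoc)

lemma translate_one: "X \<in> lcosets H \<Longrightarrow> \<one> <# X = X"
  by (rule lcos_mult_one [OF coset_carrier])

lemma translate_inv:
  assumes "g \<in> carrier G" "X \<in> lcosets H"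
  shows "inv g <# (g <# X) = X" "g <# (inv g <# X) = X"
  using assms by (simp_all add: translate_translate translate_one)

lemma topspace_GH: "topspace GH = lcosets H"
proof
  show "topspace GH \<subseteq> lcosets H"
    using openin_topspace [of GH] unfolding openin_coset_topology by (rule conjunct1)
  have "{x \<in> topspace T. x <# H \<in> lcosets H} = topspace T"
    by (auto simp: topspace_eq coset_in)
  then have "openin GH (lcosets H)" by (simp add: openin_coset_topology)
  then show "lcosets H \<subseteq> topspace GH" by (rule openin_subset)
qed

lemma continuous_coset: "continuous_map T GH (\<lambda>x. x <# H)"
  by (auto simp: continuous_map_def openin_coset_topology topspace_GH topspace_eq coset_in)

lemma openin_coset_image:
  assumes "openin T U" shows "openin GH ((\<lambda>x. x <# H) ` U)"
proof -
  have U: "U \<subseteq> carrier G" by (rule openin_carrier [OF assms])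
  have "{x \<in> topspace T. x <# H \<in> (\<lambda>x. x <# H) ` U} = (\<Union>h\<in>H. U #> h)"
  proof (intro equalityI subsetI)
    fix x assume "x \<in> {x \<in> topspace T. x <# H \<in> (\<lambda>x. x <# H) ` U}"
    then obtain u where "x \<in> carrier G" "u \<in> U" "x <# H = u <# H" by (auto simp: topspace_eq)
    then obtain h where "h \<in> H" "x = u \<otimes> h" using coset_eqD U by blast
    then show "x \<in> (\<Union>h\<in>H. U #> h)" using \<open>u \<in> U\<close> by (auto simp: r_coset_def)
  next
    fix x assume "x \<in> (\<Union>h\<in>H. U #> h)"
    then obtain u h where "u \<in> U" "h \<in> H" "x = u \<otimes> h" by (auto simp: r_coset_def)
    then show "x \<in> {x \<in> topspace T. x <# H \<in> (\<lambda>x. x <# H) ` U}"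
      using U by (auto simp: topspace_eq coset_mult_right H_carrier subset_eq)
  qed
  moreover have "openin T (\<Union>h\<in>H. U #> h)"
    by (intro openin_Union) (auto intro: openin_r_coset assms H_carrier)
  ultimately show ?thesis using U by (auto simp: openin_coset_topology coset_in)
qed

lemma continuous_translate:
  assumes "g \<in> carrier G" shows "continuous_map GH GH (\<lambda>X. g <# X)"
  unfolding continuous_map_def
proof (intro conjI allI impI)
  show "(\<lambda>X. g <# X) \<in> topspace GH \<rightarrow> topspace GH"
    using assms by (auto simp: topspace_GH translate_in)
  fix U assume U: "openin GH U"
  have "{x \<in> topspace T. x <# H \<in> {X \<in> topspace GH. g <# X \<in> U}}
      = {x \<in> topspace T. g \<otimes> x \<in> {x \<in> topspace T. x <# H \<in> U}}"
    using assms by (auto simp: topspace_eq topspace_GH translate_coset coset_in)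
  moreover have "openin T {x \<in> topspace T. g \<otimes> x \<in> {x \<in> topspace T. x <# H \<in> U}}"
    using U by (intro openin_continuous_map_preimage [OF continuous_map_translate(1)] assms)
      (simp add: openin_coset_topology)
  ultimately show "openin GH {X \<in> topspace GH. g <# X \<in> U}"
    by (auto simp: openin_coset_topology topspace_GH)
qed

text \<open>Functions on \<open>G/H\<close> are handled as right \<open>H\<close>-invariant functions on \<open>G\<close>, evaluated at
  \<open>coset_rep\<close>; the next two lemmas show that neither the choice of the representative nor continuity
  causes trouble.\<close>

definition right_invariant :: "('g \<Rightarrow> 'c) \<Rightarrow> bool"
  where "right_invariant \<phi> \<longleftrightarrow> (\<forall>x\<in>carrier G. \<forall>h\<in>H. \<phi> (x \<otimes> h) = \<phi> x)"

lemma right_invariant_rep: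
  assumes "right_invariant \<phi>" "x \<in> carrier G" shows "\<phi> (coset_rep (x <# H)) = \<phi> x"
proof -
  obtain h where "h \<in> H" "coset_rep (x <# H) = x \<otimes> h" using coset_rep_of [OF assms(2)] .
  then show ?thesis using assms by (simp add: right_invariant_def)
qed

lemma continuous_right_invariant:
  assumes "right_invariant \<phi>" "continuous_map T Y \<phi>"
  shows "continuous_map GH Y (\<lambda>X. \<phi> (coset_rep X))"
  unfolding continuous_map_def
proof (intro conjI allI impI)
  show "(\<lambda>X. \<phi> (coset_rep X)) \<in> topspace GH \<rightarrow> topspace Y"
    using continuous_map_funspace [OF assms(2)] coset_rep(1)
    by (auto simp: topspace_GH topspace_eq)
  fix U assume U: "openin Y U"
  have "{x \<in> topspace T. x <# H \<in> {X \<in> topspace GH. \<phi> (coset_rep X) \<in> U}}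
      = {x \<in> topspace T. \<phi> x \<in> U}"
    using right_invariant_rep [OF assms(1)] by (auto simp: topspace_eq topspace_GH coset_in)
  then show "openin GH {X \<in> topspace GH. \<phi> (coset_rep X) \<in> U}"
    using openin_continuous_map_preimage [OF assms(2) U]
    by (auto simp: openin_coset_topology topspace_GH)
qed

text \<open>
  The orbits of the groups \<open>K n\<close> on \<open>G/H\<close> are compact and open. As the groups decrease, two orbits
  are nested or disjoint, so together with the empty set the orbits form a countable intersection-stable
  base of \<open>G/H\<close>. Two measures that are finite on orbits are therefore equal if they agree on them.
\<close>

definition orb :: "nat \<Rightarrow> 'g \<Rightarrow> 'g set set"
  where "orb n x = (\<lambda>y. y <# H) ` (K n #> x)"

lemma orb_subset: "x \<in> carrier G \<Longrightarrow> orb n x \<subseteq> lcosets H"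
  using K_coset_carrier coset_in by (auto simp: orb_def)

lemma openin_orb: "x \<in> carrier G \<Longrightarrow> openin GH (orb n x)"
  unfolding orb_def by (intro openin_coset_image openin_r_coset K_openin)

lemma compactin_orb: "x \<in> carrier G \<Longrightarrow> compactin GH (orb n x)"
  unfolding orb_def by (intro image_compactin [OF _ continuous_coset] compactin_r_coset K_compactin)

lemma mem_orb_iff: "x \<in> carrier G \<Longrightarrow> X \<in> orb n x \<longleftrightarrow> (\<exists>k\<in>K n. X = (k \<otimes> x) <# H)"
  by (auto simp: orb_def r_coset_def)

lemma orb_self: "x \<in> carrier G \<Longrightarrow> x <# H \<in> orb n x"
  by (auto simp: orb_def mem_K_coset_self)

lemma orb_translate:
  assumes "x \<in> carrier G" "k \<in> K n" "X \<in> lcosets H"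
  shows "k <# X \<in> orb n x \<longleftrightarrow> X \<in> orb n x"
proof -
  have *: "k <# X \<in> orb n x" if k: "k \<in> K n" and X: "X \<in> orb n x" for k X
  proof -
    obtain l where "l \<in> K n" "X = (l \<otimes> x) <# H" using X assms(1) by (auto simp: mem_orb_iff)
    then have "k <# X = ((k \<otimes> l) \<otimes> x) <# H" "k \<otimes> l \<in> K n"
      using assms(1) k by (simp_all add: translate_coset K_carrier m_assoc K_closed)
    then show ?thesis using assms(1) by (auto simp: mem_orb_iff)
  qed
  show ?thesis
    using * [OF assms(2)] * [OF K_closed(3) [OF assms(2)]] translate_inv [OF K_carrier [OF assms(2)] assms(3)]
    by metis
qed

lemma orb_absorb:
  assumes "x \<in> carrier G" "y \<in> carrier G" "y <# H \<in> orb n x" shows "orb n y = orb n x"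
proof -
  obtain k where k: "k \<in> K n" "y <# H = (k \<otimes> x) <# H" using assms by (auto simp: mem_orb_iff)
  have xy: "inv k <# (y <# H) = x <# H"
    using k assms by (simp add: translate_coset K_carrier m_assoc [symmetric])
  show ?thesis
  proof (intro equalityI subsetI)
    fix X assume "X \<in> orb n y"
    then obtain l where l: "l \<in> K n" "X = l <# (y <# H)"
      using assms by (auto simp: mem_orb_iff translate_coset K_carrier)
    then show "X \<in> orb n x" using assms orb_translate coset_in by simp
  next
    fix X assume "X \<in> orb n x"
    then obtain l where l: "l \<in> K n" "X = l <# (x <# H)"
      using assms by (auto simp: mem_orb_iff translate_coset K_carrier)
    have "x <# H \<in> orb n y"
      using xy orb_translate [OF assms(2) K_closed(3) [OF k(1)]] orb_self assms coset_in by metis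
    then show "X \<in> orb n y" using assms orb_translate coset_in l by simp
  qed
qed

lemma orb_mono:
  assumes "m \<le> n" "x \<in> carrier G" shows "orb n x \<subseteq> orb m x"
  using K_mono [OF assms(1)] by (auto simp: orb_def r_coset_def)

lemma orb_nested:
  assumes "x \<in> carrier G" "y \<in> carrier G" "m \<le> n"
  shows "orb n x \<inter> orb m y = {} \<or> orb n x \<subseteq> orb m y"
proof (cases "orb n x \<inter> orb m y = {}")
  case False
  then obtain X where X: "X \<in> orb n x" "X \<in> orb m y" by auto
  then obtain z where z: "z \<in> carrier G" "X = z <# H"
    using orb_subset [OF assms(1)] by (rule_tac coset_cases [of X]) auto
  have "orb n x = orb n z" "orb m y = orb m z" using orb_absorb [OF assms(1) z(1)] orb_absorb [OF assms(2) z(1)] z X by auto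
  then show ?thesis using orb_mono assms z by simp
qed simp

lemma countable_orbs: "countable {orb n x |n x. x \<in> carrier G}"
proof -
  have "\<exists>C. countable C \<and> C \<subseteq> carrier G \<and> carrier G = (\<Union>x\<in>C. K n #> x)" for n
    by (rule K_index)
  then obtain C where C: "\<And>n. countable (C n)" "\<And>n. C n \<subseteq> carrier G"
      "\<And>n. carrier G = (\<Union>x\<in>C n. K n #> x)" by metis
  have "{orb n x |n x. x \<in> carrier G} \<subseteq> (\<Union>n. orb n ` C n)"
  proof safe
    fix n x assume x: "x \<in> carrier G"
    then obtain c where c: "c \<in> C n" "x \<in> K n #> c" using C(3) [of n] by auto
    then have "orb n x = orb n c"
      using K_coset_absorb [of c x n] C(2) [of n] by (auto simp: orb_def)
    then show "orb n x \<in> (\<Union>n. orb n ` C n)" using c by auto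
  qed
  then show ?thesis by (rule countable_subset) (simp add: C(1))
qed

lemma openin_orb_base:
  assumes "openin GH V" "X \<in> V" shows "\<exists>n x. x \<in> carrier G \<and> X \<in> orb n x \<and> orb n x \<subseteq> V"
proof -
  have V: "V \<subseteq> lcosets H" "openin T {x \<in> topspace T. x <# H \<in> V}"
    using assms(1) by (simp_all add: openin_coset_topology)
  obtain x where x: "x \<in> carrier G" "X = x <# H" using assms(2) V(1) by (rule_tac coset_cases [of X]) auto
  define U where "U = {x \<in> topspace T. x <# H \<in> V} #> inv x"
  have U: "openin T U" unfolding U_def using V(2) x(1) by (intro openin_r_coset) auto
  have sub: "{x \<in> topspace T. x <# H \<in> V} \<subseteq> carrier G" by (auto simp: topspace_eq)
  have "\<one> \<in> U"
    unfolding U_def using x assms(2) by (subst mem_r_coset_iff [OF sub]) (auto simp: topspace_eq)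
  then obtain n where n: "K n \<subseteq> U" using K_basis [OF U] by auto
  have "orb n x \<subseteq> V"
  proof
    fix Y assume "Y \<in> orb n x"
    then obtain k where "k \<in> K n" "Y = (k \<otimes> x) <# H" using x(1) by (auto simp: mem_orb_iff)
    moreover then have "k \<in> U" using n by auto
    ultimately show "Y \<in> V" using x(1) by (simp add: U_def mem_r_coset_iff [OF sub])
  qed
  then show ?thesis using x orb_self [OF x(1)] by metis
qed

abbreviation orbs :: "'g set set set"
  where "orbs \<equiv> insert {} {orb n x |n x. x \<in> carrier G}"

lemma sets_borel_GH: "sets (borel_of GH) = sigma_sets (lcosets H) orbs"
proof -
  have "sets (borel_of GH) = sigma_sets (lcosets H) {U. openin GH U}"
    unfolding borel_of_def topspace_GH
    using openin_subset [of GH] by (intro sets_measure_of) (auto simp: topspace_GH)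
  also have "\<dots> = sigma_sets (lcosets H) orbs"
  proof (rule sigma_sets_eqI)
    fix V assume "V \<in> {U. openin GH U}"
    then have V: "openin GH V" by simp
    define D where "D = {A \<in> {orb n x |n x. x \<in> carrier G}. A \<subseteq> V}"
    have VD: "V = \<Union>D" using openin_orb_base [OF V] unfolding D_def by (fast | blast)
    have cD: "countable D" unfolding D_def
      by (rule countable_subset [OF _ countable_orbs]) auto
    have "D \<subseteq> sigma_sets (lcosets H) orbs" unfolding D_def by auto
    then show "V \<in> sigma_sets (lcosets H) orbs"
      unfolding VD by (intro sigma_sets_UNION [OF cD]) auto
  next
    fix A assume "A \<in> orbs"
    then show "A \<in> sigma_sets (lcosets H) {U. openin GH U}"
      using openin_orb by auto
  qed
  finally show ?thesis .
qed

lemma Int_stable_orbs: "Int_stable orbs"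
proof (rule Int_stableI)
  fix A B assume "A \<in> orbs" "B \<in> orbs"
  then consider "A = {} \<or> B = {}"
    | m n x y where "A = orb m x" "B = orb n y" "x \<in> carrier G" "y \<in> carrier G"
    by blast
  then show "A \<inter> B \<in> orbs"
  proof cases
    case 2
    have "A \<inter> B = {} \<or> A \<inter> B = A \<or> A \<inter> B = B"
      using orb_nested [OF 2(3,4), of n m] orb_nested [OF 2(4,3), of m n] 2(1,2)
      by (cases "n \<le> m") auto
    then show ?thesis using \<open>A \<in> orbs\<close> \<open>B \<in> orbs\<close> by auto
  qed auto
qed

end

section \<open>The quasi-invariant measure on the coset space\<close>

locale rho_space = coset_space G T K H
  for G :: "('g, 'b) monoid_scheme" (structure) and T :: "'g topology" and K :: "nat \<Rightarrow> 'g set"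
    and H :: "'g set" +
  fixes m\<^sub>G m\<^sub>H :: "'g measure" and \<Delta>\<^sub>G \<Delta>\<^sub>H \<rho> :: "'g \<Rightarrow> real" and \<mu> :: "'g set measure"
  assumes H_closedin: "closedin T H"
    and haar_G: "left_haar_measure G T m\<^sub>G"
    and haar_H: "left_haar_measure (G\<lparr>carrier := H\<rparr>) (subtopology T H) m\<^sub>H"
    and rho: "rho_function G T H \<Delta>\<^sub>G \<Delta>\<^sub>H \<rho>"
    and mu: "rho_measure G T H m\<^sub>G m\<^sub>H \<rho> \<mu>"
begin

lemma sets_mG: "sets m\<^sub>G = sets (borel_of T)" and space_mG: "space m\<^sub>G = carrier G"
proof -
  show *: "sets m\<^sub>G = sets (borel_of T)"
    using haar_G by (simp add: left_haar_measure_def regular_borel_measure_def)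
  show "space m\<^sub>G = carrier G"
    using sets_eq_imp_space_eq [OF *] by (simp add: space_borel_of topspace_eq)
qed

lemma sets_mH: "sets m\<^sub>H = sets (borel_of (subtopology T H))" and space_mH: "space m\<^sub>H = H"
proof -
  show *: "sets m\<^sub>H = sets (borel_of (subtopology T H))"
    using haar_H by (simp add: left_haar_measure_def regular_borel_measure_def)
  show "space m\<^sub>H = H"
    using sets_eq_imp_space_eq [OF *] H_subset by (auto simp: space_borel_of topspace_eq)
qed

lemma sets_mu: "sets \<mu> = sets (borel_of GH)" and space_mu: "space \<mu> = lcosets H"
proof -
  show *: "sets \<mu> = sets (borel_of GH)"
    using mu by (simp add: rho_measure_def regular_borel_measure_def)
  show "space \<mu> = lcosets H"
    using sets_eq_imp_space_eq [OF *] by (simp add: space_borel_of topspace_GH)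
qed

lemma openin_mu: "openin GH U \<Longrightarrow> U \<in> sets \<mu>"
  by (simp add: sets_mu openin_borel_of)

lemma compact_mu_finite: "compactin GH A \<Longrightarrow> emeasure \<mu> A < \<infinity>"
  using mu by (simp add: rho_measure_def regular_borel_measure_def)

lemma orb_sets: "x \<in> carrier G \<Longrightarrow> orb n x \<in> sets \<mu>"
  and orb_finite: "x \<in> carrier G \<Longrightarrow> emeasure \<mu> (orb n x) < \<infinity>"
  using openin_mu [OF openin_orb] compact_mu_finite [OF compactin_orb] by auto

lemma rho_pos: "x \<in> carrier G \<Longrightarrow> \<rho> x > 0"
  and rho_mult: "x \<in> carrier G \<Longrightarrow> h \<in> H \<Longrightarrow> \<rho> (x \<otimes> h) = \<Delta>\<^sub>H h / \<Delta>\<^sub>G h * \<rho> x"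
  and rho_continuous: "continuous_map T euclideanreal \<rho>"
  using rho by (simp_all add: rho_function_def)

text \<open>
  \<open>R g\<close> is the density of the translated measure \<open>g\<inverse>\<mu>\<close> with respect to \<open>\<mu>\<close>; see
  \<open>quasi_invariance\<close> below. \<open>R_mult\<close> is its cocycle identity.
\<close>

definition R :: "'g \<Rightarrow> 'g \<Rightarrow> real"
  where "R g x = \<rho> (g \<otimes> x) / \<rho> x"

lemma R_pos: "g \<in> carrier G \<Longrightarrow> x \<in> carrier G \<Longrightarrow> R g x > 0"
  by (simp add: R_def rho_pos)

lemma R_mult: "g \<in> carrier G \<Longrightarrow> g' \<in> carrier G \<Longrightarrow> x \<in> carrier G \<Longrightarrow> R (g \<otimes> g') x = R g (g' \<otimes> x) * R g' x"
  using rho_pos [of "g' \<otimes> x"] by (simp add: R_def m_assoc)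

lemma R_one: "x \<in> carrier G \<Longrightarrow> R \<one> x = 1"
  using rho_pos [of x] by (simp add: R_def)

text \<open>The factor \<open>\<Delta>\<^sub>H h / \<Delta>\<^sub>G h\<close> appears in the numerator and the denominator of \<open>R g (x \<otimes> h)\<close>; it is not
  zero because \<open>\<rho>\<close> is positive.\<close>

lemma R_right_invariant: "g \<in> carrier G \<Longrightarrow> right_invariant (R g)"
  unfolding right_invariant_def
proof (intro ballI)
  fix x h assume x: "g \<in> carrier G" "x \<in> carrier G" "h \<in> H"
  have "\<rho> (x \<otimes> h) > 0" using x by (simp add: rho_pos H_carrier)
  then have "\<Delta>\<^sub>H h / \<Delta>\<^sub>G h \<noteq> 0" using rho_mult [OF x(2,3)] by auto
  moreover have "\<rho> (g \<otimes> (x \<otimes> h)) = \<Delta>\<^sub>H h / \<Delta>\<^sub>G h * \<rho> (g \<otimes> x)"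
    using rho_mult [of "g \<otimes> x" h] x by (simp add: m_assoc H_carrier)
  ultimately show "R g (x \<otimes> h) = R g x"
    using rho_mult [OF x(2,3)] by (simp add: R_def)
qed

lemma R_continuous_pair:
  "continuous_map (prod_topology T T) euclideanreal (\<lambda>(k, x). R k x)"
proof -
  have "continuous_map (prod_topology T T) euclideanreal (\<lambda>p. \<rho> (fst p \<otimes> snd p))"
    using continuous_map_compose [OF continuous_map_mult [OF continuous_map_fst continuous_map_snd] rho_continuous]
    by (simp add: o_def)
  moreover have "continuous_map (prod_topology T T) euclideanreal (\<lambda>p. \<rho> (snd p))"
    using continuous_map_compose [OF continuous_map_snd rho_continuous] by (simp add: o_def)
  ultimately have "continuous_map (prod_topology T T) euclideanreal (\<lambda>p. \<rho> (fst p \<otimes> snd p) / \<rho> (snd p))"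
  proof (rule continuous_map_real_divide)
    fix p assume "p \<in> topspace (prod_topology T T)"
    then show "\<rho> (snd p) \<noteq> 0" using rho_pos [of "snd p"] by (auto simp: topspace_eq)
  qed
  then show ?thesis by (simp add: R_def case_prod_beta')
qed

lemma R_continuous: "g \<in> carrier G \<Longrightarrow> continuous_map T euclideanreal (R g)"
  by (rule continuous_map_fix_left [OF R_continuous_pair])

lemma R_rep: "g \<in> carrier G \<Longrightarrow> x \<in> carrier G \<Longrightarrow> R g (coset_rep (x <# H)) = R g x"
  by (rule right_invariant_rep [OF R_right_invariant])

lemma measurable_right_invariant:
  assumes "right_invariant \<phi>" "continuous_map T euclidean \<phi>"
  shows "(\<lambda>X. \<phi> (coset_rep X)) \<in> borel_measurable \<mu>"
  by (rule continuous_map_borel_measurable [OF continuous_right_invariant [OF assms] sets_mu])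

lemma R_measurable [measurable]: "g \<in> carrier G \<Longrightarrow> (\<lambda>X. R g (coset_rep X)) \<in> borel_measurable \<mu>"
  by (intro measurable_right_invariant R_right_invariant R_continuous)

lemma translate_measurable [measurable]: "g \<in> carrier G \<Longrightarrow> (\<lambda>X. g <# X) \<in> measurable \<mu> \<mu>"
  by (rule continuous_map_measurable_borel_of [OF continuous_translate sets_mu sets_mu])

lemma translate_set_eq:
  assumes "g \<in> carrier G" "A \<subseteq> lcosets H"
  shows "(\<lambda>X. g <# X) ` A = {X \<in> lcosets H. inv g <# X \<in> A}"
  using assms translate_in translate_inv by (auto simp: subset_eq image_iff) metis+

lemma translate_sets: "g \<in> carrier G \<Longrightarrow> A \<in> sets \<mu> \<Longrightarrow> (\<lambda>X. g <# X) ` A \<in> sets \<mu>"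
  using translate_set_eq [of g A] measurable_sets [OF translate_measurable [of "inv g"], of A]
    sets.sets_into_space [of A \<mu>]
  by (simp add: space_mu vimage_def Int_def conj_commute)

text \<open>
  The compact open subgroup \<open>H \<inter> x\<inverse>(K n)x\<close> of \<open>H\<close>. Its Haar measure is the constant by which the
  integral over \<open>K n #> x\<close> in \<open>G\<close> and the integral over \<open>orb n x\<close> in \<open>G/H\<close> differ.
\<close>

definition stab :: "nat \<Rightarrow> 'g \<Rightarrow> 'g set"
  where "stab n x = {h \<in> H. x \<otimes> h \<in> K n #> x}"

lemma stab_eq:
  assumes "x \<in> carrier G" shows "stab n x = H \<inter> (inv x <# (K n #> x))"
  using mem_l_coset_iff [OF K_coset_carrier [OF assms], of "inv x"] assms
  by (auto simp: stab_def H_carrier)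

lemma stab_one: "x \<in> carrier G \<Longrightarrow> \<one> \<in> stab n x"
  by (simp add: stab_def H_closed mem_K_coset_self)

lemma openin_stab: "x \<in> carrier G \<Longrightarrow> openin (subtopology T H) (stab n x)"
  unfolding stab_eq by (intro openin_subtopology_Int2 openin_l_coset openin_r_coset K_openin) auto

lemma compactin_stab: "x \<in> carrier G \<Longrightarrow> compactin (subtopology T H) (stab n x)"
  unfolding compactin_subtopology stab_eq
  by (auto intro!: closed_Int_compactin H_closedin compactin_l_coset compactin_r_coset K_compactin)

lemma haar_H_translate:
  assumes "h \<in> H" "A \<in> sets m\<^sub>H" shows "emeasure m\<^sub>H (h <# A) = emeasure m\<^sub>H A"
  using haar_H assms by (simp add: left_haar_measure_def)

lemma stab_sets: "x \<in> carrier G \<Longrightarrow> stab n x \<in> sets m\<^sub>H"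
  by (simp add: sets_mH openin_borel_of openin_stab)

lemma stab_finite: "x \<in> carrier G \<Longrightarrow> emeasure m\<^sub>H (stab n x) < \<infinity>"
  using haar_H compactin_stab by (simp add: left_haar_measure_def regular_borel_measure_def)

text \<open>If this open set were null, then so would be all compact subsets of \<open>H\<close>, being covered by finitely
  many of its translates, and by inner regularity \<open>H\<close> itself.\<close>

lemma stab_positive:
  assumes "x \<in> carrier G" shows "emeasure m\<^sub>H (stab n x) \<noteq> 0"
proof
  assume zero: "emeasure m\<^sub>H (stab n x) = 0"
  have tr: "openin (subtopology T H) (h <# stab n x)" if "h \<in> H" for h
  proof -
    have "h <# stab n x = H \<inter> (h <# (inv x <# (K n #> x)))"
    proof -
      have sub: "inv x <# (K n #> x) \<subseteq> carrier G"
        using assms K_coset_carrier by (intro l_coset_subset_G) auto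
      have sub': "stab n x \<subseteq> carrier G" using H_subset by (auto simp: stab_def)
      show ?thesis
        using mem_l_coset_iff [OF sub H_carrier [OF that]] mem_l_coset_iff [OF sub' H_carrier [OF that]]
        unfolding stab_eq [OF assms] 
        using H_closed that H_carrier
        by (auto) (metis H_carrier H_closed inv_solve_left m_closed inv_closed)
    qed
    moreover have "openin T (h <# (inv x <# (K n #> x)))"
      by (intro openin_l_coset openin_r_coset K_openin H_carrier that inv_closed assms)
    ultimately show ?thesis by (simp add: openin_subtopology_Int2)
  qed
  have null: "emeasure m\<^sub>H C = 0" if C: "compactin (subtopology T H) C" for C
  proof -
    have CH: "C \<subseteq> H" using compactin_subset_topspace [OF C] by auto
    have "\<exists>\<F>. finite \<F> \<and> \<F> \<subseteq> (\<lambda>h. h <# stab n x) ` H \<and> C \<subseteq> \<Union>\<F>"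
    proof (rule compactinD [OF C])
      show "C \<subseteq> \<Union> ((\<lambda>h. h <# stab n x) ` H)"
      proof
        fix h assume "h \<in> C"
        then have "h \<in> H" using CH by auto
        moreover then have "h \<in> h <# stab n x"
          using stab_one [OF assms, of n] by (force simp: l_coset_def H_carrier)
        ultimately show "h \<in> \<Union> ((\<lambda>h. h <# stab n x) ` H)" by auto
      qed
    qed (auto intro: tr)
    then obtain D where D: "finite D" "D \<subseteq> H" "C \<subseteq> (\<Union>h\<in>D. h <# stab n x)"
      by (metis finite_subset_image)
    have null: "h <# stab n x \<in> null_sets m\<^sub>H" if "h \<in> H" for h
      using that zero haar_H_translate [OF that stab_sets [OF assms]] tr [OF that]
      by (auto intro!: null_setsI simp: sets_mH openin_borel_of)
    have "(\<Union>h\<in>D. h <# stab n x) \<in> null_sets m\<^sub>H"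
      using D(1,2) null by (intro null_sets.finite_UN) auto
    then show ?thesis
      by (metis D(3) emeasure_eq_0 null_setsD1 null_setsD2)
  qed
  have "openin (subtopology T H) H"
    using H_subset by (metis openin_topspace topspace_subtopology_subset topspace_eq)
  then have "emeasure m\<^sub>H H = (SUP C\<in>{C. compactin (subtopology T H) C \<and> C \<subseteq> H}. emeasure m\<^sub>H C)"
    using haar_H by (simp add: left_haar_measure_def regular_borel_measure_def)
  also have "\<dots> = 0" using null by (intro antisym SUP_least) auto
  finally show False using haar_H by (simp add: left_haar_measure_def)
qed

lemma measure_stab_pos: "x \<in> carrier G \<Longrightarrow> measure m\<^sub>H (stab n x) > 0"
  using stab_positive [of x n] stab_finite [of x n]
  by (simp add: measure_def enn2real_positive_iff zero_less_iff_neq_zero)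

lemma haar_G_translate:
  assumes "g \<in> carrier G" shows "distr m\<^sub>G m\<^sub>G (\<lambda>x. g \<otimes> x) = m\<^sub>G"
proof (rule measure_eqI)
  have meas: "(\<lambda>x. g \<otimes> x) \<in> measurable m\<^sub>G m\<^sub>G"
    by (rule continuous_map_measurable_borel_of [OF continuous_map_translate(1) [OF assms] sets_mG sets_mG])
  fix A assume "A \<in> sets (distr m\<^sub>G m\<^sub>G (\<lambda>x. g \<otimes> x))"
  then have A: "A \<in> sets m\<^sub>G" by simp
  then have AG: "A \<subseteq> carrier G" using sets.sets_into_space space_mG by blast
  have "(\<lambda>x. g \<otimes> x) -` A \<inter> space m\<^sub>G = inv g <# A"
    using mem_l_coset_iff [OF AG, of "inv g"] assms by (auto simp: space_mG)
  then have "emeasure (distr m\<^sub>G m\<^sub>G (\<lambda>x. g \<otimes> x)) A = emeasure m\<^sub>G (inv g <# A)"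
    using emeasure_distr [OF meas A] by simp
  also have "\<dots> = emeasure m\<^sub>G A"
    using haar_G assms A by (simp add: left_haar_measure_def)
  finally show "emeasure (distr m\<^sub>G m\<^sub>G (\<lambda>x. g \<otimes> x)) A = emeasure m\<^sub>G A" .
qed simp

text \<open>The defining formula of \<open>\<mu>\<close> for the function \<open>f = 1\<^sub>B u\<close> with \<open>B = g(K n)x\<close>. The inner integral over
  \<open>H\<close> at \<open>y\<close> is \<open>u y\<close> times the Haar measure of \<open>{h. yh \<in> B}\<close>. This set is empty unless \<open>yH\<close> lies in
  \<open>g(orb n x)\<close>, in which case it is a left translate of \<open>stab n x\<close>.\<close>

lemma rho_formula:
  assumes g: "g \<in> carrier G" and x: "x \<in> carrier G"
    and u: "right_invariant u" "continuous_map T euclideanreal u"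
  shows "(\<integral>y. indicator (g <# (K n #> x)) y * u y * \<rho> y \<partial>m\<^sub>G) =
    measure m\<^sub>H (stab n x) * (\<integral>X. indicator ((\<lambda>X. g <# X) ` orb n x) X * u (coset_rep X) \<partial>\<mu>)"
proof -
  define B where "B = g <# (K n #> x)"
  define f where "f y = complex_of_real (indicator B y * u y)" for y
  have BG: "B \<subseteq> carrier G" using g x K_coset_carrier by (simp add: B_def l_coset_subset_G)
  have B_open: "openin T B" unfolding B_def by (intro openin_l_coset openin_r_coset K_openin g x)
  have B_compact: "compactin T B" unfolding B_def by (intro compactin_l_coset compactin_r_coset K_compactin g x)
  have "B = {y \<in> topspace T. inv g \<otimes> y \<in> K n #> x}"
    using mem_l_coset_iff [OF K_coset_carrier [OF x] g] by (auto simp: B_def topspace_eq)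
  then have B_closed: "closedin T B"
    using closedin_continuous_map_preimage [OF continuous_map_translate(1) closedin_K_coset [OF x], of "inv g"] g
    by simp
  have "continuous_map T euclideanreal (\<lambda>y. indicator B y * u y)"
    by (intro continuous_map_real_mult continuous_map_indicator B_open B_closed u(2))
  then have "continuous_map T euclidean f"
    unfolding f_def by (rule continuous_map_unop) (intro continuous_intros)
  moreover have "compactin T (T closure_of {y \<in> topspace T. f y \<noteq> 0})"
  proof (rule closed_compactin [OF B_compact])
    show "T closure_of {y \<in> topspace T. f y \<noteq> 0} \<subseteq> B"
      by (rule closure_of_minimal [OF _ B_closed]) (auto simp: f_def indicator_def split: if_splits)
  qed simp
  ultimately have "f \<in> Cc T" by (simp add: Cc_def)
  then have "(\<integral>y. f y * complex_of_real (\<rho> y) \<partial>m\<^sub>G) =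
      (\<integral>X. (\<integral>h. f (coset_rep X \<otimes> h) \<partial>m\<^sub>H) \<partial>\<mu>)"
    using mu by (simp add: rho_measure_def)
  also have "\<dots> = (\<integral>X. complex_of_real (measure m\<^sub>H (stab n x) *
      (indicator ((\<lambda>X. g <# X) ` orb n x) X * u (coset_rep X))) \<partial>\<mu>)"
  proof (rule Bochner_Integration.integral_cong [OF refl])
    fix X assume "X \<in> space \<mu>"
    then have X: "X \<in> lcosets H" by (simp add: space_mu)
    define y where "y = coset_rep X"
    have y: "y \<in> carrier G" "y <# H = X" using coset_rep [OF X] by (simp_all add: y_def)
    define S where "S = {h \<in> H. y \<otimes> h \<in> B}"
    have memB: "z \<in> B \<longleftrightarrow> inv g \<otimes> z \<in> K n #> x" if "z \<in> carrier G" for z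
      using mem_l_coset_iff [OF K_coset_carrier [OF x] g] that by (simp add: B_def)
    have S: "emeasure m\<^sub>H S = (if X \<in> (\<lambda>X. g <# X) ` orb n x then emeasure m\<^sub>H (stab n x) else 0)
        \<and> S \<in> sets m\<^sub>H"
    proof (cases "S = {}")
      case True
      have "X \<notin> (\<lambda>X. g <# X) ` orb n x"
      proof
        assume "X \<in> (\<lambda>X. g <# X) ` orb n x"
        then obtain k where k: "k \<in> K n" "X = g <# ((k \<otimes> x) <# H)" using x by (auto simp: mem_orb_iff)
        then have "y <# H = (g \<otimes> (k \<otimes> x)) <# H" using g x y by (simp add: translate_coset K_carrier)
        then obtain h where h: "h \<in> H" "g \<otimes> (k \<otimes> x) = y \<otimes> h"
          using coset_eqD [OF y(1), of "g \<otimes> (k \<otimes> x)"] g x k by (auto simp: K_carrier)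
        have "inv g \<otimes> (y \<otimes> h) = k \<otimes> x"
          using h(2) g x k y(1) by (simp add: h(2) [symmetric] K_carrier m_assoc [symmetric])
        then have "h \<in> S" using h y k by (auto simp: S_def memB H_carrier r_coset_def)
        then show False using True by simp
      qed
      then show ?thesis using True by simp
    next
      case False
      then obtain h0 where h0: "h0 \<in> H" "y \<otimes> h0 \<in> B" by (auto simp: S_def)
      then obtain k where k: "k \<in> K n" "inv g \<otimes> (y \<otimes> h0) = k \<otimes> x"
        using y by (auto simp: memB H_carrier r_coset_def)
      have yh: "y \<otimes> h0 = g \<otimes> (k \<otimes> x)"
        using k g x y h0 by (simp add: k(2) [symmetric] H_carrier m_assoc [symmetric])
      have "X = g <# ((k \<otimes> x) <# H)"
        using y h0 coset_mult_right [OF y(1) h0(1)] g x k by (simp add: yh translate_coset K_carrier)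
      moreover have "(k \<otimes> x) <# H \<in> orb n x" using k x by (auto simp: mem_orb_iff)
      ultimately have "X \<in> (\<lambda>X. g <# X) ` orb n x" by blast
      moreover have "S = h0 <# stab n x"
      proof -
        have "h \<in> S \<longleftrightarrow> h \<in> h0 <# stab n x" for h
        proof (cases "h \<in> H")
          case True
          define l where "l = inv h0 \<otimes> h"
          have l: "l \<in> H" "h = h0 \<otimes> l"
            using True h0 by (simp_all add: l_def H_closed H_carrier m_assoc [symmetric])
          have "inv g \<otimes> (y \<otimes> h) = inv g \<otimes> ((y \<otimes> h0) \<otimes> l)"
            using l h0 y by (simp add: H_carrier m_assoc)
          also have "\<dots> = k \<otimes> (x \<otimes> l)"
            using g k(1) x l(1) unfolding yh by (simp add: H_carrier K_carrier m_assoc [symmetric])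
          finally have "h \<in> S \<longleftrightarrow> k \<otimes> (x \<otimes> l) \<in> K n #> x"
            using True y by (simp add: S_def memB H_carrier)
          also have "\<dots> \<longleftrightarrow> x \<otimes> l \<in> K n #> x"
          proof -
            have *: "k' \<otimes> z \<in> K n #> x" if k': "k' \<in> K n" and z: "z \<in> K n #> x" for k' z
            proof -
              obtain j where "j \<in> K n" "z = j \<otimes> x" using z by (auto simp: r_coset_def)
              then have "k' \<otimes> j \<in> K n" "k' \<otimes> z = (k' \<otimes> j) \<otimes> x"
                using k' x by (simp_all add: K_closed K_carrier m_assoc)
              then show ?thesis by (auto simp: r_coset_def)
            qed
            have "inv k \<otimes> (k \<otimes> (x \<otimes> l)) = x \<otimes> l"
              using k(1) x l(1) by (simp add: m_assoc [symmetric] K_carrier H_carrier)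
            then show ?thesis using * [OF k(1)] * [OF K_closed(3) [OF k(1)]] by metis
          qed
          also have "\<dots> \<longleftrightarrow> h \<in> h0 <# stab n x"
          proof -
            have "stab n x \<subseteq> carrier G" using H_carrier by (auto simp: stab_def)
            then show ?thesis
              using mem_l_coset_iff [OF _ H_carrier [OF h0(1)], of "stab n x" h] l(1) H_carrier [OF True]
              unfolding l_def [symmetric] by (simp add: stab_def)
          qed
          finally show ?thesis .
        next
          case False
          then show ?thesis using h0 by (auto simp: S_def l_coset_def stab_def H_closed)
        qed
        then show ?thesis by blast
      qed
      moreover have "S \<in> sets m\<^sub>H"
      proof -
        have "S = H \<inter> {h \<in> topspace T. y \<otimes> h \<in> B}" using H_subset by (auto simp: S_def topspace_eq)
        then have "openin (subtopology T H) S"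
          using openin_continuous_map_preimage [OF continuous_map_translate(1) [OF y(1)] B_open]
          by (metis openin_subtopology_Int2)
        then show ?thesis by (simp add: sets_mH openin_borel_of)
      qed
      ultimately show ?thesis using haar_H_translate [OF h0(1) stab_sets [OF x]] by simp
    qed
    have "(\<integral>h. f (y \<otimes> h) \<partial>m\<^sub>H) = (\<integral>h. complex_of_real (u y * indicator S h) \<partial>m\<^sub>H)"
      using u(1) y(1)
      by (intro Bochner_Integration.integral_cong refl)
        (auto simp: f_def space_mH S_def indicator_def right_invariant_def)
    also have "\<dots> = complex_of_real (u y) * measure m\<^sub>H S"
    proof -
      have "emeasure m\<^sub>H S < \<infinity>" using S stab_finite [OF x, of n] by (auto split: if_splits)
      then show ?thesis using S unfolding integral_complex_of_real by simp
    qed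
    also have "measure m\<^sub>H S = measure m\<^sub>H (stab n x) * indicator ((\<lambda>X. g <# X) ` orb n x) X"
      using S by (auto simp: measure_def)
    finally show "(\<integral>h. f (coset_rep X \<otimes> h) \<partial>m\<^sub>H) = complex_of_real (measure m\<^sub>H (stab n x) *
        (indicator ((\<lambda>X. g <# X) ` orb n x) X * u (coset_rep X)))"
      by (simp add: y_def mult_ac)
  qed
  finally have "(\<integral>y. complex_of_real (indicator B y * u y * \<rho> y) \<partial>m\<^sub>G) =
      (\<integral>X. complex_of_real (measure m\<^sub>H (stab n x) *
      (indicator ((\<lambda>X. g <# X) ` orb n x) X * u (coset_rep X))) \<partial>\<mu>)"
    by (simp add: f_def mult_ac)
  then show ?thesis
    unfolding integral_complex_of_real of_real_eq_iff B_def by simp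
qed

text \<open>Both sides, multiplied by the Haar measure of \<open>stab n x\<close>, are integrals over \<open>G\<close> by
  \<open>rho_formula\<close>; left invariance of the Haar measure of \<open>G\<close> carries one into the other.\<close>

lemma integral_orb_translate:
  assumes g: "g \<in> carrier G" and x: "x \<in> carrier G"
  shows "(\<integral>X. indicator ((\<lambda>X. g <# X) ` orb n x) X \<partial>\<mu>) =
    (\<integral>X. indicator (orb n x) X * R g (coset_rep X) \<partial>\<mu> :: real)"
proof -
  let ?c = "measure m\<^sub>H (stab n x)"
  have Kx: "K n #> x \<subseteq> carrier G" by (rule K_coset_carrier [OF x])
  have id: "(\<lambda>X. \<one> <# X) ` orb n x = orb n x" "\<one> <# (K n #> x) = K n #> x"
    using orb_subset [OF x] translate_one Kx by (force, simp add: lcos_mult_one)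
  have "?c * (\<integral>X. indicator ((\<lambda>X. g <# X) ` orb n x) X \<partial>\<mu>) =
      (\<integral>y. indicator (g <# (K n #> x)) y * \<rho> y \<partial>m\<^sub>G)"
    using rho_formula [OF g x, of "\<lambda>_. 1" n] by (simp add: right_invariant_def)
  also have "\<dots> = (\<integral>y. indicator (g <# (K n #> x)) y * \<rho> y \<partial>distr m\<^sub>G m\<^sub>G (\<lambda>x. g \<otimes> x))"
    by (simp add: haar_G_translate g)
  also have "\<dots> = (\<integral>y. indicator (g <# (K n #> x)) (g \<otimes> y) * \<rho> (g \<otimes> y) \<partial>m\<^sub>G)"
  proof (rule integral_distr)
    show "(\<lambda>x. g \<otimes> x) \<in> measurable m\<^sub>G m\<^sub>G"
      by (rule continuous_map_measurable_borel_of [OF continuous_map_translate(1) [OF g] sets_mG sets_mG])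
    have "g <# (K n #> x) \<in> sets m\<^sub>G"
      by (simp add: sets_mG openin_borel_of openin_l_coset openin_r_coset K_openin g x)
    moreover have "\<rho> \<in> borel_measurable m\<^sub>G"
      by (rule continuous_map_borel_measurable [OF rho_continuous sets_mG])
    ultimately show "(\<lambda>y. indicator (g <# (K n #> x)) y * \<rho> y) \<in> borel_measurable m\<^sub>G" by measurable
  qed
  also have "\<dots> = (\<integral>y. indicator (K n #> x) y * R g y * \<rho> y \<partial>m\<^sub>G)"
  proof (rule Bochner_Integration.integral_cong [OF refl])
    fix y assume "y \<in> space m\<^sub>G"
    then have y: "y \<in> carrier G" by (simp add: space_mG)
    have "g \<otimes> y \<in> g <# (K n #> x) \<longleftrightarrow> y \<in> K n #> x"
      using mem_l_coset_iff [OF Kx g, of "g \<otimes> y"] g y by (simp add: m_assoc [symmetric])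
    then show "indicator (g <# (K n #> x)) (g \<otimes> y) * \<rho> (g \<otimes> y) = indicator (K n #> x) y * R g y * \<rho> y"
      using rho_pos [OF y] by (simp add: R_def indicator_def)
  qed
  also have "\<dots> = ?c * (\<integral>X. indicator (orb n x) X * R g (coset_rep X) \<partial>\<mu>)"
    using rho_formula [OF one_closed x R_right_invariant [OF g] R_continuous [OF g], of n] by (simp add: id)
  finally show ?thesis using measure_stab_pos [OF x, of n] by simp
qed

text \<open>The two measures agree on the orbits by \<open>integral_orb_translate\<close>, and these generate the Borel
  sets.\<close>

lemma quasi_invariance:
  assumes g: "g \<in> carrier G"
  shows "distr \<mu> \<mu> (\<lambda>X. inv g <# X) = density \<mu> (\<lambda>X. ennreal (R g (coset_rep X)))"
proof (rule measure_eqI_generator_eq_countable [OF Int_stable_orbs])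
  let ?A = "{orb n x |n x. x \<in> carrier G}"
  show "orbs \<subseteq> Pow (lcosets H)" using orb_subset by auto
  show "sets (distr \<mu> \<mu> (\<lambda>X. inv g <# X)) = sigma_sets (lcosets H) orbs"
    "sets (density \<mu> (\<lambda>X. ennreal (R g (coset_rep X)))) = sigma_sets (lcosets H) orbs"
    by (simp_all add: sets_mu sets_borel_GH)
  show "?A \<subseteq> orbs" "countable ?A" using countable_orbs by auto
  show "\<Union> ?A = lcosets H"
  proof (intro equalityI subsetI)
    fix X assume "X \<in> lcosets H"
    then obtain x where "x \<in> carrier G" "X = x <# H" by (rule coset_cases)
    then show "X \<in> \<Union> ?A" using orb_self [of x 0] by auto
  qed (use orb_subset in auto)
  have distr: "emeasure (distr \<mu> \<mu> (\<lambda>X. inv g <# X)) (orb n x) = emeasure \<mu> ((\<lambda>X. g <# X) ` orb n x)"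
    if "x \<in> carrier G" for n x
  proof -
    have "(\<lambda>X. inv g <# X) -` orb n x \<inter> space \<mu> = (\<lambda>X. g <# X) ` orb n x"
      using translate_set_eq [OF g orb_subset [OF that]] by (auto simp: space_mu)
    then show ?thesis using g that by (simp add: emeasure_distr orb_sets)
  qed
  have fin: "emeasure \<mu> ((\<lambda>X. g <# X) ` orb n x) < \<infinity>" if "x \<in> carrier G" for n x
    by (intro compact_mu_finite image_compactin [OF compactin_orb continuous_translate] that g)
  show "emeasure (distr \<mu> \<mu> (\<lambda>X. inv g <# X)) A \<noteq> \<infinity>" if "A \<in> ?A" for A
    using that distr fin by (auto simp: less_top [symmetric])
  fix A assume "A \<in> orbs"
  then consider "A = {}" | n x where "x \<in> carrier G" "A = orb n x" by auto
  then show "emeasure (distr \<mu> \<mu> (\<lambda>X. inv g <# X)) A =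
      emeasure (density \<mu> (\<lambda>X. ennreal (R g (coset_rep X)))) A"
  proof cases
    case 2
    obtain B where B: "B \<ge> 0" "\<And>X. X \<in> orb n x \<Longrightarrow> norm (R g (coset_rep X)) \<le> B"
      using bounded_on_compact [OF continuous_right_invariant [OF R_right_invariant R_continuous] compactin_orb] 2 g
      by metis
    have int: "integrable \<mu> (\<lambda>X. indicator (orb n x) X * R g (coset_rep X))"
    proof (rule integrableI_bounded_set [where A = "orb n x" and B = B])
      show "orb n x \<in> sets \<mu>" "emeasure \<mu> (orb n x) < \<infinity>" using 2 orb_sets orb_finite by auto
      then show "(\<lambda>X. indicator (orb n x) X * R g (coset_rep X)) \<in> borel_measurable \<mu>"
        using R_measurable [OF g] by measurable
    qed (use B in \<open>auto simp: indicator_def\<close>)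
    have "emeasure (density \<mu> (\<lambda>X. ennreal (R g (coset_rep X)))) (orb n x) =
        (\<integral>\<^sup>+X. ennreal (R g (coset_rep X)) * indicator (orb n x) X \<partial>\<mu>)"
      using g 2 by (intro emeasure_density) (auto simp: orb_sets)
    also have "\<dots> = (\<integral>\<^sup>+X. ennreal (indicator (orb n x) X * R g (coset_rep X)) \<partial>\<mu>)"
      by (intro nn_integral_cong) (auto simp: indicator_def)
    also have "\<dots> = ennreal (\<integral>X. indicator (orb n x) X * R g (coset_rep X) \<partial>\<mu>)"
    proof (rule nn_integral_eq_integral [OF int])
      show "AE X in \<mu>. 0 \<le> indicator (orb n x) X * R g (coset_rep X)"
        using R_pos [OF g coset_rep(1)] by (intro AE_I2) (auto simp: space_mu less_imp_le)
    qed
    also have "\<dots> = ennreal (\<integral>X. indicator ((\<lambda>X. g <# X) ` orb n x) X \<partial>\<mu>)"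
      using integral_orb_translate [OF g] 2 by simp
    also have "\<dots> = ennreal (measure \<mu> ((\<lambda>X. g <# X) ` orb n x))"
    proof -
      have "(\<lambda>X. g <# X) ` orb n x \<in> sets \<mu>" using g 2 translate_sets orb_sets by simp
      then show ?thesis by simp
    qed
    also have "\<dots> = emeasure \<mu> ((\<lambda>X. g <# X) ` orb n x)"
      using fin [of x n] 2 by (simp add: emeasure_eq_ennreal_measure less_top)
    finally show ?thesis using distr 2 by simp
  qed simp
qed

lemma nn_integral_translate:
  assumes g: "g \<in> carrier G" and f: "f \<in> borel_measurable \<mu>"
  shows "(\<integral>\<^sup>+X. ennreal (R g (coset_rep X)) * f X \<partial>\<mu>) = (\<integral>\<^sup>+X. f (inv g <# X) \<partial>\<mu>)"
proof -
  have "(\<integral>\<^sup>+X. ennreal (R g (coset_rep X)) * f X \<partial>\<mu>) =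
      (\<integral>\<^sup>+X. f X \<partial>density \<mu> (\<lambda>X. ennreal (R g (coset_rep X))))"
    using R_measurable [OF g] f by (intro nn_integral_density [symmetric]) auto
  also have "\<dots> = (\<integral>\<^sup>+X. f (inv g <# X) \<partial>\<mu>)"
    unfolding quasi_invariance [OF g, symmetric]
    using translate_measurable [of "inv g"] g f by (intro nn_integral_distr) auto
  finally show ?thesis .
qed

lemma integral_translate:
  fixes f :: "'g set \<Rightarrow> complex"
  assumes g: "g \<in> carrier G" and f: "f \<in> borel_measurable \<mu>"
  shows "(\<integral>X. R g (coset_rep X) *\<^sub>R f X \<partial>\<mu>) = (\<integral>X. f (inv g <# X) \<partial>\<mu>)"
proof -
  have "(\<integral>X. R g (coset_rep X) *\<^sub>R f X \<partial>\<mu>) =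
      (\<integral>X. f X \<partial>density \<mu> (\<lambda>X. ennreal (R g (coset_rep X))))"
    using R_measurable [OF g] f R_pos [OF g coset_rep(1)]
    by (intro integral_density [symmetric]) (auto simp: space_mu less_imp_le)
  also have "\<dots> = (\<integral>X. f (inv g <# X) \<partial>\<mu>)"
    unfolding quasi_invariance [OF g, symmetric]
    using translate_measurable [of "inv g"] g f by (intro integral_distr) auto
  finally show ?thesis .
qed

end

section \<open>Compact sets of cosets\<close>

lemma norm_integral_le_nn_integral:
  fixes f :: "'a \<Rightarrow> 'b::{banach, second_countable_topology}"
  shows "ennreal (norm (integral\<^sup>L M f)) \<le> (\<integral>\<^sup>+x. norm (f x) \<partial>M)"
  by (cases "integrable M f") (simp_all add: integral_norm_bound_ennreal not_integrable_integral_eq)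

context coset_space
begin

text \<open>
  Finite unions of \<open>K 0\<close>-orbits: every compact subset of \<open>G/H\<close> is contained in one of them, and they
  are invariant under all the groups \<open>K n\<close>.
\<close>

definition core :: "'g set \<Rightarrow> 'g set set"
  where "core C = (\<Union>c\<in>C. orb 0 c)"

lemma core_subset: "C \<subseteq> carrier G \<Longrightarrow> core C \<subseteq> lcosets H"
  using orb_subset by (auto simp: core_def)

lemma openin_core: "C \<subseteq> carrier G \<Longrightarrow> openin GH (core C)"
  unfolding core_def using openin_orb by (intro openin_Union) auto

lemma compactin_core: "finite C \<Longrightarrow> C \<subseteq> carrier G \<Longrightarrow> compactin GH (core C)"
  unfolding core_def using compactin_orb by (intro compactin_Union) auto

lemma core_translate:
  assumes "C \<subseteq> carrier G" "k \<in> K n" "X \<in> lcosets H"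
  shows "k <# X \<in> core C \<longleftrightarrow> X \<in> core C"
proof -
  have "k \<in> K 0" using K_mono [of 0 n] assms(2) by auto
  then show ?thesis using orb_translate [of _ k 0 X] assms by (auto simp: core_def)
qed

lemma compactin_core_cover:
  assumes "compactin GH A" shows "\<exists>C. finite C \<and> C \<subseteq> carrier G \<and> A \<subseteq> core C"
proof -
  have "\<exists>\<F>. finite \<F> \<and> \<F> \<subseteq> orb 0 ` carrier G \<and> A \<subseteq> \<Union>\<F>"
  proof (rule compactinD [OF assms])
    show "A \<subseteq> \<Union> (orb 0 ` carrier G)"
    proof
      fix X assume "X \<in> A"
      then have "X \<in> lcosets H" using compactin_subset_topspace [OF assms] by (auto simp: topspace_GH)
      then obtain x where "x \<in> carrier G" "X = x <# H" by (rule coset_cases)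
      then show "X \<in> \<Union> (orb 0 ` carrier G)" using orb_self by blast
    qed
  qed (use openin_orb in auto)
  then show ?thesis unfolding core_def by (metis finite_subset_image)
qed

lemma closedin_core:
  assumes "C \<subseteq> carrier G" shows "closedin GH (core C)"
proof -
  have "topspace GH - core C = core {y \<in> carrier G. y <# H \<notin> core C}"
  proof (intro equalityI subsetI)
    fix X assume "X \<in> topspace GH - core C"
    moreover then obtain x where "x \<in> carrier G" "X = x <# H"
      by (auto simp: topspace_GH elim: coset_cases)
    ultimately show "X \<in> core {y \<in> carrier G. y <# H \<notin> core C}"
      using orb_self by (auto simp: core_def)
  next
    fix X assume "X \<in> core {y \<in> carrier G. y <# H \<notin> core C}"
    then obtain y where y: "y \<in> carrier G" "y <# H \<notin> core C" "X \<in> orb 0 y" by (auto simp: core_def)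
    then obtain k where k: "k \<in> K 0" "X = k <# (y <# H)"
      by (auto simp: mem_orb_iff translate_coset K_carrier)
    then show "X \<in> topspace GH - core C"
      using y core_translate [OF assms k(1) coset_in [OF y(1)]]
      by (simp add: topspace_GH translate_in coset_in K_carrier)
  qed
  then show ?thesis
    using openin_core [of "{y \<in> carrier G. y <# H \<notin> core C}"] core_subset [OF assms]
    by (simp add: closedin_def topspace_GH subset_eq)
qed

lemma closedin_coset_image:
  assumes "closedin T S" "\<And>x h. x \<in> S \<Longrightarrow> h \<in> H \<Longrightarrow> x \<otimes> h \<in> S"
  shows "closedin GH ((\<lambda>x. x <# H) ` S)"
proof -
  have S: "S \<subseteq> carrier G" using closedin_subset [OF assms(1)] by (simp add: topspace_eq)
  have "topspace GH - (\<lambda>x. x <# H) ` S = (\<lambda>x. x <# H) ` (topspace T - S)"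
  proof (intro equalityI subsetI)
    fix X assume "X \<in> topspace GH - (\<lambda>x. x <# H) ` S"
    moreover then obtain x where "x \<in> carrier G" "X = x <# H"
      by (auto simp: topspace_GH elim: coset_cases)
    ultimately show "X \<in> (\<lambda>x. x <# H) ` (topspace T - S)" by (auto simp: topspace_eq)
  next
    fix X assume "X \<in> (\<lambda>x. x <# H) ` (topspace T - S)"
    then obtain x where x: "x \<in> carrier G" "x \<notin> S" "X = x <# H" by (auto simp: topspace_eq)
    have "X \<noteq> s <# H" if "s \<in> S" for s
    proof
      assume "X = s <# H"
      then obtain h where "h \<in> H" "x = s \<otimes> h" using coset_eqD [of s x] x S \<open>s \<in> S\<close> by auto
      then show False using assms(2) x(2) \<open>s \<in> S\<close> by simp
    qed
    then show "X \<in> topspace GH - (\<lambda>x. x <# H) ` S" using x by (auto simp: topspace_GH coset_in)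
  qed
  moreover have "openin GH ((\<lambda>x. x <# H) ` (topspace T - S))"
    using assms(1) by (intro openin_coset_image) blast
  ultimately show ?thesis using S by (auto simp: closedin_def topspace_GH coset_in)
qed

lemma core_Un: "core (C \<union> D) = core C \<union> core D"
  by (auto simp: core_def)

lemma core_rep_cases:
  assumes "X \<in> core C" "C \<subseteq> carrier G"
  obtains l where "l \<in> (\<Union>c\<in>C. K 0 #> c)" "l \<in> carrier G" "X = l <# H"
proof -
  obtain c l where "c \<in> C" "l \<in> K 0 #> c" "X = l <# H" using assms(1) by (auto simp: core_def orb_def)
  then show ?thesis using that K_coset_carrier [of c 0] assms(2) by auto
qed

lemma compactin_core_lift: "finite C \<Longrightarrow> C \<subseteq> carrier G \<Longrightarrow> compactin T (\<Union>c\<in>C. K 0 #> c)"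
  using compactin_r_coset K_compactin by (intro compactin_Union) auto

end

context rho_space
begin

lemma core_sets: "C \<subseteq> carrier G \<Longrightarrow> core C \<in> sets \<mu>"
  and core_finite: "finite C \<Longrightarrow> C \<subseteq> carrier G \<Longrightarrow> emeasure \<mu> (core C) < \<infinity>"
  using openin_mu [OF openin_core] compact_mu_finite [OF compactin_core] by auto

text \<open>
  The coefficient of the quasi-regular representation on \<open>L\<^sup>2(\<mu>)\<close> at the indicator function of \<open>A\<close>.
  It dominates the coefficients of the induced representation, see \<open>coefficient_bound\<close>.
\<close>

definition coef :: "'g set set \<Rightarrow> 'g \<Rightarrow> ennreal"
  where "coef A g = (\<integral>\<^sup>+X. ennreal (sqrt (R (inv g) (coset_rep X)) * indicator A (inv g <# X) * indicator A X) \<partial>\<mu>)"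

end

section \<open>The induced representation is unitary\<close>

locale ind_rep = rho_space G T K H m\<^sub>G m\<^sub>H \<Delta>\<^sub>G \<Delta>\<^sub>H \<rho> \<mu>
  for G :: "('g, 'b) monoid_scheme" (structure) and T :: "'g topology" and K :: "nat \<Rightarrow> 'g set"
    and H :: "'g set" and m\<^sub>G m\<^sub>H :: "'g measure" and \<Delta>\<^sub>G \<Delta>\<^sub>H \<rho> :: "'g \<Rightarrow> real"
    and \<mu> :: "'g set measure" +
  fixes \<sigma> :: "'g \<Rightarrow> 'k \<Rightarrow> 'k::complex_hilbert" and J :: "('g \<Rightarrow> 'k) \<Rightarrow> 'h::complex_hilbert"
    and \<pi> :: "'g \<Rightarrow> 'h \<Rightarrow> 'h"
  assumes sigma: "unitary_rep (G\<lparr>carrier := H\<rparr>) (subtopology T H) \<sigma>"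
    and ind: "induced_rep G T H \<rho> \<mu> \<sigma> J \<pi>"
begin

abbreviation V :: "('g \<Rightarrow> 'k) set"
  where "V \<equiv> ind_space G T H \<sigma>"

lemma sigma_clinear: "h \<in> H \<Longrightarrow> clinear (\<sigma> h)"
  and sigma_cinner: "h \<in> H \<Longrightarrow> cinner (\<sigma> h v) (\<sigma> h w) = cinner v w"
  using sigma by (simp_all add: unitary_rep_def)

lemma sigma_norm: "h \<in> H \<Longrightarrow> norm (\<sigma> h v) = norm v"
  by (rule cinner_preserving_norm [OF sigma_cinner])

lemma V_outside: "\<eta> \<in> V \<Longrightarrow> x \<notin> carrier G \<Longrightarrow> \<eta> x = 0"
  and V_continuous: "\<eta> \<in> V \<Longrightarrow> continuous_map T euclidean \<eta>"
  and V_covariant: "\<eta> \<in> V \<Longrightarrow> x \<in> carrier G \<Longrightarrow> h \<in> H \<Longrightarrow> \<eta> (x \<otimes> h) = \<sigma> (inv h) (\<eta> x)"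
  by (simp_all add: ind_space_def)

lemma V_support:
  assumes "\<eta> \<in> V"
  obtains C where "finite C" "C \<subseteq> carrier G" "\<And>x. x \<in> carrier G \<Longrightarrow> \<eta> x \<noteq> 0 \<Longrightarrow> x <# H \<in> core C"
proof -
  let ?S = "{x \<in> carrier G. \<eta> x \<noteq> 0}"
  have "compactin GH ((\<lambda>x. x <# H) ` (T closure_of ?S))"
    using assms by (simp add: ind_space_def)
  then obtain C where C: "finite C" "C \<subseteq> carrier G" "(\<lambda>x. x <# H) ` (T closure_of ?S) \<subseteq> core C"
    using compactin_core_cover by blast
  have "?S \<subseteq> T closure_of ?S" by (rule closure_of_subset) (auto simp: topspace_eq)
  then show ?thesis using C by (intro that [of C]) auto
qed

text \<open>The condition on the support is replaced by the vanishing of \<open>\<eta>\<close> outside a compact set of cosets.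
  The set where \<open>\<eta>\<close> does not vanish is right \<open>H\<close>-invariant because \<open>\<sigma>\<close> is isometric. So is its
  closure, whose image in \<open>G/H\<close> is therefore closed, and it is contained in a compact set.\<close>

lemma V_I:
  assumes "\<And>x. x \<notin> carrier G \<Longrightarrow> \<eta> x = 0" "continuous_map T euclidean \<eta>"
    and cov: "\<And>x h. x \<in> carrier G \<Longrightarrow> h \<in> H \<Longrightarrow> \<eta> (x \<otimes> h) = \<sigma> (inv h) (\<eta> x)"
    and A: "compactin GH A" "\<And>x. x \<in> carrier G \<Longrightarrow> \<eta> x \<noteq> 0 \<Longrightarrow> x <# H \<in> A"
  shows "\<eta> \<in> V"
proof -
  let ?S = "{x \<in> carrier G. \<eta> x \<noteq> 0}"
  obtain C where C: "finite C" "C \<subseteq> carrier G" "A \<subseteq> core C" using compactin_core_cover [OF A(1)] by auto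
  have "closedin T {x \<in> topspace T. x <# H \<in> core C}"
    by (rule closedin_continuous_map_preimage [OF continuous_coset closedin_core [OF C(2)]])
  then have "T closure_of ?S \<subseteq> {x \<in> topspace T. x <# H \<in> core C}"
    using A(2) C(3) by (intro closure_of_minimal) (auto simp: topspace_eq)
  then have sub: "(\<lambda>x. x <# H) ` (T closure_of ?S) \<subseteq> core C" by auto
  have S_inv: "x \<otimes> h \<in> ?S" if "x \<in> ?S" "h \<in> H" for x h
  proof -
    have "norm (\<eta> (x \<otimes> h)) = norm (\<eta> x)"
      using that cov [of x h] sigma_norm [of "inv h"] by (simp add: H_closed)
    then show ?thesis using that by (auto simp: H_carrier)
  qed
  have "closedin GH ((\<lambda>x. x <# H) ` (T closure_of ?S))"
  proof (rule closedin_coset_image)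
    fix x h assume x: "x \<in> T closure_of ?S" and h: "h \<in> H"
    have xG: "x \<in> carrier G" using x by (simp add: in_closure_of topspace_eq)
    show "x \<otimes> h \<in> T closure_of ?S"
      unfolding in_closure_of
    proof (intro conjI allI impI)
      show "x \<otimes> h \<in> topspace T" using xG h by (simp add: topspace_eq H_carrier)
      fix W assume W: "x \<otimes> h \<in> W \<and> openin T W"
      then have "openin T (W #> inv h)" using h by (intro openin_r_coset) (auto simp: H_carrier)
      moreover have "x \<in> W #> inv h"
        using W h xG by (auto simp: r_coset_def m_assoc H_carrier intro!: bexI [of _ "x \<otimes> h"])
      ultimately obtain s where s: "s \<in> ?S" "s \<in> W #> inv h" using x by (auto simp: in_closure_of)
      then obtain w where w: "w \<in> W" "s = w \<otimes> inv h" by (auto simp: r_coset_def)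
      have "w \<in> carrier G" using w W openin_carrier by blast
      then have "s \<otimes> h = w" using w h by (simp add: m_assoc H_carrier)
      then show "\<exists>y. y \<in> ?S \<and> y \<in> W" using S_inv [OF s(1) h] w by auto
    qed
  qed simp
  then have "compactin GH ((\<lambda>x. x <# H) ` (T closure_of ?S))"
    by (rule closed_compactin [OF compactin_core [OF C(1,2)] sub])
  then show ?thesis using assms by (simp add: ind_space_def)
qed

lemma V_add:
  assumes "\<eta> \<in> V" "\<eta>' \<in> V" shows "(\<lambda>x. \<eta> x + \<eta>' x) \<in> V"
proof -
  obtain C where C: "finite C" "C \<subseteq> carrier G" "\<And>x. x \<in> carrier G \<Longrightarrow> \<eta> x \<noteq> 0 \<Longrightarrow> x <# H \<in> core C"
    using V_support [OF assms(1)] by metis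
  obtain D where D: "finite D" "D \<subseteq> carrier G" "\<And>x. x \<in> carrier G \<Longrightarrow> \<eta>' x \<noteq> 0 \<Longrightarrow> x <# H \<in> core D"
    using V_support [OF assms(2)] by metis
  show ?thesis
  proof (rule V_I [of _ "core (C \<union> D)"])
    show "compactin GH (core (C \<union> D))" using C D by (intro compactin_core) auto
    show "x <# H \<in> core (C \<union> D)" if "x \<in> carrier G" "\<eta> x + \<eta>' x \<noteq> 0" for x
      using that C(3) [of x] D(3) [of x] by (cases "\<eta> x = 0") (auto simp: core_Un)
  qed (use assms in \<open>auto simp: V_outside V_covariant H_closed clinear_add [OF sigma_clinear]
      intro: continuous_map_euclidean_add V_continuous\<close>)
qed

lemma V_scaleC:
  assumes "\<eta> \<in> V" shows "(\<lambda>x. a *\<^sub>C \<eta> x) \<in> V"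
proof -
  obtain C where C: "finite C" "C \<subseteq> carrier G" "\<And>x. x \<in> carrier G \<Longrightarrow> \<eta> x \<noteq> 0 \<Longrightarrow> x <# H \<in> core C"
    using V_support [OF assms] by metis
  show ?thesis
  proof (rule V_I [of _ "core C"])
    show "compactin GH (core C)" using C by (intro compactin_core) auto
    show "x <# H \<in> core C" if "x \<in> carrier G" "a *\<^sub>C \<eta> x \<noteq> 0" for x
      using that C(3) [of x] by (cases "\<eta> x = 0") auto
  qed (use assms in \<open>auto simp: V_outside V_covariant H_closed clinear_scaleC [OF sigma_clinear]
      intro: continuous_map_scaleC V_continuous\<close>)
qed

abbreviation act :: "'g \<Rightarrow> ('g \<Rightarrow> 'k) \<Rightarrow> 'g \<Rightarrow> 'k"
  where "act \<equiv> ind_act G \<rho>"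

lemma act_eq: "x \<in> carrier G \<Longrightarrow> act g \<eta> x = sqrt (R (inv g) x) *\<^sub>R \<eta> (inv g \<otimes> x)"
  by (simp add: ind_act_def R_def)

lemma continuous_map_V_translate_pair:
  assumes "\<eta> \<in> V"
  shows "continuous_map (prod_topology T T) euclidean (\<lambda>(k, x). sqrt (R (inv k) x) *\<^sub>R \<eta> (inv k \<otimes> x))"
proof -
  let ?P = "prod_topology T T"
  have i: "continuous_map ?P T (\<lambda>p. inv (fst p))" by (intro continuous_map_inv continuous_map_fst)
  have "continuous_map ?P ?P (\<lambda>p. (inv (fst p), snd p))"
    by (intro continuous_map_pairedI i continuous_map_snd)
  from continuous_map_compose [OF this R_continuous_pair]
  have "continuous_map ?P euclideanreal (\<lambda>p. R (inv (fst p)) (snd p))" by (simp add: o_def)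
  then have 1: "continuous_map ?P euclideanreal (\<lambda>p. sqrt (R (inv (fst p)) (snd p)))"
    by (rule continuous_map_sqrt)
  have 2: "continuous_map ?P euclidean (\<lambda>p. \<eta> (inv (fst p) \<otimes> snd p))"
    using continuous_map_compose [OF continuous_map_mult [OF i continuous_map_snd] V_continuous [OF assms]]
    by (simp add: o_def)
  show ?thesis
    using continuous_map_euclidean_scaleR [OF 1 2] by (simp add: case_prod_beta')
qed

lemma V_act:
  assumes \<eta>: "\<eta> \<in> V" and g: "g \<in> carrier G" shows "act g \<eta> \<in> V"
proof -
  obtain C where C: "finite C" "C \<subseteq> carrier G" "\<And>x. x \<in> carrier G \<Longrightarrow> \<eta> x \<noteq> 0 \<Longrightarrow> x <# H \<in> core C"
    using V_support [OF \<eta>] by metis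
  show ?thesis
  proof (rule V_I [of _ "(\<lambda>X. g <# X) ` core C"])
    show "act g \<eta> x = 0" if "x \<notin> carrier G" for x using that by (simp add: ind_act_def)
    have "continuous_map T euclidean (\<lambda>x. sqrt (R (inv g) x) *\<^sub>R \<eta> (inv g \<otimes> x))"
      using continuous_map_fix_left [OF continuous_map_V_translate_pair [OF \<eta>] g] .
    then show "continuous_map T euclidean (act g \<eta>)"
      by (rule continuous_map_eq) (simp add: act_eq topspace_eq)
    show "compactin GH ((\<lambda>X. g <# X) ` core C)"
      by (intro image_compactin [OF compactin_core continuous_translate] C g)
    show "act g \<eta> (x \<otimes> h) = \<sigma> (inv h) (act g \<eta> x)" if "x \<in> carrier G" "h \<in> H" for x h
    proof -
      have "R (inv g) (x \<otimes> h) = R (inv g) x"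
        using R_right_invariant [of "inv g"] g that by (simp add: right_invariant_def)
      moreover have "\<eta> (inv g \<otimes> (x \<otimes> h)) = \<sigma> (inv h) (\<eta> (inv g \<otimes> x))"
        using V_covariant [OF \<eta>, of "inv g \<otimes> x" h] g that by (simp add: m_assoc H_carrier)
      ultimately show ?thesis
        using that by (simp add: act_eq H_carrier H_closed clinear_scaleR [OF sigma_clinear])
    qed
    show "x <# H \<in> (\<lambda>X. g <# X) ` core C" if "x \<in> carrier G" "act g \<eta> x \<noteq> 0" for x
    proof -
      have "(inv g \<otimes> x) <# H \<in> core C" using that g by (intro C(3)) (auto simp: act_eq)
      moreover have "x <# H = g <# ((inv g \<otimes> x) <# H)"
        using that g by (simp add: translate_coset m_assoc [symmetric])
      ultimately show ?thesis by blast
    qed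
  qed
qed

lemma V_cinner_right_invariant:
  assumes "\<eta> \<in> V" "\<eta>' \<in> V" shows "right_invariant (\<lambda>x. cinner (\<eta> x) (\<eta>' x))"
  using assms by (simp add: right_invariant_def V_covariant sigma_cinner H_closed)

lemma V_norm_right_invariant:
  assumes "\<eta> \<in> V" shows "right_invariant (\<lambda>x. norm (\<eta> x))"
  using assms by (simp add: right_invariant_def V_covariant sigma_norm H_closed)

lemma V_norm_rep:
  assumes "\<eta> \<in> V" "x \<in> carrier G" shows "norm (\<eta> (coset_rep (x <# H))) = norm (\<eta> x)"
  by (rule right_invariant_rep [OF V_norm_right_invariant [OF assms(1)] assms(2)])

text \<open>The square root in the action squares to the density \<open>R (inv g)\<close>, which is cancelled by the
  substitution \<open>X \<mapsto> g\<inverse>X\<close> in the integral.\<close>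

lemma ind_inner_act:
  assumes \<eta>: "\<eta> \<in> V" "\<eta>' \<in> V" and g: "g \<in> carrier G"
  shows "ind_inner \<mu> (act g \<eta>) (act g \<eta>') = ind_inner \<mu> \<eta> \<eta>'"
proof -
  let ?\<phi> = "\<lambda>x. cinner (\<eta> x) (\<eta>' x)"
  let ?\<Phi> = "\<lambda>X. ?\<phi> (coset_rep X)"
  have inv: "right_invariant ?\<phi>" by (rule V_cinner_right_invariant [OF \<eta>])
  have meas: "?\<Phi> \<in> borel_measurable \<mu>"
    by (intro measurable_right_invariant inv continuous_map_cinner V_continuous \<eta>)
  have "ind_inner \<mu> (act g \<eta>) (act g \<eta>') = (\<integral>X. R (inv g) (coset_rep X) *\<^sub>R ?\<Phi> (inv g <# X) \<partial>\<mu>)"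
    unfolding ind_inner_def
  proof (rule Bochner_Integration.integral_cong [OF refl])
    fix X assume "X \<in> space \<mu>"
    then have X: "X \<in> lcosets H" by (simp add: space_mu)
    define x where "x = coset_rep X"
    have x: "x \<in> carrier G" "X = x <# H" using coset_rep [OF X] by (simp_all add: x_def)
    have "?\<Phi> (inv g <# X) = ?\<phi> (inv g \<otimes> x)"
      using right_invariant_rep [OF inv, of "inv g \<otimes> x"] x g by (simp add: translate_coset)
    moreover have "R (inv g) x \<ge> 0" using R_pos [of "inv g" x] x g by simp
    ultimately show "cinner (act g \<eta> (coset_rep X)) (act g \<eta>' (coset_rep X)) =
        R (inv g) (coset_rep X) *\<^sub>R ?\<Phi> (inv g <# X)"
      using x(1) by (simp add: x_def [symmetric] act_eq cinner_scaleR_left cinner_scaleR_right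
          scaleR_conv_of_real mult.assoc [symmetric] of_real_mult [symmetric] del: of_real_mult)
  qed
  also have "\<dots> = (\<integral>X. ?\<Phi> (inv g <# (inv (inv g) <# X)) \<partial>\<mu>)"
    using g measurable_compose [OF translate_measurable [of "inv g"] meas]
    by (intro integral_translate [where f = "\<lambda>X. ?\<Phi> (inv g <# X)"]) auto
  also have "\<dots> = ind_inner \<mu> \<eta> \<eta>'"
    unfolding ind_inner_def
    by (rule Bochner_Integration.integral_cong [OF refl]) (simp add: space_mu g translate_inv)
  finally show ?thesis .
qed

lemma J_add: "\<eta> \<in> V \<Longrightarrow> \<eta>' \<in> V \<Longrightarrow> J (\<lambda>x. \<eta> x + \<eta>' x) = J \<eta> + J \<eta>'"
  and J_scaleC: "\<eta> \<in> V \<Longrightarrow> J (\<lambda>x. a *\<^sub>C \<eta> x) = a *\<^sub>C J \<eta>"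
  and J_cinner: "\<eta> \<in> V \<Longrightarrow> \<eta>' \<in> V \<Longrightarrow> cinner (J \<eta>) (J \<eta>') = ind_inner \<mu> \<eta> \<eta>'"
  and J_dense: "closure (J ` V) = UNIV"
  and pi_continuous: "g \<in> carrier G \<Longrightarrow> continuous_on UNIV (\<pi> g)"
  and pi_J: "g \<in> carrier G \<Longrightarrow> \<eta> \<in> V \<Longrightarrow> \<pi> g (J \<eta>) = J (act g \<eta>)"
  using ind by (simp_all add: induced_rep_def)

text \<open>The image of \<open>J\<close> is dense, hence closed conditions on one or two vectors can be tested there. All
  algebraic properties of \<open>\<pi>\<close> are transferred in this way.\<close>

lemma dense_pairs:
  assumes "closed {p. P (fst p) (snd p)}" "\<And>\<eta> \<eta>'. \<eta> \<in> V \<Longrightarrow> \<eta>' \<in> V \<Longrightarrow> P (J \<eta>) (J \<eta>')"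
  shows "P v w"
proof -
  have "closure ((J ` V) \<times> (J ` V)) \<subseteq> {p. P (fst p) (snd p)}"
    by (rule closure_minimal [OF _ assms(1)]) (use assms(2) in auto)
  moreover have "(v, w) \<in> closure ((J ` V) \<times> (J ` V))" by (simp add: closure_Times J_dense)
  ultimately have "(v, w) \<in> {p. P (fst p) (snd p)}" by blast
  then show ?thesis by simp
qed

lemma dense_vectors:
  assumes "closed {v. P v}" "\<And>\<eta>. \<eta> \<in> V \<Longrightarrow> P (J \<eta>)" shows "P v"
proof -
  have "closure (J ` V) \<subseteq> {v. P v}"
    by (rule closure_minimal [OF _ assms(1)]) (use assms(2) in auto)
  then show ?thesis by (auto simp: J_dense)
qed

lemma approx: "e > 0 \<Longrightarrow> \<exists>\<eta>\<in>V. norm (v - J \<eta>) < e"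
  using closure_approachable [of v "J ` V"] by (auto simp: J_dense dist_norm norm_minus_commute)

lemma continuous_on_pi_comp:
  assumes "g \<in> carrier G" "continuous_on S f" shows "continuous_on S (\<lambda>x. \<pi> g (f x))"
  using continuous_on_compose2 [OF pi_continuous [OF assms(1)] assms(2)] by simp

lemma pi_cinner: assumes "g \<in> carrier G" shows "cinner (\<pi> g v) (\<pi> g w) = cinner v w"
proof (rule dense_pairs)
  show "closed {p. cinner (\<pi> g (fst p)) (\<pi> g (snd p)) = cinner (fst p) (snd p)}"
    by (intro closed_Collect_eq bounded_bilinear.continuous_on [OF bounded_bilinear_cinner]
        continuous_on_pi_comp assms continuous_intros)
qed (simp add: assms pi_J J_cinner V_act ind_inner_act)

lemma act_add: "act g (\<lambda>x. \<eta> x + \<eta>' x) = (\<lambda>x. act g \<eta> x + act g \<eta>' x)"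
  by (auto simp: ind_act_def scaleR_add_right)

lemma act_scaleC: "act g (\<lambda>x. a *\<^sub>C \<eta> x) = (\<lambda>x. a *\<^sub>C act g \<eta> x)"
  by (auto simp: ind_act_def scaleC_scaleR)

lemma pi_clinear: assumes g: "g \<in> carrier G" shows "clinear (\<pi> g)"
  unfolding clinear_def
proof (intro conjI allI)
  fix v w show "\<pi> g (v + w) = \<pi> g v + \<pi> g w"
  proof (rule dense_pairs [where P = "\<lambda>v w. \<pi> g (v + w) = \<pi> g v + \<pi> g w"])
    show "closed {p. \<pi> g (fst p + snd p) = \<pi> g (fst p) + \<pi> g (snd p)}"
      by (intro closed_Collect_eq continuous_on_add continuous_on_pi_comp g continuous_on_fst
          continuous_on_snd continuous_on_id)
    show "\<pi> g (J \<eta> + J \<eta>') = \<pi> g (J \<eta>) + \<pi> g (J \<eta>')" if "\<eta> \<in> V" "\<eta>' \<in> V" for \<eta> \<eta>'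
      using that g by (simp add: J_add [symmetric] pi_J V_add V_act act_add)
  qed
next
  fix a v show "\<pi> g (a *\<^sub>C v) = a *\<^sub>C \<pi> g v"
  proof (rule dense_vectors [where P = "\<lambda>v. \<pi> g (a *\<^sub>C v) = a *\<^sub>C \<pi> g v"])
    show "closed {v. \<pi> g (a *\<^sub>C v) = a *\<^sub>C \<pi> g v}"
      by (intro closed_Collect_eq bounded_linear.continuous_on [OF bounded_linear_scaleC]
          continuous_on_pi_comp g continuous_on_id)
    show "\<pi> g (a *\<^sub>C J \<eta>) = a *\<^sub>C \<pi> g (J \<eta>)" if "\<eta> \<in> V" for \<eta>
      using that g by (simp add: J_scaleC [symmetric] pi_J V_scaleC V_act act_scaleC)
  qed
qed

lemma act_mult:
  assumes "g \<in> carrier G" "g' \<in> carrier G" shows "act (g \<otimes> g') \<eta> = act g (act g' \<eta>)"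
proof
  fix x
  show "act (g \<otimes> g') \<eta> x = act g (act g' \<eta>) x"
  proof (cases "x \<in> carrier G")
    case True
    then have "R (inv (g \<otimes> g')) x = R (inv g') (inv g \<otimes> x) * R (inv g) x"
      using assms R_mult [of "inv g'" "inv g" x] by (simp add: inv_mult_group)
    then show ?thesis
      using True assms by (simp add: act_eq real_sqrt_mult inv_mult_group m_assoc mult.commute)
  qed (simp add: ind_act_def)
qed

lemma act_one: assumes "\<eta> \<in> V" shows "act \<one> \<eta> = \<eta>"
proof
  fix x show "act \<one> \<eta> x = \<eta> x"
  proof (cases "x \<in> carrier G")
    case True
    then show ?thesis by (simp add: act_eq R_one)
  next
    case False
    then show ?thesis using V_outside [OF assms] by (simp add: ind_act_def)
  qed
qed

lemma pi_mult:
  assumes "g \<in> carrier G" "g' \<in> carrier G" shows "\<pi> (g \<otimes> g') v = \<pi> g (\<pi> g' v)"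
proof (rule dense_vectors [where P = "\<lambda>v. \<pi> (g \<otimes> g') v = \<pi> g (\<pi> g' v)"])
  show "closed {v. \<pi> (g \<otimes> g') v = \<pi> g (\<pi> g' v)}"
    by (intro closed_Collect_eq continuous_on_pi_comp assms m_closed continuous_on_id)
qed (simp add: assms pi_J V_act act_mult)

lemma pi_one: "\<pi> \<one> v = v"
proof (rule dense_vectors [where P = "\<lambda>v. \<pi> \<one> v = v"])
  show "closed {v. \<pi> \<one> v = v}"
    by (intro closed_Collect_eq continuous_on_pi_comp one_closed continuous_on_id)
qed (simp add: pi_J act_one)

lemma pi_norm: "g \<in> carrier G \<Longrightarrow> norm (\<pi> g v) = norm v"
  by (rule cinner_preserving_norm [OF pi_cinner])

lemma J_norm_le:
  assumes \<psi>: "\<psi> \<in> V" and A: "A \<in> sets \<mu>" "emeasure \<mu> A < \<infinity>"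
    and le: "\<And>X. X \<in> A \<Longrightarrow> norm (\<psi> (coset_rep X)) \<le> \<delta>"
    and zero: "\<And>X. X \<in> lcosets H \<Longrightarrow> X \<notin> A \<Longrightarrow> \<psi> (coset_rep X) = 0"
    and \<delta>: "\<delta> \<ge> 0"
  shows "(norm (J \<psi>))\<^sup>2 \<le> \<delta>\<^sup>2 * measure \<mu> A"
proof -
  have "complex_of_real ((norm (J \<psi>))\<^sup>2) = ind_inner \<mu> \<psi> \<psi>"
    using J_cinner [OF \<psi> \<psi>] by (simp add: cinner_self)
  then have "ennreal ((norm (J \<psi>))\<^sup>2) = ennreal (norm (ind_inner \<mu> \<psi> \<psi>))"
    by (metis abs_of_nonneg norm_of_real zero_le_power2)
  also have "\<dots> \<le> (\<integral>\<^sup>+X. norm (cinner (\<psi> (coset_rep X)) (\<psi> (coset_rep X))) \<partial>\<mu>)"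
    unfolding ind_inner_def by (rule norm_integral_le_nn_integral)
  also have "\<dots> \<le> (\<integral>\<^sup>+X. ennreal (\<delta>\<^sup>2) * indicator A X \<partial>\<mu>)"
  proof (rule nn_integral_mono)
    fix X assume X: "X \<in> space \<mu>"
    show "ennreal (norm (cinner (\<psi> (coset_rep X)) (\<psi> (coset_rep X)))) \<le> ennreal (\<delta>\<^sup>2) * indicator A X"
    proof (cases "X \<in> A")
      case True
      have "norm (cinner (\<psi> (coset_rep X)) (\<psi> (coset_rep X))) \<le> \<delta>\<^sup>2"
        using power_mono [OF le [OF True] norm_ge_zero, of 2] by (simp add: cinner_self norm_power)
      then show ?thesis using True by (simp add: ennreal_leI)
    next
      case False
      then show ?thesis using X zero by (simp add: space_mu cinner_self)
    qed
  qed
  also have "\<dots> = ennreal (\<delta>\<^sup>2 * measure \<mu> A)"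
    using A by (simp add: nn_integral_cmult_indicator emeasure_eq_ennreal_measure ennreal_mult less_top)
  finally show ?thesis by (subst (asm) ennreal_le_iff) auto
qed

text \<open>For \<open>k\<close> in \<open>K 0\<close> the difference of \<open>\<eta>\<close> and its translate vanishes outside one fixed compact
  set of cosets. There it is uniformly small if \<open>k\<close> is close to the identity, by the tube lemma.\<close>

lemma act_near_identity:
  assumes \<eta>: "\<eta> \<in> V" and e: "e > 0"
  shows "\<exists>n. \<forall>k\<in>K n. norm (\<pi> k (J \<eta>) - J \<eta>) < e"
proof -
  obtain C where C: "finite C" "C \<subseteq> carrier G" "\<And>x. x \<in> carrier G \<Longrightarrow> \<eta> x \<noteq> 0 \<Longrightarrow> x <# H \<in> core C"
    using V_support [OF \<eta>] by metis
  define m where "m = measure \<mu> (core C)"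
  \<comment> \<open>any \<open>\<delta>\<close> with \<open>\<delta>\<^sup>2 m < e\<^sup>2\<close> would do\<close>
  define \<delta> where "\<delta> = e / (m + 2)"
  have m: "m \<ge> 0" by (simp add: m_def)
  have \<delta>: "\<delta> > 0" using e m by (simp add: \<delta>_def)
  let ?L = "\<Union>c\<in>C. K 0 #> c"
  let ?\<Phi> = "\<lambda>k x. norm (sqrt (R (inv k) x) *\<^sub>R \<eta> (inv k \<otimes> x) + (-1) *\<^sub>R \<eta> x)"
  have "\<exists>n. \<forall>k\<in>K n. \<forall>x\<in>?L. ?\<Phi> k x < \<delta>"
  proof (rule tube_at_identity [OF compactin_core_lift [OF C(1,2)]])
    have "continuous_map (prod_topology T T) euclidean (\<lambda>p. \<eta> (snd p))"
      using continuous_map_compose [OF continuous_map_snd V_continuous [OF \<eta>]] by (simp add: o_def)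
    then have "continuous_map (prod_topology T T) euclidean (\<lambda>p. (-1) *\<^sub>R \<eta> (snd p))"
      by (rule continuous_map_unop) (intro continuous_intros)
    from continuous_map_euclidean_add [OF continuous_map_V_translate_pair [OF \<eta>] this]
    have "continuous_map (prod_topology T T) euclidean
        (\<lambda>p. sqrt (R (inv (fst p)) (snd p)) *\<^sub>R \<eta> (inv (fst p) \<otimes> snd p) + (-1) *\<^sub>R \<eta> (snd p))"
      by (simp add: case_prod_beta')
    then have "continuous_map (prod_topology T T) euclideanreal
        (\<lambda>p. norm (sqrt (R (inv (fst p)) (snd p)) *\<^sub>R \<eta> (inv (fst p) \<otimes> snd p) + (-1) *\<^sub>R \<eta> (snd p)))"
      by (rule continuous_map_unop) (intro continuous_intros)
    then show "continuous_map (prod_topology T T) euclideanreal (\<lambda>(k, x). ?\<Phi> k x)"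
      by (simp add: case_prod_beta')
    fix x assume "x \<in> ?L"
    then have "x \<in> carrier G" using C(2) K_coset_carrier by auto
    then show "?\<Phi> \<one> x < \<delta>" using \<delta> by (simp add: R_one)
  qed
  then obtain n where n: "\<And>k x. k \<in> K n \<Longrightarrow> x \<in> ?L \<Longrightarrow> ?\<Phi> k x < \<delta>" by auto
  have "norm (\<pi> k (J \<eta>) - J \<eta>) < e" if k: "k \<in> K n" for k
  proof -
    have kG: "k \<in> carrier G" by (rule K_carrier [OF k])
    define \<psi> where "\<psi> x = act k \<eta> x + (-1) *\<^sub>C \<eta> x" for x
    have \<psi>: "\<psi> \<in> V" unfolding \<psi>_def by (intro V_add V_act V_scaleC \<eta> kG)
    have J\<psi>: "J \<psi> = \<pi> k (J \<eta>) - J \<eta>"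
    proof -
      have "J \<psi> = J (act k \<eta>) + (-1) *\<^sub>C J \<eta>"
        unfolding \<psi>_def using \<eta> kG by (simp add: J_add J_scaleC V_act V_scaleC)
      then show ?thesis using \<eta> kG by (simp add: pi_J scaleC_minus_one)
    qed
    have "(norm (J \<psi>))\<^sup>2 \<le> \<delta>\<^sup>2 * measure \<mu> (core C)"
    proof (rule J_norm_le [OF \<psi> core_sets core_finite])
      fix X assume "X \<in> core C"
      then obtain l where l: "l \<in> ?L" "l \<in> carrier G" "X = l <# H" using C(2) by (rule core_rep_cases)
      have "norm (\<psi> (coset_rep X)) = ?\<Phi> k l"
        using V_norm_rep [OF \<psi> l(2)] l by (simp add: \<psi>_def act_eq scaleC_minus_one)
      then show "norm (\<psi> (coset_rep X)) \<le> \<delta>" using n [OF k l(1)] by simp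
    next
      fix X assume X: "X \<in> lcosets H" "X \<notin> core C"
      define x where "x = coset_rep X"
      have x: "x \<in> carrier G" "X = x <# H" using coset_rep [OF X(1)] by (simp_all add: x_def)
      have "inv k <# X \<notin> core C" using core_translate [OF C(2) K_closed(3) [OF k] X(1)] X(2) by simp
      then have "\<eta> (inv k \<otimes> x) = 0" using C(3) [of "inv k \<otimes> x"] x kG by (auto simp: translate_coset)
      moreover have "\<eta> x = 0" using C(3) [of x] x X by auto
      ultimately show "\<psi> (coset_rep X) = 0" using x(1) by (simp add: \<psi>_def act_eq x_def [symmetric])
    qed (use C \<delta> in auto)
    also have "\<dots> = \<delta>\<^sup>2 * m" by (simp add: m_def)
    also have "\<dots> < e\<^sup>2"
    proof -
      have "m < (m + 2)\<^sup>2" using m by (simp add: power2_eq_square algebra_simps add_nonneg_pos)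
      then have "m / (m + 2)\<^sup>2 < 1" using m by simp
      then have "e\<^sup>2 * (m / (m + 2)\<^sup>2) < e\<^sup>2 * 1" using e by (intro mult_strict_left_mono) auto
      then show ?thesis by (simp add: \<delta>_def power_divide)
    qed
    finally show ?thesis using e power2_less_imp_less [of "norm (J \<psi>)" e] by (simp add: J\<psi>)
  qed
  then show ?thesis by blast
qed

lemma pi_near_identity:
  assumes e: "e > 0" shows "\<exists>n. \<forall>k\<in>K n. norm (\<pi> k v - v) < e"
proof -
  obtain \<eta> where \<eta>: "\<eta> \<in> V" "norm (v - J \<eta>) < e / 3" using approx [of "e/3"] e by auto
  obtain n where n: "\<And>k. k \<in> K n \<Longrightarrow> norm (\<pi> k (J \<eta>) - J \<eta>) < e / 3"
    using act_near_identity [OF \<eta>(1), of "e/3"] e by auto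
  have "norm (\<pi> k v - v) < e" if k: "k \<in> K n" for k
  proof -
    have "\<pi> k v - v = \<pi> k (v - J \<eta>) + (\<pi> k (J \<eta>) - J \<eta>) - (v - J \<eta>)"
      by (simp add: clinear_diff [OF pi_clinear [OF K_carrier [OF k]]])
    then have "norm (\<pi> k v - v) \<le> norm (\<pi> k (v - J \<eta>)) + norm (\<pi> k (J \<eta>) - J \<eta>) + norm (v - J \<eta>)"
      by (metis norm_triangle_le_diff norm_triangle_ineq add_mono_thms_linordered_semiring(3))
    also have "\<dots> < e" using n [OF k] \<eta>(2) by (simp add: pi_norm [OF K_carrier [OF k]])
    finally show ?thesis .
  qed
  then show ?thesis by blast
qed

lemma pi_strongly_continuous: "continuous_map T euclidean (\<lambda>g. \<pi> g v)"
  unfolding continuous_map_def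
proof (intro conjI allI impI)
  fix U :: "'h set" assume "openin euclidean U"
  then have U: "open U" by simp
  show "openin T {g \<in> topspace T. \<pi> g v \<in> U}"
  proof (subst openin_subopen, intro ballI)
    fix g assume "g \<in> {g \<in> topspace T. \<pi> g v \<in> U}"
    then have g: "g \<in> carrier G" "\<pi> g v \<in> U" by (auto simp: topspace_eq)
    obtain e where e: "e > 0" "ball (\<pi> g v) e \<subseteq> U" using U g(2) open_contains_ball by metis
    obtain n where n: "\<And>k. k \<in> K n \<Longrightarrow> norm (\<pi> k v - v) < e" using pi_near_identity [OF e(1)] by metis
    have "g <# K n \<subseteq> {g \<in> topspace T. \<pi> g v \<in> U}"
    proof
      fix g' assume "g' \<in> g <# K n"
      then obtain k where k: "k \<in> K n" "g' = g \<otimes> k" by (auto simp: l_coset_def)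
      have kG: "k \<in> carrier G" by (rule K_carrier [OF k(1)])
      have "\<pi> g' v - \<pi> g v = \<pi> g (\<pi> k v - v)"
        using g kG by (simp add: k(2) pi_mult clinear_diff [OF pi_clinear])
      then have "norm (\<pi> g' v - \<pi> g v) < e" using n [OF k(1)] g by (simp add: pi_norm)
      then have "\<pi> g' v \<in> ball (\<pi> g v) e" by (simp add: dist_norm norm_minus_commute)
      then show "g' \<in> {g \<in> topspace T. \<pi> g v \<in> U}" using e g kG k by (auto simp: topspace_eq)
    qed
    moreover have "openin T (g <# K n)" by (rule openin_l_coset [OF K_openin g(1)])
    moreover have "g \<in> g <# K n" using K_closed(1) [of n] g(1) by (force simp: l_coset_def)
    ultimately show "\<exists>W. openin T W \<and> g \<in> W \<and> W \<subseteq> {g \<in> topspace T. \<pi> g v \<in> U}" by blast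
  qed
qed simp

lemma unitary: "unitary_rep G T \<pi>"
  unfolding unitary_rep_def
proof (intro conjI ballI allI)
  fix g assume g: "g \<in> carrier G"
  show "clinear (\<pi> g)" by (rule pi_clinear [OF g])
  show "surj (\<pi> g)"
  proof (rule surjI)
    show "\<pi> g (\<pi> (inv g) v) = v" for v
      using pi_mult [OF g, of "inv g" v] g by (simp add: pi_one)
  qed
  show "cinner (\<pi> g v) (\<pi> g w) = cinner v w" for v w by (rule pi_cinner [OF g])
  show "\<pi> (g \<otimes> g') = \<pi> g \<circ> \<pi> g'" if "g' \<in> carrier G" for g'
    using pi_mult [OF g that] by (auto simp: fun_eq_iff)
qed (rule pi_strongly_continuous)

section \<open>Domination of matrix coefficients\<close>

lemma V_bounded:
  assumes \<eta>: "\<eta> \<in> V" and C: "finite C" "C \<subseteq> carrier G"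
  obtains B where "B \<ge> 0" "\<And>X. X \<in> core C \<Longrightarrow> norm (\<eta> (coset_rep X)) \<le> B"
proof -
  obtain B where B: "B \<ge> 0" "\<And>x. x \<in> (\<Union>c\<in>C. K 0 #> c) \<Longrightarrow> norm (\<eta> x) \<le> B"
    using bounded_on_compact [OF V_continuous [OF \<eta>] compactin_core_lift [OF C]] by metis
  have "norm (\<eta> (coset_rep X)) \<le> B" if "X \<in> core C" for X
    using that C(2) by (rule core_rep_cases) (use B in \<open>simp add: V_norm_rep [OF \<eta>]\<close>)
  then show ?thesis using B(1) that by blast
qed

text \<open>Both sections are bounded and vanish outside a common \<open>core C\<close>, so pointwise their inner product is at
  most a constant times the integrand of \<open>coef\<close>.\<close>

lemma coefficient_bound:
  assumes \<eta>: "\<eta> \<in> V" "\<eta>' \<in> V"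
  obtains C B where "finite C" "C \<subseteq> carrier G" "B \<ge> 0"
    "\<And>g. g \<in> carrier G \<Longrightarrow> ennreal (cmod (cinner (\<pi> g (J \<eta>)) (J \<eta>'))) \<le> ennreal B * coef (core C) g"
proof -
  obtain C1 where C1: "finite C1" "C1 \<subseteq> carrier G" "\<And>x. x \<in> carrier G \<Longrightarrow> \<eta> x \<noteq> 0 \<Longrightarrow> x <# H \<in> core C1"
    using V_support [OF \<eta>(1)] by metis
  obtain C2 where C2: "finite C2" "C2 \<subseteq> carrier G" "\<And>x. x \<in> carrier G \<Longrightarrow> \<eta>' x \<noteq> 0 \<Longrightarrow> x <# H \<in> core C2"
    using V_support [OF \<eta>(2)] by metis
  define C where "C = C1 \<union> C2"
  have C: "finite C" "C \<subseteq> carrier G" using C1 C2 by (auto simp: C_def)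
  obtain B1 where B1: "B1 \<ge> 0" "\<And>X. X \<in> core C \<Longrightarrow> norm (\<eta> (coset_rep X)) \<le> B1"
    using V_bounded [OF \<eta>(1) C] by metis
  obtain B2 where B2: "B2 \<ge> 0" "\<And>X. X \<in> core C \<Longrightarrow> norm (\<eta>' (coset_rep X)) \<le> B2"
    using V_bounded [OF \<eta>(2) C] by metis
  have le1: "norm (\<eta> x) \<le> B1 * indicator (core C) (x <# H)" if "x \<in> carrier G" for x
    using B1(1) B1(2) [of "x <# H"] C1(3) [OF that] V_norm_rep [OF \<eta>(1) that]
    by (cases "\<eta> x = 0") (auto simp: C_def core_Un indicator_def)
  have le2: "norm (\<eta>' x) \<le> B2 * indicator (core C) (x <# H)" if "x \<in> carrier G" for x
    using B2(1) B2(2) [of "x <# H"] C2(3) [OF that] V_norm_rep [OF \<eta>(2) that]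
    by (cases "\<eta>' x = 0") (auto simp: C_def core_Un indicator_def)
  have "ennreal (cmod (cinner (\<pi> g (J \<eta>)) (J \<eta>'))) \<le> ennreal (B1 * B2) * coef (core C) g"
    if g: "g \<in> carrier G" for g
  proof -
    have "ennreal (cmod (cinner (\<pi> g (J \<eta>)) (J \<eta>'))) = ennreal (cmod (ind_inner \<mu> (act g \<eta>) \<eta>'))"
      using g \<eta> by (simp add: pi_J J_cinner V_act)
    also have "\<dots> \<le> (\<integral>\<^sup>+X. norm (cinner (act g \<eta> (coset_rep X)) (\<eta>' (coset_rep X))) \<partial>\<mu>)"
      unfolding ind_inner_def by (rule norm_integral_le_nn_integral)
    also have "\<dots> \<le> (\<integral>\<^sup>+X. ennreal (B1 * B2) * ennreal (sqrt (R (inv g) (coset_rep X)) *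
        indicator (core C) (inv g <# X) * indicator (core C) X) \<partial>\<mu>)"
    proof (rule nn_integral_mono)
      fix X assume "X \<in> space \<mu>"
      then have X: "X \<in> lcosets H" by (simp add: space_mu)
      define x where "x = coset_rep X"
      have x: "x \<in> carrier G" "X = x <# H" using coset_rep [OF X] by (simp_all add: x_def)
      have s: "sqrt (R (inv g) x) \<ge> 0" using R_pos [of "inv g" x] g x by simp
      have "norm (cinner (act g \<eta> x) (\<eta>' x)) \<le> norm (act g \<eta> x) * norm (\<eta>' x)" by (rule cmod_cinner_le)
      also have "\<dots> = sqrt (R (inv g) x) * (norm (\<eta> (inv g \<otimes> x)) * norm (\<eta>' x))"
        using s x by (simp add: act_eq)
      also have "\<dots> \<le> sqrt (R (inv g) x) * ((B1 * indicator (core C) ((inv g \<otimes> x) <# H)) *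
          (B2 * indicator (core C) (x <# H)))"
        using x g s B1(1) B2(1) by (intro mult_left_mono mult_mono le1 le2) auto
      also have "\<dots> = (B1 * B2) * (sqrt (R (inv g) x) * indicator (core C) (inv g <# X) * indicator (core C) X)"
        using x g by (simp add: translate_coset mult_ac)
      finally show "ennreal (norm (cinner (act g \<eta> (coset_rep X)) (\<eta>' (coset_rep X)))) \<le>
          ennreal (B1 * B2) * ennreal (sqrt (R (inv g) (coset_rep X)) *
          indicator (core C) (inv g <# X) * indicator (core C) X)"
        using s B1(1) B2(1) unfolding x_def [symmetric] by (subst ennreal_mult [symmetric]) (auto intro: ennreal_leI)
    qed
    also have "\<dots> = ennreal (B1 * B2) * coef (core C) g"
      unfolding coef_def
    proof (rule nn_integral_cmult)
      have "(\<lambda>X. inv g <# X) \<in> measurable \<mu> \<mu>" "(\<lambda>X. R (inv g) (coset_rep X)) \<in> borel_measurable \<mu>"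
        "core C \<in> sets \<mu>" using g C core_sets by auto
      then show "(\<lambda>X. ennreal (sqrt (R (inv g) (coset_rep X)) * indicator (core C) (inv g <# X) *
          indicator (core C) X)) \<in> borel_measurable \<mu>" by measurable
    qed
    finally show ?thesis .
  qed
  then show ?thesis using that [OF C, of "B1 * B2"] B1(1) B2(1) by simp
qed

text \<open>Approximating \<open>v\<close> and \<open>w\<close> by images of sections changes all coefficients by a uniformly small amount,
  since \<open>\<pi>\<close> is isometric. The set in question is then closed and contained in a compact set.\<close>

lemma C0_criterion:
  assumes decay: "\<And>C e. finite C \<Longrightarrow> C \<subseteq> carrier G \<Longrightarrow> e > 0 \<Longrightarrow>
      \<exists>Q. compactin T Q \<and> (\<forall>g\<in>carrier G - Q. coef (core C) g \<le> ennreal e)"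
  shows "C0_rep G T \<pi>"
  unfolding C0_rep_def
proof (intro conjI allI impI)
  show "unitary_rep G T \<pi>" by (rule unitary)
  fix v w and \<epsilon> :: real assume \<epsilon>: "\<epsilon> > 0"
  let ?S = "{g \<in> carrier G. cmod (cinner (\<pi> g v) w) \<ge> \<epsilon>}"
  \<comment> \<open>chosen so that \<open>d \<le> 1\<close> and \<open>d * norm w + (norm v + 1) * d\<close> is at most \<open>\<epsilon> / 4\<close>\<close>
  define d where "d = \<epsilon> / (4 * (norm w + norm v + 1 + \<epsilon>))"
  have pos: "norm w + norm v + 1 + \<epsilon> > 0" using \<epsilon> by (simp add: add_nonneg_pos)
  have d: "d > 0" using \<epsilon> pos by (simp add: d_def)
  obtain \<eta> where \<eta>: "\<eta> \<in> V" "norm (v - J \<eta>) < d" using approx [OF d] by auto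
  obtain \<eta>' where \<eta>': "\<eta>' \<in> V" "norm (w - J \<eta>') < d" using approx [OF d] by auto
  have d_eq: "d * (norm w + norm v + 1 + \<epsilon>) = \<epsilon> / 4" 
  proof -
    have "\<epsilon> / (4 * P) * P = \<epsilon> / 4" if "P > 0" for P :: real using that by simp
    from this [OF pos] show ?thesis by (simp only: d_def)
  qed
  have "d \<le> 1"
  proof -
    have "\<epsilon> \<le> 4 * (norm w + norm v + 1 + \<epsilon>)" using \<epsilon> by (simp add: add_nonneg_nonneg)
    then show ?thesis using pos by (simp add: d_def)
  qed
  have close: "cmod (cinner (\<pi> g v) w) \<le> cmod (cinner (\<pi> g (J \<eta>)) (J \<eta>')) + \<epsilon> / 2"
    if g: "g \<in> carrier G" for g
  proof -
    have "cinner (\<pi> g v) w = cinner (\<pi> g (J \<eta>)) (J \<eta>') + cinner (\<pi> g (v - J \<eta>)) w +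
        cinner (\<pi> g (J \<eta>)) (w - J \<eta>')"
      by (simp add: clinear_diff [OF pi_clinear [OF g]]
          bounded_bilinear.diff_left [OF bounded_bilinear_cinner]
          bounded_bilinear.diff_right [OF bounded_bilinear_cinner])
    then have "cmod (cinner (\<pi> g v) w) \<le> cmod (cinner (\<pi> g (J \<eta>)) (J \<eta>')) +
        cmod (cinner (\<pi> g (v - J \<eta>)) w) + cmod (cinner (\<pi> g (J \<eta>)) (w - J \<eta>'))"
      by (metis (no_types, lifting) norm_triangle_ineq norm_triangle_mono order_refl)
    moreover have "cmod (cinner (\<pi> g (v - J \<eta>)) w) \<le> d * norm w"
      using cmod_cinner_le [of "\<pi> g (v - J \<eta>)" w] mult_right_mono [OF less_imp_le [OF \<eta>(2)], of "norm w"]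
      by (simp add: pi_norm [OF g])
    moreover have "cmod (cinner (\<pi> g (J \<eta>)) (w - J \<eta>')) \<le> (norm v + 1) * d"
    proof -
      have "norm (J \<eta>) \<le> norm v + norm (v - J \<eta>)"
        by (metis norm_minus_commute norm_triangle_sub)
      then have "norm (J \<eta>) \<le> norm v + 1" using \<eta>(2) \<open>d \<le> 1\<close> by simp
      then have "norm (J \<eta>) * norm (w - J \<eta>') \<le> (norm v + 1) * d"
        using \<eta>'(2) by (intro mult_mono) auto
      then show ?thesis using cmod_cinner_le [of "\<pi> g (J \<eta>)" "w - J \<eta>'"] by (simp add: pi_norm [OF g])
    qed
    moreover have "d * norm w + (norm v + 1) * d \<le> \<epsilon> / 4"
    proof -
      have "d * norm w + (norm v + 1) * d = d * (norm w + norm v + 1 + \<epsilon>) - d * \<epsilon>"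
        by (simp add: algebra_simps)
      moreover have "d * \<epsilon> \<ge> 0" using d \<epsilon> by simp
      ultimately show ?thesis using d_eq by linarith
    qed
    ultimately show ?thesis using \<epsilon> by linarith
  qed
  obtain C B where CB: "finite C" "C \<subseteq> carrier G" "B \<ge> 0"
    "\<And>g. g \<in> carrier G \<Longrightarrow> ennreal (cmod (cinner (\<pi> g (J \<eta>)) (J \<eta>'))) \<le> ennreal B * coef (core C) g"
    using coefficient_bound [OF \<eta>(1) \<eta>'(1)] by metis
  define e where "e = \<epsilon> / (4 * (B + 1))"
  have e: "e > 0" using \<epsilon> CB(3) by (simp add: e_def)
  obtain Q where Q: "compactin T Q" "\<And>g. g \<in> carrier G \<Longrightarrow> g \<notin> Q \<Longrightarrow> coef (core C) g \<le> ennreal e"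
    using decay [OF CB(1,2) e] by auto
  have "?S \<subseteq> Q"
  proof
    fix g assume "g \<in> ?S"
    then have g: "g \<in> carrier G" "cmod (cinner (\<pi> g v) w) \<ge> \<epsilon>" by auto
    show "g \<in> Q"
    proof (rule ccontr)
      assume "g \<notin> Q"
      then have "ennreal (cmod (cinner (\<pi> g (J \<eta>)) (J \<eta>'))) \<le> ennreal B * ennreal e"
        using CB(4) [OF g(1)] Q(2) [OF g(1)] by (meson mult_left_mono order_trans zero_le)
      also have "\<dots> = ennreal (B * e)" using CB(3) e by (simp add: ennreal_mult)
      finally have "cmod (cinner (\<pi> g (J \<eta>)) (J \<eta>')) \<le> B * e"
        using CB(3) e by (subst (asm) ennreal_le_iff) auto
      also have "\<dots> \<le> \<epsilon> / 4"
      proof -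
        have "B * e \<le> (B + 1) * e" using e by (simp add: algebra_simps)
        also have "\<dots> = \<epsilon> / 4"
        proof -
          have "P * (\<epsilon> / (4 * P)) = \<epsilon> / 4" if "P > 0" for P :: real using that by simp
          from this [of "B + 1"] show ?thesis using CB(3) by (simp only: e_def)
        qed
        finally show ?thesis .
      qed
      finally show False using close [OF g(1)] g(2) \<epsilon> by linarith
    qed
  qed
  moreover have "closedin T ?S"
  proof -
    have "continuous_map T euclidean (\<lambda>g. cinner (\<pi> g v) w)"
      by (rule continuous_map_unop [OF pi_strongly_continuous])
        (intro bounded_bilinear.continuous_on [OF bounded_bilinear_cinner] continuous_intros)
    then have "continuous_map T euclideanreal (\<lambda>g. cmod (cinner (\<pi> g v) w))"
      by (rule continuous_map_unop) (intro continuous_intros)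
    from closedin_continuous_map_preimage [OF this, of "{\<epsilon>..}"]
    show ?thesis by (simp add: topspace_eq)
  qed
  ultimately show "compactin T ?S" by (intro closed_compactin [OF Q(1)])
qed

end

section \<open>Decay of the dominating coefficient\<close>

lemma at_most_one_nonzero:
  fixes f :: "'i \<Rightarrow> 'b::zero"
  assumes "\<And>i j. i \<in> I \<Longrightarrow> j \<in> I \<Longrightarrow> i \<noteq> j \<Longrightarrow> f i = 0 \<or> f j = 0"
  shows "(\<forall>i\<in>I. f i = 0) \<or> (\<exists>j\<in>I. \<forall>i\<in>I. f i = (if i = j then f j else 0))"
  using assms by (metis (full_types))

text \<open>A pointwise substitute for the Cauchy-Schwarz inequality in \<open>L\<^sup>2\<close>: Young's inequality
  \<open>2ab \<le> a\<^sup>2/q + q b\<^sup>2\<close>. For the \<open>x i\<close> it is needed only once, as at most one of them is not zero; for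
  the \<open>y i\<close> it is applied to each summand with the roles of the factors exchanged. The \<open>x i\<close> and \<open>y i\<close>
  will be the two parts of translated indicator functions.\<close>

lemma sum_young:
  fixes x y :: "'i \<Rightarrow> real"
  assumes "finite I" and q: "q > 0" "real (card I) = q\<^sup>2"
    and one: "\<And>i j. i \<in> I \<Longrightarrow> j \<in> I \<Longrightarrow> i \<noteq> j \<Longrightarrow> x i = 0 \<or> x j = 0"
  shows "(\<Sum>i\<in>I. 2 * (x i + y i) * s) \<le> (\<Sum>i\<in>I. (x i)\<^sup>2 / q + q * (y i)\<^sup>2 + 2 * s\<^sup>2 / q)"
proof -
  have young: "2 * a * b \<le> a\<^sup>2 / q + q * b\<^sup>2" for a b :: real
  proof -
    have "a\<^sup>2 / q + q * b\<^sup>2 - 2 * a * b = (a - q * b)\<^sup>2 / q"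
      using q(1) by (simp add: field_simps power2_eq_square)
    moreover have "(a - q * b)\<^sup>2 / q \<ge> 0" using q(1) by simp
    ultimately show ?thesis by linarith
  qed
  have "(\<Sum>i\<in>I. 2 * x i * s) \<le> (\<Sum>i\<in>I. (x i)\<^sup>2 / q) + q * s\<^sup>2"
  proof -
    consider "\<forall>i\<in>I. x i = 0" | j where "j \<in> I" "\<forall>i\<in>I. x i = (if i = j then x j else 0)"
      using at_most_one_nonzero [of I x, OF one] by blast
    then show ?thesis
    proof cases
      case 1
      then show ?thesis using q(1) by simp
    next
      case one: (2 j)
      have "(\<Sum>i\<in>I. 2 * x i * s) = (\<Sum>i\<in>I. if i = j then 2 * x j * s else 0)"
        using one(2) by (intro sum.cong) auto
      also have "\<dots> = 2 * x j * s" using one(1) assms(1) by simp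
      finally have 1: "(\<Sum>i\<in>I. 2 * x i * s) = 2 * x j * s" .
      have "(\<Sum>i\<in>I. (x i)\<^sup>2 / q) = (\<Sum>i\<in>I. if i = j then (x j)\<^sup>2 / q else 0)"
        using one(2) by (intro sum.cong) auto
      also have "\<dots> = (x j)\<^sup>2 / q" using one(1) assms(1) by simp
      finally show ?thesis using 1 young [of "x j" s] by simp
    qed
  qed
  moreover have "2 * y i * s \<le> q * (y i)\<^sup>2 + s\<^sup>2 / q" for i
    using young [of s "y i"] by (simp add: mult_ac add.commute)
  then have "(\<Sum>i\<in>I. 2 * y i * s) \<le> (\<Sum>i\<in>I. q * (y i)\<^sup>2 + s\<^sup>2 / q)" by (rule sum_mono)
  moreover have "q * s\<^sup>2 = (\<Sum>i\<in>I. s\<^sup>2 / q)"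
    using q by (simp add: power2_eq_square)
  ultimately have "(\<Sum>i\<in>I. 2 * x i * s) + (\<Sum>i\<in>I. 2 * y i * s) \<le>
      (\<Sum>i\<in>I. (x i)\<^sup>2 / q) + (\<Sum>i\<in>I. s\<^sup>2 / q) + (\<Sum>i\<in>I. q * (y i)\<^sup>2 + s\<^sup>2 / q)" by linarith
  moreover have "(\<Sum>i\<in>I. 2 * (x i + y i) * s) = (\<Sum>i\<in>I. 2 * x i * s) + (\<Sum>i\<in>I. 2 * y i * s)"
    unfolding sum.distrib [symmetric] by (intro sum.cong refl) (simp add: algebra_simps)
  moreover have "(\<Sum>i\<in>I. (x i)\<^sup>2 / q) + (\<Sum>i\<in>I. s\<^sup>2 / q) + (\<Sum>i\<in>I. q * (y i)\<^sup>2 + s\<^sup>2 / q) =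
      (\<Sum>i\<in>I. (x i)\<^sup>2 / q + q * (y i)\<^sup>2 + 2 * s\<^sup>2 / q)"
    unfolding sum.distrib [symmetric] by (intro sum.cong refl) simp
  ultimately show ?thesis by linarith
qed

context rho_space
begin

text \<open>The quasi-regular representation of \<open>G\<close> on functions on \<open>G/H\<close>.\<close>

definition tau :: "'g \<Rightarrow> ('g set \<Rightarrow> real) \<Rightarrow> 'g set \<Rightarrow> real"
  where "tau g \<phi> X = sqrt (R (inv g) (coset_rep X)) * \<phi> (inv g <# X)"

lemma coef_tau: "coef A g = (\<integral>\<^sup>+X. ennreal (tau g (indicator A) X * indicator A X) \<partial>\<mu>)"
  by (simp add: coef_def tau_def)

lemma tau_measurable:
  assumes "g \<in> carrier G" "\<phi> \<in> borel_measurable \<mu>" shows "tau g \<phi> \<in> borel_measurable \<mu>"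
  unfolding tau_def
  using measurable_compose [OF translate_measurable [OF inv_closed [OF assms(1)]] assms(2)]
    R_measurable [OF inv_closed [OF assms(1)]]
  by (intro borel_measurable_times borel_measurable_sqrt) auto

lemma tau_tau:
  assumes "g \<in> carrier G" "g' \<in> carrier G" "X \<in> lcosets H"
  shows "tau g (tau g' \<phi>) X = tau (g \<otimes> g') \<phi> X"
proof -
  define x where "x = coset_rep X"
  have x: "x \<in> carrier G" "X = x <# H" using coset_rep [OF assms(3)] by (simp_all add: x_def)
  have "R (inv g') (coset_rep (inv g <# X)) = R (inv g') (inv g \<otimes> x)"
    using x assms by (simp add: translate_coset R_rep)
  moreover have "R (inv (g \<otimes> g')) x = R (inv g') (inv g \<otimes> x) * R (inv g) x"
    using assms x R_mult [of "inv g'" "inv g" x] by (simp add: inv_mult_group)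
  moreover have "inv g' <# (inv g <# X) = inv (g \<otimes> g') <# X"
    using assms by (simp add: translate_translate inv_mult_group)
  ultimately show ?thesis by (simp add: tau_def x_def [symmetric] real_sqrt_mult)
qed

lemma tau_isometric:
  assumes g: "g \<in> carrier G" and \<phi>: "\<phi> \<in> borel_measurable \<mu>" "\<psi> \<in> borel_measurable \<mu>"
  shows "(\<integral>\<^sup>+X. ennreal (tau g \<phi> X * tau g \<psi> X) \<partial>\<mu>) = (\<integral>\<^sup>+X. ennreal (\<phi> X * \<psi> X) \<partial>\<mu>)"
proof -
  let ?f = "\<lambda>X. ennreal (\<phi> X * \<psi> X)"
  have f: "?f \<in> borel_measurable \<mu>" using \<phi> by measurable
  have "(\<integral>\<^sup>+X. ennreal (tau g \<phi> X * tau g \<psi> X) \<partial>\<mu>) =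
      (\<integral>\<^sup>+X. ennreal (R (inv g) (coset_rep X)) * ?f (inv g <# X) \<partial>\<mu>)"
  proof (rule nn_integral_cong)
    fix X assume "X \<in> space \<mu>"
    then have "R (inv g) (coset_rep X) \<ge> 0"
      using R_pos [of "inv g" "coset_rep X"] coset_rep(1) [of X] g by (simp add: space_mu)
    then show "ennreal (tau g \<phi> X * tau g \<psi> X) = ennreal (R (inv g) (coset_rep X)) * ?f (inv g <# X)"
    proof -
      have "tau g \<phi> X * tau g \<psi> X = (sqrt (R (inv g) (coset_rep X)))\<^sup>2 * (\<phi> (inv g <# X) * \<psi> (inv g <# X))"
        unfolding tau_def power2_eq_square by (simp only: mult_ac)
      also have "(sqrt (R (inv g) (coset_rep X)))\<^sup>2 = R (inv g) (coset_rep X)"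
        using \<open>R (inv g) (coset_rep X) \<ge> 0\<close> by (rule real_sqrt_pow2)
      finally show ?thesis using \<open>R (inv g) (coset_rep X) \<ge> 0\<close> by (simp add: ennreal_mult')
    qed
  qed
  also have "\<dots> = (\<integral>\<^sup>+X. ?f (inv g <# (inv (inv g) <# X)) \<partial>\<mu>)"
    using g measurable_compose [OF translate_measurable [of "inv g"] f]
    by (intro nn_integral_translate [where f = "\<lambda>X. ?f (inv g <# X)"]) auto
  also have "\<dots> = (\<integral>\<^sup>+X. ?f X \<partial>\<mu>)"
    using g by (intro nn_integral_cong) (simp add: space_mu translate_inv)
  finally show ?thesis .
qed

lemma tau_indicator_square:
  assumes "g \<in> carrier G" "B \<in> sets \<mu>"
  shows "(\<integral>\<^sup>+X. ennreal ((tau g (indicator B) X)\<^sup>2) \<partial>\<mu>) = emeasure \<mu> B"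
proof -
  have "(\<integral>\<^sup>+X. ennreal ((tau g (indicator B) X)\<^sup>2) \<partial>\<mu>) = (\<integral>\<^sup>+X. ennreal (indicator B X * indicator B X) \<partial>\<mu>)"
    unfolding power2_eq_square using assms by (intro tau_isometric) auto
  also have "\<dots> = (\<integral>\<^sup>+X. indicator B X \<partial>\<mu>)"
    by (intro nn_integral_cong) (auto simp: indicator_def)
  finally show ?thesis using assms by simp
qed

text \<open>\<open>R \<one> = 1\<close>, and \<open>1/4 < 1\<close>; the constant is chosen as a square because \<open>tau\<close> involves the square
  root of \<open>R\<close>.\<close>

lemma R_near_identity:
  assumes C: "finite C" "C \<subseteq> carrier G"
  shows "\<exists>r. \<forall>k\<in>K r. \<forall>X\<in>core C. R k (coset_rep X) \<ge> 1 / 4"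
proof -
  have "continuous_map (prod_topology T T) euclideanreal (\<lambda>p. - R (fst p) (snd p))"
    using R_continuous_pair by (intro continuous_map_minus) (simp add: case_prod_beta')
  then have "\<exists>r. \<forall>k\<in>K r. \<forall>x\<in>(\<Union>c\<in>C. K 0 #> c). - R k x < - (1 / 4)"
    using C(2) K_coset_carrier
    by (intro tube_at_identity [OF compactin_core_lift [OF C]]) (auto simp: case_prod_beta' R_one subset_eq)
  then obtain r where r: "\<And>k x. k \<in> K r \<Longrightarrow> x \<in> (\<Union>c\<in>C. K 0 #> c) \<Longrightarrow> - R k x < - (1 / 4)" by blast
  have "R k (coset_rep X) \<ge> 1 / 4" if k: "k \<in> K r" and X: "X \<in> core C" for k X
  proof -
    obtain l where l: "l \<in> (\<Union>c\<in>C. K 0 #> c)" "l \<in> carrier G" "X = l <# H"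
      using X C(2) by (rule core_rep_cases)
    then show ?thesis using r [OF k l(1)] R_rep [OF K_carrier [OF k] l(2)] by simp
  qed
  then show ?thesis by blast
qed

text \<open>Each translate of \<open>B\<close> by \<open>u i\<close> lies in \<open>core C\<close> and has at least a quarter of the measure of \<open>B\<close>.\<close>

lemma measure_disjoint_translates:
  fixes u :: "nat \<Rightarrow> 'g"
  assumes C: "finite C" "C \<subseteq> carrier G"
    and r: "\<And>k X. k \<in> K r \<Longrightarrow> X \<in> core C \<Longrightarrow> R k (coset_rep X) \<ge> 1 / 4"
    and B: "B \<in> sets \<mu>" "B \<subseteq> core C"
    and u: "\<And>i. i < N \<Longrightarrow> u i \<in> K r"
    and disj: "\<And>i j X Y. i < N \<Longrightarrow> j < N \<Longrightarrow> i \<noteq> j \<Longrightarrow> X \<in> B \<Longrightarrow> Y \<in> B \<Longrightarrow> u i <# X \<noteq> u j <# Y"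
  shows "of_nat N * emeasure \<mu> B \<le> 4 * emeasure \<mu> (core C)"
proof -
  have uG: "u i \<in> carrier G" if "i < N" for i by (rule K_carrier [OF u [OF that]])
  have piece: "emeasure \<mu> B \<le> 4 * (\<integral>\<^sup>+X. indicator B (inv (u i) <# X) \<partial>\<mu>)" if i: "i < N" for i
  proof -
    have "emeasure \<mu> B = (\<integral>\<^sup>+X. indicator B X \<partial>\<mu>)" using B by simp
    also have "\<dots> \<le> (\<integral>\<^sup>+X. 4 * (ennreal (R (u i) (coset_rep X)) * indicator B X) \<partial>\<mu>)"
    proof (rule nn_integral_mono)
      fix X
      have "1 \<le> 4 * ennreal (R (u i) (coset_rep X))" if "X \<in> B"
      proof -
        have "1 \<le> 4 * R (u i) (coset_rep X)" using r [OF u [OF i], of X] B(2) that by auto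
        then have "ennreal 1 \<le> ennreal (4 * R (u i) (coset_rep X))" by (rule ennreal_leI)
        then show ?thesis by (simp add: ennreal_mult')
      qed
      then show "indicator B X \<le> 4 * (ennreal (R (u i) (coset_rep X)) * indicator B X)"
        by (auto simp: indicator_def)
    qed
    also have "\<dots> = 4 * (\<integral>\<^sup>+X. ennreal (R (u i) (coset_rep X)) * indicator B X \<partial>\<mu>)"
      using R_measurable [OF uG [OF i]] B(1)
      by (intro nn_integral_cmult borel_measurable_times_ennreal borel_measurable_indicator) auto
    also have "\<dots> = 4 * (\<integral>\<^sup>+X. indicator B (inv (u i) <# X) \<partial>\<mu>)"
      using B by (subst nn_integral_translate [OF uG [OF i]]) auto
    finally show ?thesis .
  qed
  have "of_nat N * emeasure \<mu> B = (\<Sum>i<N. emeasure \<mu> B)" by simp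
  also have "\<dots> \<le> (\<Sum>i<N. 4 * (\<integral>\<^sup>+X. indicator B (inv (u i) <# X) \<partial>\<mu>))"
    by (intro sum_mono piece) simp
  also have "\<dots> = 4 * (\<integral>\<^sup>+X. (\<Sum>i<N. indicator B (inv (u i) <# X)) \<partial>\<mu>)"
  proof -
    have "(\<lambda>X. indicator B (inv (u i) <# X) :: ennreal) \<in> borel_measurable \<mu>" if "i < N" for i
      using measurable_compose [OF translate_measurable [of "inv (u i)"], of "indicator B"] B(1) uG [OF that]
      by simp
    then show ?thesis by (subst nn_integral_sum) (auto simp: sum_distrib_left)
  qed
  also have "\<dots> \<le> 4 * (\<integral>\<^sup>+X. indicator (core C) X \<partial>\<mu>)"
  proof (intro mult_left_mono nn_integral_mono)
    fix X assume "X \<in> space \<mu>"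
    then have X: "X \<in> lcosets H" by (simp add: space_mu)
    let ?f = "\<lambda>i. indicator B (inv (u i) <# X) :: ennreal"
    have one: "?f i = 0 \<or> ?f j = 0" if "i \<in> {..<N}" "j \<in> {..<N}" "i \<noteq> j" for i j
      using disj [of i j "inv (u i) <# X" "inv (u j) <# X"] that X
      by (auto simp: indicator_def translate_inv uG)
    show "(\<Sum>i<N. ?f i) \<le> indicator (core C) X"
    proof -
      consider "\<forall>i\<in>{..<N}. ?f i = 0" | j where "j \<in> {..<N}" "\<forall>i\<in>{..<N}. ?f i = (if i = j then ?f j else 0)"
        using at_most_one_nonzero [of "{..<N}" ?f, OF one] by blast
      then show ?thesis
      proof cases
        case one: (2 j)
        have "(\<Sum>i<N. ?f i) = (\<Sum>i<N. if i = j then ?f j else 0)" using one(2) by (intro sum.cong) auto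
        also have "\<dots> = ?f j" using one(1) by simp
        also have "\<dots> \<le> indicator (core C) X"
          using core_translate [OF C(2) K_closed(3) [OF u] X, of j] one(1) B(2) by (auto simp: indicator_def)
        finally show ?thesis .
      qed simp
    qed
  qed simp
  also have "\<dots> = 4 * emeasure \<mu> (core C)" using core_sets [OF C(2)] by simp
  finally show ?thesis .
qed

text \<open>For \<open>k = g u\<inverse> g\<inverse>\<close> in \<open>K r\<close> the indicator function \<open>1\<^sub>A\<close> is at most \<open>2 \<tau>(k) 1\<^sub>A\<close>. Hence the
  coefficient is at most \<open>2\<langle>\<tau>(g) 1\<^sub>A, \<tau>(k) 1\<^sub>A\<rangle>\<close>, and applying the isometry \<open>\<tau>(u g\<inverse>)\<close> to both
  entries turns \<open>g\<close> into \<open>u\<close> and \<open>k\<close> into \<open>g\<inverse>\<close>.\<close>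

lemma coef_transfer:
  assumes C: "finite C" "C \<subseteq> carrier G"
    and r: "\<And>k X. k \<in> K r \<Longrightarrow> X \<in> core C \<Longrightarrow> R k (coset_rep X) \<ge> 1 / 4"
    and g: "g \<in> carrier G" and u: "u \<in> carrier G" and k: "g \<otimes> inv u \<otimes> inv g \<in> K r"
  shows "coef (core C) g \<le>
    (\<integral>\<^sup>+X. ennreal (2 * tau u (indicator (core C)) X * tau (inv g) (indicator (core C)) X) \<partial>\<mu>)"
proof -
  let ?A = "core C"
  let ?k = "g \<otimes> inv u \<otimes> inv g"
  have kG: "?k \<in> carrier G" by (rule K_carrier [OF k])
  have A: "(indicator ?A :: _ \<Rightarrow> real) \<in> borel_measurable \<mu>" using core_sets [OF C(2)] by simp
  have "coef ?A g \<le> (\<integral>\<^sup>+X. ennreal (2 * tau g (indicator ?A) X * tau ?k (indicator ?A) X) \<partial>\<mu>)"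
    unfolding coef_tau
  proof (intro nn_integral_mono ennreal_leI)
    fix X assume "X \<in> space \<mu>"
    then have X: "X \<in> lcosets H" by (simp add: space_mu)
    have "indicator ?A X \<le> 2 * tau ?k (indicator ?A) X"
    proof (cases "X \<in> ?A")
      case True
      have "inv ?k <# X \<in> ?A" using core_translate [OF C(2) K_closed(3) [OF k] X] True by simp
      moreover have "sqrt (R (inv ?k) (coset_rep X)) \<ge> sqrt ((1 / 2)\<^sup>2)"
        using r [OF K_closed(3) [OF k] True] by (intro real_sqrt_le_mono) (simp add: power2_eq_square)
      ultimately show ?thesis using True by (simp add: tau_def)
    next
      case False
      have "R (inv ?k) (coset_rep X) \<ge> 0"
        using R_pos [of "inv ?k" "coset_rep X"] kG coset_rep(1) [OF X] by (simp add: less_imp_le)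
      then show ?thesis using False by (simp add: tau_def)
    qed
    moreover have "tau g (indicator ?A) X \<ge> 0"
      using R_pos [of "inv g" "coset_rep X"] g coset_rep(1) [OF X] by (simp add: tau_def less_imp_le)
    ultimately have "tau g (indicator ?A) X * indicator ?A X \<le> tau g (indicator ?A) X * (2 * tau ?k (indicator ?A) X)"
      by (rule mult_left_mono)
    then show "tau g (indicator ?A) X * indicator ?A X \<le> 2 * tau g (indicator ?A) X * tau ?k (indicator ?A) X"
      by (simp add: mult_ac)
  qed
  also have "\<dots> = 2 * (\<integral>\<^sup>+X. ennreal (tau g (indicator ?A) X * tau ?k (indicator ?A) X) \<partial>\<mu>)"
    using tau_measurable [OF g A] tau_measurable [OF kG A]
    by (simp add: ennreal_mult' mult.assoc nn_integral_cmult)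
  also have "\<dots> = 2 * (\<integral>\<^sup>+X. ennreal (tau (u \<otimes> inv g) (tau g (indicator ?A)) X *
      tau (u \<otimes> inv g) (tau ?k (indicator ?A)) X) \<partial>\<mu>)"
    using g u by (subst tau_isometric [OF _ tau_measurable [OF g A] tau_measurable [OF kG A]]) auto
  also have "\<dots> = 2 * (\<integral>\<^sup>+X. ennreal (tau u (indicator ?A) X * tau (inv g) (indicator ?A) X) \<partial>\<mu>)"
  proof -
    have "u \<otimes> inv g \<otimes> g = u" using g u by (simp add: m_assoc)
    moreover have "u \<otimes> inv g \<otimes> ?k = inv g"
    proof -
      have "x \<otimes> (inv x \<otimes> z) = z" "inv x \<otimes> (x \<otimes> z) = z" if "x \<in> carrier G" "z \<in> carrier G" for x z
        using that by (simp_all add: m_assoc [symmetric])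
      then show ?thesis using g u by (simp add: m_assoc)
    qed
    ultimately show ?thesis
      using g u kG by (intro arg_cong [where f = "\<lambda>t. 2 * t"] nn_integral_cong) (simp add: space_mu tau_tau)
  qed
  also have "\<dots> = (\<integral>\<^sup>+X. ennreal (2 * tau u (indicator ?A) X * tau (inv g) (indicator ?A) X) \<partial>\<mu>)"
    using tau_measurable [OF u A] tau_measurable [OF inv_closed [OF g] A]
    by (simp add: ennreal_mult' mult.assoc nn_integral_cmult)
  finally show ?thesis .
qed

text \<open>Summing \<open>coef_transfer\<close> over the \<open>u i\<close> and splitting \<open>1\<^sub>A\<close> into the parts on and off \<open>D\<close>, the first
  parts have translates with disjoint supports and the second part is small by
  \<open>measure_disjoint_translates\<close>. With \<open>q = 2\<^sup>p\<close> and \<open>N = q\<^sup>2\<close> elements, \<open>sum_young\<close> gives for each \<open>i\<close>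
  at most \<open>\<mu>(A)/q\<close> from \<open>D\<close>, at most \<open>q \<mu>(A - D) \<le> 4 \<mu>(A)/q\<close> from its complement, and
  \<open>2 \<mu>(A)/q\<close> from the function \<open>\<tau>(g\<inverse>) 1\<^sub>A\<close>.\<close>

lemma coef_decay:
  fixes u w :: "nat \<Rightarrow> 'g"
  assumes C: "finite C" "C \<subseteq> carrier G"
    and r: "\<And>k X. k \<in> K r \<Longrightarrow> X \<in> core C \<Longrightarrow> R k (coset_rep X) \<ge> 1 / 4"
    and g: "g \<in> carrier G" and D: "D \<in> sets \<mu>"
    and u: "\<And>i. i < 4 ^ p \<Longrightarrow> u i \<in> carrier G" "\<And>i. i < 4 ^ p \<Longrightarrow> g \<otimes> inv (u i) \<otimes> inv g \<in> K r"
    and u_disj: "\<And>i j X Y. i < 4 ^ p \<Longrightarrow> j < 4 ^ p \<Longrightarrow> i \<noteq> j \<Longrightarrow> X \<in> D \<Longrightarrow> Y \<in> D \<Longrightarrow> u i <# X \<noteq> u j <# Y"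
    and w: "\<And>i. i < 4 ^ p \<Longrightarrow> w i \<in> K r"
    and w_disj: "\<And>i j X Y. i < 4 ^ p \<Longrightarrow> j < 4 ^ p \<Longrightarrow> i \<noteq> j \<Longrightarrow> X \<in> lcosets H - D \<Longrightarrow>
      Y \<in> lcosets H - D \<Longrightarrow> w i <# X \<noteq> w j <# Y"
  shows "coef (core C) g \<le> ennreal (7 * measure \<mu> (core C) / 2 ^ p)"
proof -
  let ?A = "core C"
  let ?N = "4 ^ p :: nat"
  define q :: real where "q = 2 ^ p"
  define a where "a = measure \<mu> ?A"
  define b where "b = measure \<mu> (?A - D)"
  define \<psi> where "\<psi> = tau (inv g) (indicator ?A)"
  \<comment> \<open>the two parts of the translates of the indicator function of \<open>core C\<close>, on and off \<open>D\<close>\<close>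
  define xx where "xx i = tau (u i) (indicator (?A \<inter> D))" for i
  define yy where "yy i = tau (u i) (indicator (?A - D))" for i
  let ?g = "\<lambda>i X. ennreal (1 / q) * ennreal ((xx i X)\<^sup>2) + ennreal q * ennreal ((yy i X)\<^sup>2) +
      ennreal (2 / q) * ennreal ((\<psi> X)\<^sup>2)"
  have q: "q > 0" by (simp add: q_def)
  have Nq: "real ?N = q\<^sup>2" by (simp add: q_def power2_eq_square flip: power_mult_distrib)
  have A: "?A \<in> sets \<mu>" by (rule core_sets [OF C(2)])
  have Afin: "emeasure \<mu> ?A = ennreal a"
    using core_finite [OF C] by (simp add: a_def emeasure_eq_ennreal_measure less_top)
  have ADfin: "emeasure \<mu> (?A - D) = ennreal b"
    using emeasure_mono [of "?A - D" ?A \<mu>] A Afin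
    unfolding b_def by (intro emeasure_eq_ennreal_measure) (auto simp: top_unique)
  have a: "a \<ge> 0" and b: "b \<ge> 0" by (simp_all add: a_def b_def)
  have "of_nat ?N * emeasure \<mu> (?A - D) \<le> 4 * emeasure \<mu> ?A"
  proof (rule measure_disjoint_translates [OF C r])
    show "w i <# X \<noteq> w j <# Y"
      if "i < ?N" "j < ?N" "i \<noteq> j" "X \<in> ?A - D" "Y \<in> ?A - D" for i j X Y
      using w_disj [OF that(1-3)] that(4,5) core_subset [OF C(2)] by blast
  qed (use A D w in auto)
  then have "ennreal (q\<^sup>2 * b) \<le> ennreal (4 * a)"
    using a b unfolding Afin ADfin Nq [symmetric] by (simp add: ennreal_mult' ennreal_of_nat_eq_real_of_nat)
  then have qb: "q\<^sup>2 * b \<le> 4 * a" using a by (subst (asm) ennreal_le_iff) auto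
  have meas: "xx i \<in> borel_measurable \<mu>" "yy i \<in> borel_measurable \<mu>" if "i < ?N" for i
    unfolding xx_def yy_def using A D by (intro tau_measurable u(1) that; simp)+
  have meas_psi: "\<psi> \<in> borel_measurable \<mu>" unfolding \<psi>_def using A g by (intro tau_measurable) auto
  have split: "tau (u i) (indicator ?A) X = xx i X + yy i X" for i X
    by (simp add: xx_def yy_def tau_def indicator_def algebra_simps)
  have "of_nat ?N * coef ?A g = (\<Sum>i<?N. coef ?A g)" by simp
  also have "\<dots> \<le> (\<Sum>i<?N. \<integral>\<^sup>+X. ennreal (2 * (xx i X + yy i X) * \<psi> X) \<partial>\<mu>)"
    using coef_transfer [OF C r g u(1) u(2)]
    unfolding split \<psi>_def [symmetric] by (intro sum_mono) auto
  also have "\<dots> = (\<integral>\<^sup>+X. (\<Sum>i<?N. ennreal (2 * (xx i X + yy i X) * \<psi> X)) \<partial>\<mu>)"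
  proof (rule nn_integral_sum [symmetric])
    fix i assume "i \<in> {..<?N}"
    then have [measurable]: "xx i \<in> borel_measurable \<mu>" "yy i \<in> borel_measurable \<mu>" using meas [of i] by auto
    note meas_psi [measurable]
    show "(\<lambda>X. ennreal (2 * (xx i X + yy i X) * \<psi> X)) \<in> borel_measurable \<mu>"
      by measurable
  qed
  also have "\<dots> \<le> (\<integral>\<^sup>+X. (\<Sum>i<?N. ?g i X) \<partial>\<mu>)"
  proof (rule nn_integral_mono)
    fix X assume "X \<in> space \<mu>"
    then have X: "X \<in> lcosets H" by (simp add: space_mu)
    have pos: "tau h (indicator B) X \<ge> 0" if "h \<in> carrier G" for h B
      using R_pos [of "inv h" "coset_rep X"] that coset_rep(1) [OF X] by (simp add: tau_def less_imp_le)
    have one: "xx i X = 0 \<or> xx j X = 0" if "i \<in> {..<?N}" "j \<in> {..<?N}" "i \<noteq> j" for i j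
    proof (rule ccontr)
      assume "\<not> (xx i X = 0 \<or> xx j X = 0)"
      then have "inv (u i) <# X \<in> D" "inv (u j) <# X \<in> D" by (auto simp: xx_def tau_def indicator_def)
      moreover have "u i <# (inv (u i) <# X) = u j <# (inv (u j) <# X)"
        using that u(1) X by (simp add: translate_inv)
      ultimately show False using u_disj [of i j] that by auto
    qed
    have nonneg: "2 * (xx i X + yy i X) * \<psi> X \<ge> 0" if "i < ?N" for i
      using pos [OF u(1) [OF that]] pos [of "inv g"] g by (simp add: xx_def yy_def \<psi>_def)
    have "(\<Sum>i<?N. ennreal (2 * (xx i X + yy i X) * \<psi> X)) = ennreal (\<Sum>i<?N. 2 * (xx i X + yy i X) * \<psi> X)"
      using nonneg by (intro sum_ennreal) auto
    also have "\<dots> \<le> ennreal (\<Sum>i<?N. (xx i X)\<^sup>2 / q + q * (yy i X)\<^sup>2 + 2 * (\<psi> X)\<^sup>2 / q)"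
      using q one Nq by (intro ennreal_leI sum_young) auto
    also have "\<dots> = (\<Sum>i<?N. ennreal ((xx i X)\<^sup>2 / q + q * (yy i X)\<^sup>2 + 2 * (\<psi> X)\<^sup>2 / q))"
      using q by (intro sum_ennreal [symmetric]) auto
    also have "\<dots> = (\<Sum>i<?N. ?g i X)"
    proof (rule sum.cong [OF refl])
      fix i
      have "ennreal ((xx i X)\<^sup>2 / q + q * (yy i X)\<^sup>2 + 2 * (\<psi> X)\<^sup>2 / q) =
          ennreal ((xx i X)\<^sup>2 / q) + ennreal (q * (yy i X)\<^sup>2) + ennreal (2 * (\<psi> X)\<^sup>2 / q)"
        using q by (simp add: ennreal_plus)
      also have "ennreal ((xx i X)\<^sup>2 / q) = ennreal (1 / q) * ennreal ((xx i X)\<^sup>2)"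
        using q by (simp add: ennreal_mult' [symmetric])
      also have "ennreal (q * (yy i X)\<^sup>2) = ennreal q * ennreal ((yy i X)\<^sup>2)"
        using q by (simp add: ennreal_mult')
      also have "ennreal (2 * (\<psi> X)\<^sup>2 / q) = ennreal (2 / q) * ennreal ((\<psi> X)\<^sup>2)"
        using q by (simp add: ennreal_mult' [symmetric])
      finally show "ennreal ((xx i X)\<^sup>2 / q + q * (yy i X)\<^sup>2 + 2 * (\<psi> X)\<^sup>2 / q) =
          ?g i X" .
    qed
    finally show "(\<Sum>i<?N. ennreal (2 * (xx i X + yy i X) * \<psi> X)) \<le>
        (\<Sum>i<?N. ?g i X)" .
  qed
  also have "\<dots> = (\<Sum>i<?N. \<integral>\<^sup>+X. ?g i X \<partial>\<mu>)"
  proof (rule nn_integral_sum)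
    fix i assume "i \<in> {..<?N}"
    then have [measurable]: "xx i \<in> borel_measurable \<mu>" "yy i \<in> borel_measurable \<mu>" using meas [of i] by auto
    note meas_psi [measurable]
    show "(\<lambda>X. ?g i X) \<in> borel_measurable \<mu>"
      by measurable
  qed
  also have "\<dots> \<le> (\<Sum>i<?N. ennreal (7 * a / q))"
  proof (rule sum_mono)
    fix i assume "i \<in> {..<?N}"
    then have i: "i < ?N" by simp
    have "(\<integral>\<^sup>+X. ?g i X \<partial>\<mu>) =
        ennreal (1 / q) * (\<integral>\<^sup>+X. ennreal ((xx i X)\<^sup>2) \<partial>\<mu>) + ennreal q * (\<integral>\<^sup>+X. ennreal ((yy i X)\<^sup>2) \<partial>\<mu>) +
        ennreal (2 / q) * (\<integral>\<^sup>+X. ennreal ((\<psi> X)\<^sup>2) \<partial>\<mu>)"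
      using meas [OF i] meas_psi by (simp add: nn_integral_add nn_integral_cmult)
    also have "\<dots> = ennreal (1 / q) * emeasure \<mu> (?A \<inter> D) + ennreal q * ennreal b + ennreal (2 / q) * ennreal a"
      unfolding xx_def yy_def \<psi>_def using A D g u(1) [OF i]
      by (simp add: tau_indicator_square Afin ADfin)
    also have "\<dots> \<le> ennreal (1 / q) * ennreal a + ennreal q * ennreal b + ennreal (2 / q) * ennreal a"
      using emeasure_mono [of "?A \<inter> D" ?A \<mu>] A unfolding Afin
      by (intro add_right_mono mult_left_mono) auto
    also have "\<dots> = ennreal (1 / q * a + q * b + 2 / q * a)"
    proof -
      have "0 \<le> 1 / q" "0 \<le> q" "0 \<le> 2 / q" using q by auto
      then show ?thesis
        using a b by (simp only: ennreal_plus ennreal_mult' add_nonneg_nonneg mult_nonneg_nonneg)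
    qed
    also have "\<dots> \<le> ennreal (7 * a / q)"
    proof (rule ennreal_leI)
      have "q * b = q\<^sup>2 * b / q" using q by (simp add: power2_eq_square)
      also have "\<dots> \<le> 4 * a / q" using qb q by (intro divide_right_mono) auto
      finally have "q * b \<le> 4 * a / q" .
      moreover have "1 / q * a + 2 / q * a + 4 * a / q = 7 * a / q"
        by (simp add: add_divide_distrib [symmetric])
      ultimately show "1 / q * a + q * b + 2 / q * a \<le> 7 * a / q" by linarith
    qed
    finally show "(\<integral>\<^sup>+X. ?g i X \<partial>\<mu>) \<le> ennreal (7 * a / q)" .
  qed
  also have "\<dots> = of_nat ?N * ennreal (7 * a / q)" by simp
  finally have "of_nat ?N * coef ?A g \<le> of_nat ?N * ennreal (7 * a / q)" .
  then have "coef ?A g \<le> ennreal (7 * a / q)"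
    using of_nat_less_top [of ?N]
    by (subst (asm) ennreal_mult_le_mult_iff) (auto simp del: of_nat_power of_nat_less_top)
  then show ?thesis by (simp add: a_def q_def)
qed

end

section \<open>Coloured regular trees\<close>

locale coloured_tree =
  fixes d :: nat and E :: "'v set set" and i :: "'v set \<Rightarrow> nat"
  assumes regular: "regular_tree d E" and legal: "legal_colouring d E i"
begin

text \<open>The neighbour of \<open>x\<close> along the edge of colour \<open>c\<close>. Vertices are described by the colours along a path
  from a base vertex; a path without backtracking corresponds to a word without repeated adjacent
  colours.\<close>

definition nb :: "'v \<Rightarrow> nat \<Rightarrow> 'v"
  where "nb x c = (THE y. {x, y} \<in> E \<and> i {x, y} = c)"

lemma edge_card: "e \<in> E \<Longrightarrow> card e = 2"
  using regular by (simp add: regular_tree_def tree_def simple_graph_def)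

lemma edge_ne: "{x, y} \<in> E \<Longrightarrow> x \<noteq> y"
  using edge_card [of "{x, y}"] by auto

lemma colour_bij: "bij_betw i (star E x) {1..d}"
  using legal by (simp add: legal_colouring_def)

lemma edge_colour: "{x, y} \<in> E \<Longrightarrow> i {x, y} \<in> {1..d}"
  using bij_betwE [OF colour_bij [of x]] by (auto simp: star_def)

lemma edge_unique:
  assumes "{x, y} \<in> E" "{x, y'} \<in> E" "i {x, y} = i {x, y'}" shows "y = y'"
proof -
  have "{x, y} = {x, y'}"
    using bij_betw_imp_inj_on [OF colour_bij [of x]] assms by (auto simp: star_def inj_on_def)
  then show ?thesis by (auto simp: doubleton_eq_iff)
qed

lemma nb_eqI: "{x, y} \<in> E \<Longrightarrow> i {x, y} = c \<Longrightarrow> nb x c = y"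
  unfolding nb_def by (rule the_equality) (auto intro: edge_unique)

lemma nb_edge:
  assumes "c \<in> {1..d}" shows "{x, nb x c} \<in> E" "i {x, nb x c} = c"
proof -
  obtain e where e: "e \<in> star E x" "i e = c"
    using colour_bij [of x] assms unfolding bij_betw_def by (metis image_iff)
  then have "card e = 2" "x \<in> e" "e \<in> E" using edge_card by (auto simp: star_def)
  then obtain y where "e = {x, y}" by (metis card_2_iff insertE insert_commute singletonD)
  then show "{x, nb x c} \<in> E" "i {x, nb x c} = c"
    using nb_eqI [of x y c] e \<open>e \<in> E\<close> by auto
qed

lemma nb_ne: "c \<in> {1..d} \<Longrightarrow> nb x c \<noteq> x"
  using nb_edge(1) [of c x] edge_ne by metis

lemma nb_nb: "c \<in> {1..d} \<Longrightarrow> nb (nb x c) c = x"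
  using nb_edge [of c x] by (intro nb_eqI) (auto simp: insert_commute)

lemma nb_inj: "c \<in> {1..d} \<Longrightarrow> c' \<in> {1..d} \<Longrightarrow> nb x c = nb x c' \<Longrightarrow> c = c'"
  using nb_edge(2) by metis

abbreviation walk :: "'v \<Rightarrow> nat list \<Rightarrow> 'v"
  where "walk \<equiv> foldl nb"

definition reduced :: "nat list \<Rightarrow> bool"
  where "reduced w \<longleftrightarrow> set w \<subseteq> {1..d} \<and> distinct_adj w"

lemma reduced_Nil: "reduced []" by (simp add: reduced_def)

lemma reduced_Cons: "reduced (c # w) \<longleftrightarrow> c \<in> {1..d} \<and> reduced w \<and> (w = [] \<or> c \<noteq> hd w)"
  by (auto simp: reduced_def distinct_adj_Cons)

lemma reduced_append:
  "reduced (w @ w') \<longleftrightarrow> reduced w \<and> reduced w' \<and> (w = [] \<or> w' = [] \<or> last w \<noteq> hd w')"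
  by (auto simp: reduced_def distinct_adj_append_iff)

lemma reduced_snoc: "reduced (w @ [c]) \<longleftrightarrow> reduced w \<and> c \<in> {1..d} \<and> (w = [] \<or> last w \<noteq> c)"
  by (auto simp: reduced_append reduced_Cons reduced_Nil)

lemma reduced_rev: "reduced (rev w) \<longleftrightarrow> reduced w"
  by (simp add: reduced_def)

lemma reduced_set: "reduced w \<Longrightarrow> set w \<subseteq> {1..d}"
  by (simp add: reduced_def)

lemma reduced_butlast: "reduced w \<Longrightarrow> reduced (butlast w)"
  by (cases w rule: rev_cases) (auto simp: reduced_snoc reduced_Nil)

lemma reduced_sublist: "reduced w \<Longrightarrow> reduced (drop j (take k w))"
  by (metis append_take_drop_id reduced_append)

lemma walk_rev: "set w \<subseteq> {1..d} \<Longrightarrow> walk (walk x w) (rev w) = x"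
  by (induction w arbitrary: x) (auto simp: nb_nb)

lemma walk_reaches: "\<exists>w. reduced w \<and> walk x w = y"
proof -
  have "(x, y) \<in> {(u, v). {u, v} \<in> E}\<^sup>*"
    using regular by (simp add: regular_tree_def tree_def connected_graph_def)
  then show ?thesis
  proof (induction rule: rtrancl_induct)
    case base
    then show ?case using reduced_Nil by (intro exI [of _ "[]"]) simp
  next
    case (step y z)
    then obtain w where w: "reduced w" "walk x w = y" by auto
    define c where "c = i {y, z}"
    have c: "c \<in> {1..d}" "nb y c = z" using step(2) edge_colour nb_eqI by (auto simp: c_def)
    show ?case
    proof (cases "w \<noteq> [] \<and> last w = c")
      case True
      then obtain w' where w': "w = w' @ [c]" by (metis append_butlast_last_id)
      then have "walk x w' = z" using w c nb_nb [OF c(1), of "walk x w'"] by auto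
      then show ?thesis using w w' by (auto simp: reduced_snoc)
    next
      case False
      then have "reduced (w @ [c])" using w c by (auto simp: reduced_snoc)
      then show ?thesis using w c by (intro exI [of _ "w @ [c]"]) auto
    qed
  qed
qed

lemma walk_take_Suc: "k < length w \<Longrightarrow> walk x (take (Suc k) w) = nb (walk x (take k w)) (w ! k)"
  by (simp add: take_Suc_conv_app_nth)

text \<open>A nonempty closed reduced walk of minimal length visits pairwise different vertices, since a
  repetition would cut out a shorter one. It has length at least \<open>3\<close>, so it is a cycle.\<close>

lemma reduced_closed_walk:
  assumes "reduced w" "walk x w = x" shows "w = []"
proof (rule ccontr)
  assume "w \<noteq> []"
  define P where "P n \<longleftrightarrow> (\<exists>w x. reduced w \<and> walk x w = x \<and> w \<noteq> [] \<and> length w = n)" for n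
  have "P (length w)" using assms \<open>w \<noteq> []\<close> by (auto simp: P_def)
  then have "P (LEAST n. P n)" by (rule LeastI)
  then obtain v y where v: "reduced v" "walk y v = y" "v \<noteq> []" "length v = (LEAST n. P n)"
    by (auto simp: P_def)
  have minimal: "length v \<le> length w'" if "reduced w'" "walk x' w' = x'" "w' \<noteq> []" for w' x'
    unfolding v(4) using that by (intro Least_le) (auto simp: P_def)
  have vcol: "v ! k \<in> {1..d}" if "k < length v" for k
    using reduced_set [OF v(1)] that by (auto simp: subset_iff)
  define f where "f k = walk y (take k v)" for k
  define xs where "xs = map f [0..<length v]"
  have f_Suc: "f (Suc k) = nb (f k) (v ! k)" if "k < length v" for k
    using that by (simp add: f_def walk_take_Suc)
  have f_end: "f (length v) = y" "f 0 = y" by (simp_all add: f_def v(2))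
  have f_ne: "f j \<noteq> f k" if "j < k" "k < length v" for j k
  proof
    assume eq: "f j = f k"
    let ?w = "drop j (take k v)"
    have "take k v = take j v @ ?w"
      using that by (metis append_take_drop_id less_or_eq_imp_le min.absorb1 take_take)
    then have "walk (f j) ?w = f k" unfolding f_def by (metis foldl_append)
    then have "length v \<le> length ?w"
      using eq that by (intro minimal [of _ "f j"] reduced_sublist v(1)) auto
    then show False using that by simp
  qed
  have "length v \<noteq> 1"
  proof
    assume "length v = 1"
    then have "f 1 = nb (f 0) (v ! 0)" using f_Suc [of 0] by simp
    then show False using f_end \<open>length v = 1\<close> nb_ne [OF vcol [of 0], of y] by simp
  qed
  moreover have "length v \<noteq> 2"
  proof
    assume l: "length v = 2"
    then have "f 2 = nb (f 1) (v ! 1)" "f 1 = nb (f 0) (v ! 0)"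
      using f_Suc [of 0] f_Suc [of 1] by (simp_all add: numeral_2_eq_2)
    then have "nb (f 1) (v ! 1) = nb (f 1) (v ! 0)"
      using f_end l nb_nb [OF vcol [of 0], of y] by simp
    then have "v ! 1 = v ! 0" using nb_inj vcol l by simp
    moreover have "v ! 0 \<noteq> v ! Suc 0"
      using v(1) l by (intro distinct_adj_nth) (auto simp: reduced_def)
    ultimately show False by simp
  qed
  moreover have "length v \<noteq> 0" using v(3) by simp
  ultimately have l3: "length v \<ge> 3" by linarith
  have "distinct xs"
  proof -
    have "inj_on f {0..<length v}"
    proof (rule inj_onI)
      fix j k assume "j \<in> {0..<length v}" "k \<in> {0..<length v}" "f j = f k"
      then show "j = k" using f_ne [of j k] f_ne [of k j] by (cases j k rule: linorder_cases) auto
    qed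
    then show ?thesis by (simp add: xs_def distinct_map)
  qed
  moreover have "successively (\<lambda>u v. {u, v} \<in> E) xs"
    unfolding xs_def successively_conv_nth using f_Suc nb_edge(1) vcol by auto
  moreover have "{last xs, hd xs} \<in> E"
  proof -
    have "[0..<length v] \<noteq> []" using v(3) by simp
    then have "last xs = f (length v - 1)" "hd xs = y"
      unfolding xs_def using v(3) f_end by (simp_all add: last_map hd_map)
    moreover have "nb (f (length v - 1)) (v ! (length v - 1)) = y"
    proof -
      have "Suc (length v - 1) = length v" using v(3) by simp
      then show ?thesis using f_Suc [of "length v - 1"] v(3) f_end by simp
    qed
    ultimately show ?thesis using nb_edge(1) [OF vcol [of "length v - 1"], of "f (length v - 1)"] l3 by simp
  qed
  ultimately have "graph_cycle E xs" using l3 by (simp add: graph_cycle_def xs_def)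
  then show False using regular by (auto simp: regular_tree_def tree_def)
qed

text \<open>If the last colours agree, they can be removed; otherwise the first word followed by the reverse of
  the second is a closed reduced walk.\<close>

lemma reduced_walk_unique:
  assumes "reduced w" "reduced w'" "walk x w = walk x w'" shows "w = w'"
  using assms
proof (induction w arbitrary: w' rule: rev_induct)
  case Nil
  then show ?case using reduced_closed_walk [of w' x] by simp
next
  case (snoc c w)
  show ?case
  proof (cases w' rule: rev_cases)
    case Nil
    then show ?thesis using reduced_closed_walk [OF snoc(2), of x] snoc(4) by simp
  next
    case (snoc v c')
    show ?thesis
    proof (cases "c = c'")
      case True
      then have "walk x w = walk x v"
        using snoc snoc.prems nb_nb [of c "walk x w"] nb_nb [of c "walk x v"]
        by (auto simp: reduced_snoc)
      then show ?thesis using snoc.IH [of v] snoc snoc.prems True by (auto simp: reduced_snoc)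
    next
      case False
      have "reduced ((w @ [c]) @ rev w')"
        using snoc snoc.prems False reduced_rev [of w'] by (auto simp: reduced_append reduced_Cons)
      moreover have "walk x ((w @ [c]) @ rev w') = x"
        using snoc.prems(3) walk_rev [OF reduced_set [OF snoc.prems(2)], of x] by simp
      ultimately show ?thesis using reduced_closed_walk by blast
    qed
  qed
qed

text \<open>The colours along the geodesic from \<open>x\<close> to \<open>y\<close>.\<close>

definition W :: "'v \<Rightarrow> 'v \<Rightarrow> nat list"
  where "W x y = (THE w. reduced w \<and> walk x w = y)"

lemma W_eqI: "reduced w \<Longrightarrow> walk x w = y \<Longrightarrow> W x y = w"
  unfolding W_def by (rule the_equality) (auto intro: reduced_walk_unique)

lemma reduced_W: "reduced (W x y)" and walk_W: "walk x (W x y) = y"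
  using walk_reaches [of x y] W_eqI by auto

lemma W_walk: "reduced w \<Longrightarrow> W x (walk x w) = w"
  by (rule W_eqI) auto

lemma W_self: "W x x = []"
  by (rule W_eqI) (auto simp: reduced_Nil)

lemma W_sym: "W y x = rev (W x y)"
  using walk_rev [OF reduced_set [OF reduced_W], of x x y]
  by (intro W_eqI) (auto simp: reduced_rev reduced_W walk_W)

lemma W_nb:
  assumes "a \<in> {1..d}"
  shows "W x (nb y a) = (if W x y \<noteq> [] \<and> last (W x y) = a then butlast (W x y) else W x y @ [a])"
proof (cases "W x y \<noteq> [] \<and> last (W x y) = a")
  case True
  then have w: "W x y = butlast (W x y) @ [a]" by (metis append_butlast_last_id)
  have "nb (walk x (butlast (W x y))) a = y"
    using walk_W [of x y] by (subst (asm) w) simp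
  then have "walk x (butlast (W x y)) = nb y a" using nb_nb [OF assms, of "walk x (butlast (W x y))"] by simp
  then show ?thesis using True by (auto intro!: W_eqI reduced_butlast reduced_W)
next
  case False
  then have "reduced (W x y @ [a])" using reduced_W assms by (auto simp: reduced_snoc)
  moreover have "walk x (W x y @ [a]) = nb y a" by (simp add: walk_W)
  ultimately have "W x (nb y a) = W x y @ [a]" by (rule W_eqI)
  then show ?thesis using False by auto
qed

definition tdist :: "'v \<Rightarrow> 'v \<Rightarrow> nat"
  where "tdist x y = length (W x y)"

text \<open>The half-tree of the vertices that are reached from \<open>x\<close> through the edge of colour \<open>c\<close>.\<close>

definition half :: "'v \<Rightarrow> nat \<Rightarrow> 'v set"
  where "half x c = {y. \<exists>w. W x y = c # w}"

lemma half_memI: "reduced (c # w) \<Longrightarrow> walk x (c # w) \<in> half x c"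
  using W_walk [of "c # w" x] by (simp add: half_def)

lemma half_memE:
  assumes "y \<in> half x c" obtains w where "reduced (c # w)" "y = walk x (c # w)"
proof -
  obtain w where "W x y = c # w" using assms by (auto simp: half_def)
  then show ?thesis using that [of w] reduced_W [of x y] walk_W [of x y] by simp
qed

lemma half_disjoint: "c \<noteq> c' \<Longrightarrow> half x c \<inter> half x c' = {}"
  by (auto simp: half_def)

lemma half_complement:
  assumes c: "c \<in> {1..d}" shows "half (nb x c) c = - half x c"
proof (intro equalityI subsetI)
  fix y assume "y \<in> half (nb x c) c"
  then obtain w where w: "reduced (c # w)" "y = walk (nb x c) (c # w)" by (rule half_memE)
  then have "W x y = w" using c by (intro W_eqI) (auto simp: nb_nb reduced_Cons)
  then show "y \<in> - half x c" using w(1) by (auto simp: half_def reduced_Cons)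
next
  fix y assume y: "y \<in> - half x c"
  then have "reduced (c # W x y)"
    using c reduced_W [of x y] by (cases "W x y") (auto simp: half_def reduced_Cons reduced_Nil)
  then have "walk (nb x c) (c # W x y) \<in> half (nb x c) c" by (rule half_memI)
  then show "y \<in> half (nb x c) c" using c by (simp add: nb_nb walk_W)
qed

text \<open>The boundary edge is the only edge that leaves a half-tree.\<close>

lemma half_exit:
  assumes "y \<in> half x c" "a \<in> {1..d}" "nb y a \<notin> half x c" shows "y = nb x c" "a = c"
proof -
  obtain w where w: "W x y = c # w" using assms(1) by (auto simp: half_def)
  have "w = [] \<and> a = c"
    using assms(3) W_nb [OF assms(2), of x y] w
    by (cases "last (W x y) = a"; cases w rule: rev_cases) (auto simp: half_def split: if_splits)
  then show "y = nb x c" "a = c" using walk_W [of x y] w by auto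
qed

lemma half_nested:
  assumes "c \<in> {1..d}" "c' \<noteq> c" shows "half (nb x c) c' \<subseteq> half x c"
proof
  fix y assume "y \<in> half (nb x c) c'"
  then obtain w where w: "reduced (c' # w)" "y = walk (nb x c) (c' # w)" by (rule half_memE)
  then have "reduced (c # c' # w)" using assms by (auto simp: reduced_Cons)
  then show "y \<in> half x c" using half_memI [of c "c' # w" x] w by simp
qed

lemma half_far:
  assumes "reduced (w @ [c])" "y \<in> half (walk z w) c" shows "length w < tdist z y"
proof -
  obtain w' where w': "reduced (c # w')" "y = walk (walk z w) (c # w')" using assms(2) by (rule half_memE)
  have "reduced (w @ c # w')" using assms(1) w'(1) by (auto simp: reduced_append)
  then have "W z y = w @ c # w'" using w'(2) by (intro W_eqI) auto
  then show ?thesis by (simp add: tdist_def)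
qed

text \<open>A ray is injective, so it never traverses an edge back and forth: its colours form a reduced word.\<close>

lemma ray_W:
  assumes s: "s \<in> rays E"
  shows "W (s a) (s (a + k)) = map (\<lambda>j. i {s j, s (Suc j)}) [a..<a + k]"
proof (rule W_eqI)
  have inj: "inj s" and edge: "\<And>n. {s n, s (Suc n)} \<in> E" using s by (auto simp: rays_def)
  let ?c = "\<lambda>j. i {s j, s (Suc j)}"
  have col: "?c j \<in> {1..d}" for j by (rule edge_colour [OF edge])
  have nb: "nb (s j) (?c j) = s (Suc j)" "nb (s (Suc j)) (?c j) = s j" for j
    using edge [of j] by (auto intro!: nb_eqI simp: insert_commute)
  have ne: "?c j \<noteq> ?c (Suc j)" for j
  proof
    assume "?c j = ?c (Suc j)"
    then have "s j = s (Suc (Suc j))" using nb(2) [of j] nb(1) [of "Suc j"] by metis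
    then show False using inj by (auto dest: injD)
  qed
  show "reduced (map ?c [a..<a + k])"
    unfolding reduced_def
  proof
    show "set (map ?c [a..<a + k]) \<subseteq> {1..d}" using col by auto
    show "distinct_adj (map ?c [a..<a + k])"
      unfolding distinct_adj_conv_nth using ne by auto
  qed
  show "walk (s a) (map ?c [a..<a + k]) = s (a + k)"
    by (induction k) (auto simp: nb)
qed

lemma ray_tdist: "s \<in> rays E \<Longrightarrow> tdist (s a) (s (a + k)) = k"
  by (simp add: tdist_def ray_W)

lemma ray_step: "s \<in> rays E \<Longrightarrow> \<exists>c\<in>{1..d}. s (Suc n) = nb (s n) c"
  using edge_colour [of "s n" "s (Suc n)"] nb_eqI [of "s n" "s (Suc n)"] by (force simp: rays_def)

end

section \<open>Automorphisms with prescribed local permutations\<close>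

locale coloured_tree_group = coloured_tree d E i
  for d :: nat and E :: "'v set set" and i :: "'v set \<Rightarrow> nat" +
  fixes F :: "(nat \<Rightarrow> nat) set"
  assumes F_subgroup: "subgroup F (sym_group d)"
begin

lemma F_permutes: "f \<in> F \<Longrightarrow> f permutes {1..d}"
  using subgroup.mem_carrier [OF F_subgroup] by (simp add: sym_group_carrier)

lemma F_id: "id \<in> F"
  using subgroup.one_closed [OF F_subgroup] by (simp add: sym_group_one)

lemma F_comp: "f \<in> F \<Longrightarrow> f' \<in> F \<Longrightarrow> f \<circ> f' \<in> F"
  using subgroup.m_closed [OF F_subgroup, of f f'] by (simp add: sym_group_mult)

lemma F_inv: assumes "f \<in> F" shows "inv' f \<in> F"
proof -
  interpret S: group "sym_group d" by (rule sym_group_is_group)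
  have f: "f permutes {1..d}" by (rule F_permutes [OF assms])
  have "inv\<^bsub>sym_group d\<^esub> f = inv' f"
    using f permutes_inv [OF f] permutes_inv_o(2) [OF f]
    by (intro S.inv_equality) (simp_all add: sym_group_carrier sym_group_mult sym_group_one)
  then show ?thesis using subgroup.m_inv_closed [OF F_subgroup assms] by simp
qed

lemma F_image: "f \<in> F \<Longrightarrow> c \<in> {1..d} \<Longrightarrow> f c \<in> {1..d}"
  using permutes_in_image [OF F_permutes] by metis

lemma F_inj: "f \<in> F \<Longrightarrow> f a = f b \<Longrightarrow> a = b"
  using permutes_inj [OF F_permutes] by (auto dest: injD)

abbreviation U :: "('v \<Rightarrow> 'v) monoid"
  where "U \<equiv> universal_group d E i F"

abbreviation lp :: "('v \<Rightarrow> 'v) \<Rightarrow> 'v \<Rightarrow> nat \<Rightarrow> nat"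
  where "lp g x \<equiv> local_perm d E i g x"

lemma lp_eq:
  assumes "c \<in> {1..d}" shows "lp g x c = i {g x, g (nb x c)}"
proof -
  have "inv_into (star E x) i c = {x, nb x c}"
    using nb_edge [OF assms, of x]
    by (intro inv_into_f_eq [OF bij_betw_imp_inj_on [OF colour_bij]]) (auto simp: star_def)
  then show ?thesis using assms by (simp add: local_perm_def)
qed

lemma U_bij: "g \<in> carrier U \<Longrightarrow> bij g"
  and U_edge: "g \<in> carrier U \<Longrightarrow> {g x, g y} \<in> E \<longleftrightarrow> {x, y} \<in> E"
  and U_lp: "g \<in> carrier U \<Longrightarrow> lp g x \<in> F"
  by (simp_all add: universal_group_def tree_aut_def)

lemma U_inj: "g \<in> carrier U \<Longrightarrow> g x = g y \<Longrightarrow> x = y"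
  using U_bij [of g] by (auto simp: bij_def dest: injD)

lemma U_nb:
  assumes "g \<in> carrier U" "c \<in> {1..d}" shows "g (nb x c) = nb (g x) (lp g x c)"
  using assms nb_edge(1) [OF assms(2), of x] by (intro nb_eqI [symmetric]) (simp_all add: U_edge lp_eq)

text \<open>Membership in \<open>U(F)\<close> is a purely local condition: each vertex \<open>x\<close> needs some permutation in \<open>F\<close> that
  describes the map on the neighbours of \<open>x\<close>. Preservation of edges follows.\<close>

lemma U_I:
  assumes bij: "bij g" and loc: "\<And>x. \<exists>f\<in>F. \<forall>c\<in>{1..d}. g (nb x c) = nb (g x) (f c)"
  shows "g \<in> carrier U"
proof -
  have inj: "g x = g y \<Longrightarrow> x = y" for x y using bij by (auto simp: bij_def dest: injD)
  have edge: "{g x, g y} \<in> E \<longleftrightarrow> {x, y} \<in> E" for x y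
  proof -
    obtain f where f: "f \<in> F" "\<forall>c\<in>{1..d}. g (nb x c) = nb (g x) (f c)" using loc [of x] by auto
    show ?thesis
    proof
      assume xy: "{x, y} \<in> E"
      define c where "c = i {x, y}"
      have c: "c \<in> {1..d}" "nb x c = y" using edge_colour [OF xy] nb_eqI [OF xy] by (auto simp: c_def)
      then have "g y = nb (g x) (f c)" using f(2) by auto
      then show "{g x, g y} \<in> E" using nb_edge(1) [OF F_image [OF f(1) c(1)]] by simp
    next
      assume xy: "{g x, g y} \<in> E"
      define c where "c = inv' f (i {g x, g y})"
      have c: "c \<in> {1..d}" using F_image [OF F_inv [OF f(1)]] edge_colour [OF xy] by (simp add: c_def)
      have "f c = i {g x, g y}"
        using permutes_inverses(1) [OF F_permutes [OF f(1)]] by (simp add: c_def)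
      then have "g (nb x c) = g y" using f(2) c nb_eqI [OF xy] by auto
      then show "{x, y} \<in> E" using inj nb_edge(1) [OF c, of x] by auto
    qed
  qed
  have "lp g x \<in> F" for x
  proof -
    obtain f where f: "f \<in> F" "\<forall>c\<in>{1..d}. g (nb x c) = nb (g x) (f c)" using loc [of x] by auto
    have "lp g x = f"
    proof
      fix k show "lp g x k = f k"
      proof (cases "k \<in> {1..d}")
        case True
        then have "lp g x k = i {g x, nb (g x) (f k)}" using f(2) by (simp only: lp_eq)
        then show ?thesis using nb_edge(2) [OF F_image [OF f(1) True]] by simp
      next
        case False
        then show ?thesis
          using permutes_not_in [OF F_permutes [OF f(1)] False] by (simp only: local_perm_def if_False)
      qed
    qed
    then show ?thesis using f by simp
  qed
  then show ?thesis using bij edge by (simp add: universal_group_def tree_aut_def)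
qed

lemma U_id: "id \<in> carrier U"
  using F_id by (intro U_I) (auto intro!: bexI [of _ id])

lemma U_comp:
  assumes g: "g \<in> carrier U" and h: "h \<in> carrier U" shows "g \<circ> h \<in> carrier U"
proof (rule U_I)
  show "bij (g \<circ> h)" by (rule bij_comp [OF U_bij [OF h] U_bij [OF g]])
  fix x
  have "(g \<circ> h) (nb x c) = nb ((g \<circ> h) x) ((lp g (h x) \<circ> lp h x) c)" if "c \<in> {1..d}" for c
    using U_nb [OF h that] U_nb [OF g F_image [OF U_lp [OF h] that]] by simp
  then show "\<exists>f\<in>F. \<forall>c\<in>{1..d}. (g \<circ> h) (nb x c) = nb ((g \<circ> h) x) (f c)"
    using F_comp [OF U_lp [OF g] U_lp [OF h]] by blast
qed

lemma U_inv:
  assumes g: "g \<in> carrier U" shows "inv' g \<in> carrier U"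
proof (rule U_I)
  show "bij (inv' g)" by (rule bij_imp_bij_inv [OF U_bij [OF g]])
  fix y
  define x where "x = inv' g y"
  let ?f = "inv' (lp g x)"
  have gx: "g x = y" using U_bij [OF g] by (simp add: x_def bij_is_surj surj_f_inv_f)
  have "inv' g (nb y c) = nb x (?f c)" if c: "c \<in> {1..d}" for c
  proof -
    have "g (nb x (?f c)) = nb y c"
      using U_nb [OF g F_image [OF F_inv [OF U_lp [OF g]] c]] gx
        permutes_inverses(1) [OF F_permutes [OF U_lp [OF g]]] by simp
    then show ?thesis using U_bij [OF g] by (metis bij_is_inj inv_f_f)
  qed
  then show "\<exists>f\<in>F. \<forall>c\<in>{1..d}. inv' g (nb y c) = nb (inv' g y) (f c)"
    using F_inv [OF U_lp [OF g]] unfolding x_def [symmetric] by blast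
qed

lemma U_simps: "mult U = (\<circ>)" "one U = id"
  by (simp_all add: universal_group_def)

lemma U_group: "group U"
proof (rule groupI)
  show "\<exists>h\<in>carrier U. h \<otimes>\<^bsub>U\<^esub> g = \<one>\<^bsub>U\<^esub>" if "g \<in> carrier U" for g
    using U_inv [OF that] U_bij [OF that] by (intro bexI [of _ "inv' g"]) (auto simp: U_simps bij_is_inj)
qed (simp_all add: U_simps U_comp U_id comp_assoc)

abbreviation G :: "('v \<Rightarrow> 'v) monoid"
  where "G \<equiv> universal_group_plus d E i F"

lemma G_simps: "mult G = (\<circ>)" "one G = id"
  by (simp_all add: universal_group_plus_def U_simps)

lemma edge_fixators_subset: "(\<Union>e\<in>E. {g \<in> carrier U. \<forall>x\<in>e. g x = x}) \<subseteq> carrier U"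
  by auto

lemma G_subgroup: "subgroup (carrier G) U"
  using group.generate_is_subgroup [OF U_group edge_fixators_subset]
  by (simp add: universal_group_plus_def)

lemma G_group: "group G"
  using subgroup.subgroup_is_group [OF G_subgroup U_group] by (simp add: universal_group_plus_def)

lemma G_U: "g \<in> carrier G \<Longrightarrow> g \<in> carrier U"
  by (rule subgroup.mem_carrier [OF G_subgroup])

lemma G_I:
  assumes "g \<in> carrier U" "{x, y} \<in> E" "g x = x" "g y = y" shows "g \<in> carrier G"
proof -
  have "g \<in> (\<Union>e\<in>E. {g \<in> carrier U. \<forall>x\<in>e. g x = x})"
    using assms by (intro UN_I [of "{x, y}"]) auto
  then show ?thesis by (simp add: universal_group_plus_def generate.incl)
qed

lemma G_id: "id \<in> carrier G"
  using subgroup.one_closed [OF G_subgroup] by (simp add: U_simps)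

lemma G_comp: "g \<in> carrier G \<Longrightarrow> h \<in> carrier G \<Longrightarrow> g \<circ> h \<in> carrier G"
  using subgroup.m_closed [OF G_subgroup, of g h] by (simp add: U_simps)

lemma G_inv: assumes "g \<in> carrier G" shows "inv\<^bsub>G\<^esub> g = inv' g"
proof -
  have "inv\<^bsub>G\<^esub> g \<circ> g = id" "g \<circ> inv\<^bsub>G\<^esub> g = id"
    using group.l_inv [OF G_group assms] group.r_inv [OF G_group assms] by (simp_all add: G_simps)
  then show ?thesis by (metis inv_unique_comp)
qed

lemma G_inv_closed: "g \<in> carrier G \<Longrightarrow> inv' g \<in> carrier G"
  using group.inv_closed [OF G_group] G_inv by metis

text \<open>The local permutations at the two ends of an edge agree on the colour of this edge. Therefore
  automorphisms map reduced words to reduced words, one local permutation at a time.\<close>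

lemma U_lp_back:
  assumes g: "g \<in> carrier U" and c: "c \<in> {1..d}" shows "lp g (nb x c) c = lp g x c"
proof -
  have "nb (g (nb x c)) (lp g (nb x c) c) = g x"
    using U_nb [OF g c, of "nb x c"] by (simp add: nb_nb [OF c])
  moreover have "nb (g (nb x c)) (lp g x c) = g x"
    using U_nb [OF g c, of x] nb_nb [OF F_image [OF U_lp [OF g] c]] by simp
  ultimately show ?thesis using nb_inj [OF F_image [OF U_lp [OF g] c] F_image [OF U_lp [OF g] c]] by metis
qed

lemma U_walk:
  assumes g: "g \<in> carrier U" and w: "reduced w"
  shows "\<exists>w'. reduced w' \<and> length w' = length w \<and> g (walk x w) = walk (g x) w' \<and>
    (w \<noteq> [] \<longrightarrow> hd w' = lp g x (hd w))"
  using w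
proof (induction w arbitrary: x)
  case Nil
  then show ?case by (intro exI [of _ "[]"]) (simp add: reduced_Nil)
next
  case (Cons c w)
  then have c: "c \<in> {1..d}" and w: "reduced w" by (auto simp: reduced_Cons)
  obtain w' where w': "reduced w'" "length w' = length w" "g (walk (nb x c) w) = walk (g (nb x c)) w'"
      "w \<noteq> [] \<longrightarrow> hd w' = lp g (nb x c) (hd w)"
    using Cons.IH [OF w, of "nb x c"] by auto
  have "lp g x c \<noteq> hd w'" if "w' \<noteq> []"
  proof
    assume eq: "lp g x c = hd w'"
    have "w \<noteq> []" using that w'(2) by auto
    then have "lp g (nb x c) c = lp g (nb x c) (hd w)" using eq w'(4) U_lp_back [OF g c, of x] by simp
    then have "c = hd w" by (rule F_inj [OF U_lp [OF g]])
    then show False using Cons.prems \<open>w \<noteq> []\<close> by (simp add: reduced_Cons)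
  qed
  then have "reduced (lp g x c # w')" using w'(1) F_image [OF U_lp [OF g] c] by (auto simp: reduced_Cons)
  then show ?case using w' U_nb [OF g c, of x] by (intro exI [of _ "lp g x c # w'"]) simp
qed

lemma U_tdist:
  assumes g: "g \<in> carrier U" shows "tdist (g x) (g y) = tdist x y"
proof -
  obtain w' where "reduced w'" "length w' = length (W x y)" "g (walk x (W x y)) = walk (g x) w'"
    using U_walk [OF g reduced_W [of x y], of x] by auto
  then show ?thesis using W_eqI [of w' "g x" "g y"] by (simp add: tdist_def walk_W)
qed

lemma U_half:
  assumes g: "g \<in> carrier U" and y: "y \<in> half x c" shows "g y \<in> half (g x) (lp g x c)"
proof -
  obtain w where w: "reduced (c # w)" "y = walk x (c # w)" using y by (rule half_memE)
  obtain w' where w': "reduced w'" "length w' = length (c # w)" "g y = walk (g x) w'" "hd w' = lp g x c"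
    using U_walk [OF g w(1), of x] w(2) by auto
  then have "w' = lp g x c # tl w'" by (cases w') auto
  then show ?thesis using half_memI [of "lp g x c" "tl w'" "g x"] w' by metis
qed

lemma U_fix_half:
  assumes g: "g \<in> carrier U" and c: "c \<in> {1..d}" and fixed: "g x = x" "g (nb x c) = nb x c"
  shows "g y \<in> half x c \<longleftrightarrow> y \<in> half x c"
proof -
  have "nb x (lp g x c) = nb x c" using U_nb [OF g c, of x] fixed by simp
  then have l: "lp g x c = c" using nb_inj [OF F_image [OF U_lp [OF g] c] c] by metis
  then have l': "lp g (nb x c) c = c" using U_lp_back [OF g c] by simp
  have "g y \<in> half x c" if "y \<in> half x c"
    using U_half [OF g that] l fixed by simp
  moreover have "g y \<in> half (nb x c) c" if "y \<in> half (nb x c) c"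
    using U_half [OF g that] l' fixed by simp
  ultimately show ?thesis using half_complement [OF c, of x] by auto
qed

text \<open>
  Tits' independence property: an element that fixes both ends of an edge may be replaced by the
  identity on one side of it. At the two ends of the edge both descriptions agree, so the local
  condition of \<open>U_I\<close> is satisfied everywhere.
\<close>

definition patch :: "('v \<Rightarrow> 'v) \<Rightarrow> 'v \<Rightarrow> nat \<Rightarrow> 'v \<Rightarrow> 'v"
  where "patch g x c y = (if y \<in> half x c then g y else y)"

lemma patch_in_U:
  assumes g: "g \<in> carrier U" and c: "c \<in> {1..d}" and fixed: "g x = x" "g (nb x c) = nb x c"
  shows "patch g x c \<in> carrier U"
proof (rule U_I)
  note half_iff = U_fix_half [OF g c fixed]
  show "bij (patch g x c)"
  proof (rule bijI)
    show "inj (patch g x c)"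
      using half_iff U_inj [OF g] unfolding patch_def inj_def by metis
    show "surj (patch g x c)"
      unfolding surj_def
    proof
      fix z
      show "\<exists>y. z = patch g x c y"
      proof (cases "z \<in> half x c")
        case True
        obtain y where "g y = z" using U_bij [OF g] by (metis bij_pointE)
        then have "y \<in> half x c" using True half_iff by auto
        then show ?thesis using \<open>g y = z\<close> by (intro exI [of _ y]) (simp add: patch_def)
      next
        case False
        then show ?thesis by (intro exI [of _ z]) (simp add: patch_def)
      qed
    qed
  qed
  have on_half: "patch g x c y = g y" if "y \<in> half x c \<or> y = x" for y
    using that fixed by (auto simp: patch_def)
  have off_half: "patch g x c y = y" if "y \<notin> half x c \<or> y = nb x c" for y
    using that fixed by (auto simp: patch_def)
  fix y
  show "\<exists>f\<in>F. \<forall>a\<in>{1..d}. patch g x c (nb y a) = nb (patch g x c y) (f a)"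
  proof (cases "y \<in> half x c")
    case True
    have "patch g x c (nb y a) = nb (patch g x c y) (lp g y a)" if a: "a \<in> {1..d}" for a
    proof -
      have "nb y a \<in> half x c \<or> nb y a = x"
        using half_exit [OF True a] nb_nb [OF c, of x] by metis
      then show ?thesis using on_half [of "nb y a"] on_half [of y] True U_nb [OF g a] by simp
    qed
    then show ?thesis using U_lp [OF g] by blast
  next
    case False
    then have y: "y \<in> half (nb x c) c" using half_complement [OF c] by auto
    have "patch g x c (nb y a) = nb (patch g x c y) (id a)" if a: "a \<in> {1..d}" for a
    proof -
      have "nb y a \<notin> half x c \<or> nb y a = nb x c"
        using half_exit [OF y a] nb_nb [OF c, of x] half_complement [OF c, of x] by (metis ComplD)
      then show ?thesis using off_half [of "nb y a"] off_half [of y] False by simp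
    qed
    then show ?thesis using F_id by blast
  qed
qed

text \<open>
  The automorphism that fixes \<open>p\<close> and has local permutation \<open>f\<close> at every vertex.
\<close>

definition twist :: "(nat \<Rightarrow> nat) \<Rightarrow> 'v \<Rightarrow> 'v \<Rightarrow> 'v"
  where "twist f p y = walk p (map f (W p y))"

lemma reduced_map:
  assumes "f \<in> F" "reduced w" shows "reduced (map f w)"
proof -
  have "inj_on f (set w)" using F_inj [OF assms(1)] by (auto simp: inj_on_def)
  then show ?thesis
    using assms(2) F_image [OF assms(1)] unfolding reduced_def by (auto intro: distinct_adj_mapI)
qed

lemma twist_nb:
  assumes f: "f \<in> F" and a: "a \<in> {1..d}" shows "twist f p (nb y a) = nb (twist f p y) (f a)"
proof (cases "W p y \<noteq> [] \<and> last (W p y) = a")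
  case True
  then have "W p y = butlast (W p y) @ [a]" by (metis append_butlast_last_id)
  from arg_cong [OF this, of "map f"]
  have "map f (W p y) = map f (butlast (W p y)) @ [f a]" by simp
  then have "twist f p y = nb (walk p (map f (butlast (W p y)))) (f a)"
    unfolding twist_def by simp
  then show ?thesis using True W_nb [OF a, of p y] nb_nb [OF F_image [OF f a]] by (simp add: twist_def)
next
  case False
  then have "W p (nb y a) = W p y @ [a]" using W_nb [OF a, of p y] by auto
  then show ?thesis by (simp add: twist_def)
qed

lemma twist_twist:
  assumes "f \<in> F" "f' \<in> F" "f \<circ> f' = id" shows "twist f p (twist f' p y) = y"
proof -
  have "W p (twist f' p y) = map f' (W p y)"
    unfolding twist_def by (rule W_walk [OF reduced_map [OF assms(2) reduced_W]])
  then show ?thesis using assms(3) by (simp add: twist_def walk_W)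
qed

lemma twist_in_U:
  assumes f: "f \<in> F" shows "twist f p \<in> carrier U"
proof (rule U_I)
  have f': "f \<circ> inv' f = id" "inv' f \<circ> f = id" using permutes_inv_o [OF F_permutes [OF f]] by auto
  have "twist f p \<circ> twist (inv' f) p = id" "twist (inv' f) p \<circ> twist f p = id"
    by (simp_all add: fun_eq_iff twist_twist [OF f F_inv [OF f] f'(1)] twist_twist [OF F_inv [OF f] f f'(2)])
  then show "bij (twist f p)" by (metis o_bij)
qed (use f twist_nb [OF f] in blast)

lemma twist_self: "twist f p p = p"
  by (simp add: twist_def W_self)

section \<open>Moving half-trees apart\<close>

definition movable :: bool
  where "movable \<longleftrightarrow> (\<forall>c\<in>{1..d}. \<forall>c'\<in>{1..d}. c \<noteq> c' \<longrightarrow> (\<exists>f\<in>F. f c = c \<and> f c' \<noteq> c'))"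

text \<open>\<open>u\<close> is the automorphism with constant local permutation \<open>f\<close> beyond the edge of colour \<open>c\<close>, where
  \<open>f\<close> fixes \<open>c\<close> and moves \<open>c'\<close>, and the identity on the other side of this edge.\<close>

lemma separate_half:
  assumes mov: "movable" and c: "c \<in> {1..d}" "c' \<in> {1..d}" "c \<noteq> c'"
  obtains u where "u \<in> carrier G" "\<And>y. y \<notin> half x c \<Longrightarrow> u y = y"
    "u ` half (nb x c) c' \<subseteq> half x c" "u ` half (nb x c) c' \<inter> half (nb x c) c' = {}"
    "\<And>y. y \<in> half x c \<Longrightarrow> u y \<in> half x c"
proof -
  let ?p = "nb x c"
  obtain f where f: "f \<in> F" "f c = c" "f c' \<noteq> c'" using mov c unfolding movable_def by blast
  define g where "g = twist f ?p"
  have g: "g \<in> carrier U" unfolding g_def by (rule twist_in_U [OF f(1)])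
  have gp: "g ?p = ?p" by (simp add: g_def twist_self)
  have g_nb: "g (nb ?p a) = nb ?p (f a)" if "a \<in> {1..d}" for a
    using twist_nb [OF f(1) that, of ?p ?p] by (simp add: g_def twist_self)
  have gx: "g x = x" using g_nb [OF c(1)] f(2) nb_nb [OF c(1)] by simp
  define u where "u = patch g x c"
  have u: "u \<in> carrier U" unfolding u_def by (rule patch_in_U [OF g c(1) gx gp])
  have ux: "u x = x" "u ?p = ?p" using gx gp by (auto simp: u_def patch_def)
  have sub: "half ?p c' \<subseteq> half x c" using half_nested [OF c(1)] c(3) by auto
  have lp: "lp g ?p c' = f c'"
    using U_nb [OF g c(2), of ?p] g_nb [OF c(2)] gp nb_inj [OF F_image [OF U_lp [OF g] c(2)] F_image [OF f(1) c(2)]]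
    by metis
  have image: "u y \<in> half ?p (f c')" if "y \<in> half ?p c'" for y
    using U_half [OF g that] that sub by (auto simp: u_def patch_def gp lp)
  have fc: "f c' \<noteq> c" using F_inj [OF f(1), of c' c] f(2) c(3) by auto
  show ?thesis
  proof (rule that [of u])
    show "u \<in> carrier G" by (rule G_I [OF u nb_edge(1) [OF c(1)] ux])
    show "u y = y" if "y \<notin> half x c" for y using that by (simp add: u_def patch_def)
    show "u ` half ?p c' \<subseteq> half x c" using image half_nested [OF c(1) fc, of x] by blast
    show "u ` half ?p c' \<inter> half ?p c' = {}" using image half_disjoint [OF f(3), of ?p] by blast
    show "u y \<in> half x c" if "y \<in> half x c" for y
      using U_fix_half [OF g c(1) gx gp] that by (simp add: u_def patch_def)
  qed
qed

text \<open>Induction on \<open>m\<close>, walking outwards from \<open>z\<close>: given \<open>2\<^sup>m\<close> disjoint translates of the half-tree behind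
  an edge of the path, the element \<open>u\<close> of \<open>separate_half\<close> moves the half-tree behind the next edge off
  itself, within the larger half-tree. Combining each old element with \<open>u\<close> and with the identity doubles
  their number. The ball of radius \<open>r\<close> is not affected, as only edges at distance at least \<open>r\<close> from
  \<open>z\<close> are used.\<close>

lemma disjoint_half_translates:
  assumes mov: "movable" and w: "reduced (w @ [c])" "r + m \<le> length w"
  shows "\<exists>\<kappa> :: nat \<Rightarrow> 'v \<Rightarrow> 'v. (\<forall>j<2 ^ m. \<kappa> j \<in> carrier G \<and> (\<forall>y. tdist z y \<le> r \<longrightarrow> \<kappa> j y = y)) \<and>
    (\<forall>j<2 ^ m. \<forall>k<2 ^ m. j \<noteq> k \<longrightarrow> \<kappa> j ` half (walk z w) c \<inter> \<kappa> k ` half (walk z w) c = {})"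
  using w
proof (induction m arbitrary: w c)
  case 0
  show ?case using G_id [unfolded id_def] by (intro exI [of _ "\<lambda>_ y. y"]) simp
next
  case (Suc m)
  obtain v b where vb: "w = v @ [b]" using Suc.prems(2) by (cases w rule: rev_cases) auto
  have red: "reduced (v @ [b])" "b \<in> {1..d}" "c \<in> {1..d}" "b \<noteq> c"
    using Suc.prems(1) by (auto simp: vb reduced_append reduced_Cons)
  have len: "r + m \<le> length v" using Suc.prems(2) vb by simp
  let ?x = "walk z v"
  have p: "walk z w = nb ?x b" by (simp add: vb)
  let ?h = "half (nb ?x b) c"
  obtain \<kappa> :: "nat \<Rightarrow> 'v \<Rightarrow> 'v" where
    1: "\<forall>j<2 ^ m. \<kappa> j \<in> carrier G \<and> (\<forall>y. tdist z y \<le> r \<longrightarrow> \<kappa> j y = y)" and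
    2: "\<forall>j<2 ^ m. \<forall>k<2 ^ m. j \<noteq> k \<longrightarrow> \<kappa> j ` half ?x b \<inter> \<kappa> k ` half ?x b = {}"
    using Suc.IH [OF red(1) len] by iprover
  have \<kappa>: "j < 2 ^ m \<Longrightarrow> \<kappa> j \<in> carrier G"
      "j < 2 ^ m \<Longrightarrow> tdist z y \<le> r \<Longrightarrow> \<kappa> j y = y"
      "j < 2 ^ m \<Longrightarrow> k < 2 ^ m \<Longrightarrow> j \<noteq> k \<Longrightarrow> \<kappa> j ` half ?x b \<inter> \<kappa> k ` half ?x b = {}" for j k y
    using 1 2 by simp_all
  obtain u where u: "u \<in> carrier G" "\<And>y. y \<notin> half ?x b \<Longrightarrow> u y = y" "u ` ?h \<subseteq> half ?x b"
      "u ` ?h \<inter> ?h = {}"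
    using separate_half [OF mov red(2,3,4), of ?x] by metis
  define \<kappa>' where "\<kappa>' j = \<kappa> (j div 2) \<circ> (if odd j then u else id)" for j
  have image: "\<kappa>' j ` ?h \<subseteq> \<kappa> (j div 2) ` half ?x b" for j
    using u(3) half_nested [OF red(2) red(4) [symmetric], of ?x] by (auto simp: \<kappa>'_def)
  have lt: "j div 2 < 2 ^ m" if "j < 2 ^ Suc m" for j :: nat using that by (simp add: less_mult_imp_div_less mult.commute)
  have "\<kappa>' j \<in> carrier G" if "j < 2 ^ Suc m" for j
    using \<kappa>(1) [OF lt [OF that]] u(1) G_comp G_id by (auto simp: \<kappa>'_def)
  moreover have "\<kappa>' j y = y" if j: "j < 2 ^ Suc m" and y: "tdist z y \<le> r" for j y
  proof -
    have "y \<notin> half ?x b" using half_far [OF red(1), of y z] y len by auto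
    then show ?thesis using \<kappa>(2) [OF lt [OF j] y] u(2) by (simp add: \<kappa>'_def)
  qed
  moreover have "\<kappa>' j ` ?h \<inter> \<kappa>' k ` ?h = {}" if j: "j < 2 ^ Suc m" and k: "k < 2 ^ Suc m" and "j \<noteq> k" for j k
  proof (cases "j div 2 = k div 2")
    case False
    then show ?thesis using \<kappa>(3) [OF lt [OF j] lt [OF k] False] image [of j] image [of k] by blast
  next
    case True
    have inj: "inj (\<kappa> (k div 2))" by (rule bij_is_inj [OF U_bij [OF G_U [OF \<kappa>(1) [OF lt [OF k]]]]])
    have "odd j \<noteq> odd k" using True \<open>j \<noteq> k\<close> by (metis bit_eq_rec even_iff_mod_2_eq_zero odd_iff_mod_2_eq_one div_mult_mod_eq)
    then have "(if odd j then u else id) ` ?h \<inter> (if odd k then u else id) ` ?h = {}" using u(4) by auto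
    then have "\<kappa> (k div 2) ` ((if odd j then u else id) ` ?h \<inter> (if odd k then u else id) ` ?h) = {}" by simp
    then show ?thesis by (simp only: image_Int [OF inj] \<kappa>'_def image_comp [symmetric] True)
  qed
  ultimately show ?case unfolding p by (intro exI [of _ \<kappa>']) blast
qed

section \<open>Primitive permutation groups\<close>

text \<open>Calling two colours equivalent if they have the same stabilizer in \<open>F\<close> defines an
  \<open>F\<close>-invariant equivalence relation. If it is trivial, two different stabilizers cannot contain one
  another, because they are conjugate and finite, so some element fixes the first colour and moves the
  second. If all stabilizers are equal, an element of one of them fixes every colour.\<close>

lemma primitive_dichotomy:
  assumes prim: "primitive_perm_group d F"
  shows "movable \<or> (\<forall>f\<in>F. \<forall>c\<in>{1..d}. f c = c \<longrightarrow> f = id)"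
proof -
  define R where "R = {(a, b). a \<in> {1..d} \<and> b \<in> {1..d} \<and> (\<forall>f\<in>F. f a = a \<longleftrightarrow> f b = b)}"
  have trans: "\<exists>p\<in>F. p a = b" if "a \<in> {1..d}" "b \<in> {1..d}" for a b
    using prim that by (simp add: primitive_perm_group_def)
  have "equiv {1..d} R" by (auto simp: R_def intro!: equivI refl_onI symI transI)
  moreover have "(p a, p b) \<in> R" if p: "p \<in> F" and ab: "(a, b) \<in> R" for p a b
  proof -
    have "f (p a) = p a \<longleftrightarrow> f (p b) = p b" if f: "f \<in> F" for f
    proof -
      let ?f = "inv' p \<circ> f \<circ> p"
      have "?f \<in> F" using p f by (intro F_comp F_inv)
      moreover have "\<forall>f\<in>F. f a = a \<longleftrightarrow> f b = b" using ab by (simp add: R_def)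
      ultimately have "?f a = a \<longleftrightarrow> ?f b = b" by blast
      moreover have "?f c = c \<longleftrightarrow> f (p c) = p c" for c
        using permutes_inverses [OF F_permutes [OF p]] by (metis comp_apply)
      ultimately show ?thesis by simp
    qed
    then show ?thesis using ab F_image [OF p] by (simp add: R_def)
  qed
  ultimately have "R = Id_on {1..d} \<or> R = {1..d} \<times> {1..d}"
    using prim unfolding primitive_perm_group_def by blast
  then show ?thesis
  proof
    assume R: "R = Id_on {1..d}"
    have "\<exists>f\<in>F. f c = c \<and> f c' \<noteq> c'" if c: "c \<in> {1..d}" "c' \<in> {1..d}" "c \<noteq> c'" for c c'
    proof (rule ccontr)
      assume "\<not> (\<exists>f\<in>F. f c = c \<and> f c' \<noteq> c')"
      then have sub: "{f \<in> F. f c = c} \<subseteq> {f \<in> F. f c' = c'}" by auto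
      have finF: "finite F"
        using finite_subset [OF _ finite_permutations [of "{1..d}"]] F_permutes by blast
      obtain p where p: "p \<in> F" "p c = c'" using trans c by blast
      have "{f \<in> F. f c' = c'} \<subseteq> (\<lambda>f. p \<circ> f \<circ> inv' p) ` {f \<in> F. f c = c}"
      proof
        fix f assume f: "f \<in> {f \<in> F. f c' = c'}"
        have "inv' p c' = c" using p permutes_inverses(2) [OF F_permutes [OF p(1)], of c] by simp
        then have "(inv' p \<circ> f \<circ> p) \<in> {f \<in> F. f c = c}"
          using f p F_comp F_inv by simp
        moreover have "f = p \<circ> (inv' p \<circ> f \<circ> p) \<circ> inv' p"
          using permutes_inverses(1) [OF F_permutes [OF p(1)]] by (simp add: fun_eq_iff)
        ultimately show "f \<in> (\<lambda>f. p \<circ> f \<circ> inv' p) ` {f \<in> F. f c = c}" by (intro image_eqI)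
      qed
      then have "card {f \<in> F. f c' = c'} \<le> card {f \<in> F. f c = c}"
        using finF by (intro surj_card_le) auto
      then have "{f \<in> F. f c = c} = {f \<in> F. f c' = c'}"
        using sub finF by (intro card_seteq) auto
      then have "(c, c') \<in> R" using c by (auto simp: R_def)
      then show False using R c(3) by auto
    qed
    then show ?thesis by (auto simp: movable_def)
  next
    assume R: "R = {1..d} \<times> {1..d}"
    have "f = id" if f: "f \<in> F" "c \<in> {1..d}" "f c = c" for f c
    proof
      fix k show "f k = id k"
      proof (cases "k \<in> {1..d}")
        case True
        then have "(c, k) \<in> R" using R f(2) by simp
        then show ?thesis using f by (simp add: R_def)
      next
        case False
        then show ?thesis using permutes_not_in [OF F_permutes [OF f(1)]] by simp
      qed
    qed
    then show ?thesis by blast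
  qed
qed

text \<open>The local permutation of an element fixing an edge is trivial at one end of the edge, and by
  \<open>U_lp_back\<close> triviality spreads to all neighbouring vertices.\<close>

lemma free_trivial:
  assumes free: "\<And>f c. f \<in> F \<Longrightarrow> c \<in> {1..d} \<Longrightarrow> f c = c \<Longrightarrow> f = id"
  shows "carrier G = {id}"
proof -
  have "g = id" if g: "g \<in> carrier U" and e: "e \<in> E" "\<forall>x\<in>e. g x = x" for g e
  proof -
    obtain x y where xy: "e = {x, y}" using edge_card [OF e(1)] by (meson card_2_iff)
    define c where "c = i {x, y}"
    have c: "c \<in> {1..d}" "nb x c = y" using edge_colour [of x y] nb_eqI [of x y] e(1) by (auto simp: xy c_def)
    have gx: "g x = x" "g y = y" using e(2) by (auto simp: xy)
    have "nb x (lp g x c) = nb x c" using U_nb [OF g c(1), of x] gx c by simp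
    then have "lp g x c = c" using nb_inj [OF F_image [OF U_lp [OF g] c(1)] c(1)] by metis
    then have "lp g x = id" using free [OF U_lp [OF g] c(1)] by simp
    then have "g (walk x w) = walk x w \<and> lp g (walk x w) = id" if "set w \<subseteq> {1..d}" for w
      using that
    proof (induction w rule: rev_induct)
      case (snoc a w)
      then have IH: "g (walk x w) = walk x w" "lp g (walk x w) = id" and a: "a \<in> {1..d}" using \<open>lp g x = id\<close> by auto
      have "lp g (nb (walk x w) a) a = a" using U_lp_back [OF g a, of "walk x w"] IH by simp
      then have "lp g (nb (walk x w) a) = id" using free [OF U_lp [OF g] a] by simp
      then show ?case using U_nb [OF g a, of "walk x w"] IH by simp
    qed (use gx in simp)
    then show "g = id" using walk_W [of x] reduced_set [OF reduced_W] by (metis eq_id_iff)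
  qed
  then have "(\<Union>e\<in>E. {g \<in> carrier U. \<forall>x\<in>e. g x = x}) \<subseteq> {\<one>\<^bsub>U\<^esub>}" by (auto simp: U_simps)
  from group.generate_subgroup_incl [OF U_group this group.triv_subgroup [OF U_group]]
  have "carrier G \<subseteq> {\<one>\<^bsub>U\<^esub>}" by (simp add: universal_group_plus_def)
  then show ?thesis using G_id by (auto simp: U_simps)
qed

end

section \<open>The pointwise topology\<close>

text \<open>A set of maps is open iff membership of each of its elements depends only on finitely many of its
  values.\<close>

lemma openin_product_discrete:
  "openin (product_topology (\<lambda>_. discrete_topology UNIV) UNIV) C \<longleftrightarrow>
    (\<forall>g\<in>C. \<exists>S. finite S \<and> (\<forall>g'. (\<forall>s\<in>S. g' s = g s) \<longrightarrow> g' \<in> C))" (is "?L \<longleftrightarrow> ?R")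
proof
  assume L: ?L
  show ?R
  proof
    fix g assume "g \<in> C"
    then obtain V where V: "finite {s. V s \<noteq> UNIV}" "g \<in> Pi\<^sub>E UNIV V" "Pi\<^sub>E UNIV V \<subseteq> C"
      using L by (auto simp: openin_product_topology_alt)
    have "g' \<in> C" if "\<forall>s\<in>{s. V s \<noteq> UNIV}. g' s = g s" for g'
    proof -
      have "g' s \<in> V s" for s
        using V(2) that by (cases "V s = UNIV") (auto simp: PiE_iff)
      then show ?thesis using V(3) by (auto simp: PiE_iff)
    qed
    then show "\<exists>S. finite S \<and> (\<forall>g'. (\<forall>s\<in>S. g' s = g s) \<longrightarrow> g' \<in> C)" using V(1) by blast
  qed
next
  assume R: ?R
  show ?L
    unfolding openin_product_topology_alt
  proof
    fix g assume "g \<in> C"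
    then obtain S where S: "finite S" "\<And>g'. (\<forall>s\<in>S. g' s = g s) \<Longrightarrow> g' \<in> C" using R by blast
    let ?V = "\<lambda>s. if s \<in> S then {g s} else UNIV"
    have "finite {s \<in> UNIV. ?V s \<noteq> topspace (discrete_topology UNIV)}"
      by (rule finite_subset [OF _ S(1)]) auto
    moreover have "Pi\<^sub>E UNIV ?V \<subseteq> C"
    proof
      fix g' assume "g' \<in> Pi\<^sub>E UNIV ?V"
      then have "g' s \<in> ?V s" for s by (auto simp: PiE_iff)
      then have "\<forall>s\<in>S. g' s = g s" by (metis singletonD)
      then show "g' \<in> C" by (rule S(2))
    qed
    ultimately show "\<exists>V. finite {s \<in> UNIV. V s \<noteq> topspace (discrete_topology UNIV)} \<and>
        (\<forall>s\<in>UNIV. openin (discrete_topology UNIV) (V s)) \<and> g \<in> Pi\<^sub>E UNIV V \<and> Pi\<^sub>E UNIV V \<subseteq> C"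
      by (intro exI [of _ ?V]) auto
  qed
qed

lemma openin_pointwise_topology:
  "openin (pointwise_topology G) V \<longleftrightarrow> V \<subseteq> carrier G \<and>
    (\<forall>g\<in>V. \<exists>S. finite S \<and> (\<forall>g'\<in>carrier G. (\<forall>s\<in>S. g' s = g s) \<longrightarrow> g' \<in> V))" (is "?L \<longleftrightarrow> ?R")
proof
  assume ?L
  then obtain C where C: "V = C \<inter> carrier G"
      "\<forall>g\<in>C. \<exists>S. finite S \<and> (\<forall>g'. (\<forall>s\<in>S. g' s = g s) \<longrightarrow> g' \<in> C)"
    unfolding pointwise_topology_def openin_subtopology openin_product_discrete by auto
  then show ?R by (metis IntD1 IntI inf_le2)
next
  assume R: ?R
  then obtain S where S: "\<And>g. g \<in> V \<Longrightarrow> finite (S g)"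
      "\<And>g g'. g \<in> V \<Longrightarrow> g' \<in> carrier G \<Longrightarrow> \<forall>s\<in>S g. g' s = g s \<Longrightarrow> g' \<in> V" by metis
  define C where "C = {g'. \<exists>g\<in>V. \<forall>s\<in>S g. g' s = g s}"
  have "V = C \<inter> carrier G" using R S(2) by (auto simp: C_def)
  moreover have "openin (product_topology (\<lambda>_. discrete_topology UNIV) UNIV) C"
    unfolding openin_product_discrete
  proof
    fix g' assume "g' \<in> C"
    then obtain g where "g \<in> V" "\<forall>s\<in>S g. g' s = g s" by (auto simp: C_def)
    then show "\<exists>S. finite S \<and> (\<forall>g''. (\<forall>s\<in>S. g'' s = g' s) \<longrightarrow> g'' \<in> C)"
      using S(1) by (intro exI [of _ "S g"]) (auto simp: C_def)
  qed
  ultimately show ?L unfolding pointwise_topology_def openin_subtopology by auto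
qed

lemma topspace_pointwise_topology: "topspace (pointwise_topology G) = carrier G"
  by (simp add: pointwise_topology_def)

lemma openin_evaluation: "openin (pointwise_topology G) {g \<in> carrier G. g y \<in> Z}"
  unfolding openin_pointwise_topology by (auto intro!: exI [of _ "{y}"])

lemma continuous_map_pointwise_topologyI:
  assumes "\<And>x. x \<in> topspace X \<Longrightarrow> f x \<in> carrier G"
    and "\<And>s Z. openin X {x \<in> topspace X. f x s \<in> Z}"
  shows "continuous_map X (pointwise_topology G) f"
  unfolding pointwise_topology_def continuous_map_in_subtopology continuous_map_componentwise_UNIV
  using assms by (auto simp: continuous_map_def)

context coloured_tree_group
begin

abbreviation T :: "('v \<Rightarrow> 'v) topology"
  where "T \<equiv> pointwise_topology G"

lemma continuous_composition: "continuous_map (prod_topology T T) T (\<lambda>(g, h). g \<circ> h)"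
proof (rule continuous_map_pointwise_topologyI)
  fix p assume "p \<in> topspace (prod_topology T T)"
  then show "(case p of (g, h) \<Rightarrow> g \<circ> h) \<in> carrier G"
    by (auto simp: topspace_pointwise_topology G_comp)
next
  fix s Z
  have "{p \<in> topspace (prod_topology T T). (case p of (g, h) \<Rightarrow> g \<circ> h) s \<in> Z} =
      (\<Union>y. {g \<in> carrier G. g y \<in> Z} \<times> {h \<in> carrier G. h s \<in> {y}})"
    by (auto simp: topspace_pointwise_topology)
  moreover have "openin (prod_topology T T) (\<Union>y. {g \<in> carrier G. g y \<in> Z} \<times> {h \<in> carrier G. h s \<in> {y}})"
    by (intro openin_Union) (auto simp only: openin_prod_Times_iff openin_evaluation)
  ultimately show "openin (prod_topology T T)
      {p \<in> topspace (prod_topology T T). (case p of (g, h) \<Rightarrow> g \<circ> h) s \<in> Z}" by simp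
qed

lemma G_apply_inv: "g \<in> carrier G \<Longrightarrow> g (inv' g y) = y" "g \<in> carrier G \<Longrightarrow> inv' g (g y) = y"
  using U_bij [OF G_U [of g]] by (simp_all add: bij_is_surj surj_f_inv_f bij_is_inj)

lemma continuous_inverse: "continuous_map T T (\<lambda>g. inv\<^bsub>G\<^esub> g)"
proof (rule continuous_map_pointwise_topologyI)
  fix g assume "g \<in> topspace T"
  then show "inv\<^bsub>G\<^esub> g \<in> carrier G" by (simp add: topspace_pointwise_topology group.inv_closed [OF G_group])
next
  fix s Z
  have "{g \<in> topspace T. (inv\<^bsub>G\<^esub> g) s \<in> Z} = (\<Union>z\<in>Z. {g \<in> carrier G. g z \<in> {s}})"
    using G_apply_inv by (force simp: topspace_pointwise_topology G_inv)
  moreover have "openin T (\<Union>z\<in>Z. {g \<in> carrier G. g z \<in> {s}})"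
    by (intro openin_Union) (auto simp only: openin_evaluation)
  ultimately show "openin T {g \<in> topspace T. (inv\<^bsub>G\<^esub> g) s \<in> Z}" by simp
qed

definition ball_stab :: "'v \<Rightarrow> nat \<Rightarrow> ('v \<Rightarrow> 'v) set"
  where "ball_stab z r = {g \<in> carrier G. \<forall>y. tdist z y \<le> r \<longrightarrow> g y = y}"

lemma finite_ball: "finite {y. tdist z y \<le> n}"
proof -
  have "{y. tdist z y \<le> n} \<subseteq> walk z ` {w. set w \<subseteq> {1..d} \<and> length w \<le> n}"
    using walk_W [of z] reduced_set [OF reduced_W] by (force simp: tdist_def intro: image_eqI [OF sym])
  then show ?thesis by (rule finite_subset) (intro finite_imageI finite_lists_length_le finite_atLeastAtMost)
qed

lemma countable_vertices: "countable (UNIV :: 'v set)"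
proof -
  have "(UNIV :: 'v set) \<subseteq> range (walk undefined)" using walk_W [of undefined] by (metis rangeI subsetI)
  then show ?thesis by (rule countable_subset) simp
qed

lemma tdist_self: "tdist x x = 0"
  by (simp add: tdist_def W_self)

lemma tdist_sym: "tdist x y = tdist y x"
  by (simp add: tdist_def W_sym [of y x])

lemma tdist_zero: "tdist x y = 0 \<Longrightarrow> x = y"
  using walk_W [of x y] by (simp add: tdist_def)

lemma tdist_nb: "a \<in> {1..d} \<Longrightarrow> tdist x (nb y a) \<le> Suc (tdist x y)"
  by (auto simp: tdist_def W_nb)

lemma tdist_nb_self: "a \<in> {1..d} \<Longrightarrow> tdist x (nb x a) = 1"
  using tdist_nb [of a x x] tdist_zero [of x "nb x a"] nb_ne [of a x] tdist_self [of x] by fastforce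

lemma ball_stab_subgroup: "subgroup (ball_stab z r) G"
proof (rule group.subgroupI [OF G_group])
  show "ball_stab z r \<noteq> {}" using G_id by (auto simp: ball_stab_def)
  show "inv\<^bsub>G\<^esub> g \<in> ball_stab z r" if "g \<in> ball_stab z r" for g
  proof -
    have g: "g \<in> carrier G" using that by (simp add: ball_stab_def)
    have "inv' g y = y" if "tdist z y \<le> r" for y
      using \<open>g \<in> ball_stab z r\<close> that G_apply_inv(2) [OF g, of y] by (simp add: ball_stab_def)
    then show ?thesis using G_inv_closed [OF g] by (simp add: ball_stab_def G_inv [OF g])
  qed
  show "g \<otimes>\<^bsub>G\<^esub> h \<in> ball_stab z r" if "g \<in> ball_stab z r" "h \<in> ball_stab z r" for g h
    using that by (auto simp: ball_stab_def G_simps G_comp)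
qed (auto simp: ball_stab_def)

lemma ball_stab_openin: "openin T (ball_stab z r)"
  unfolding openin_pointwise_topology
proof (intro conjI ballI)
  fix g assume "g \<in> ball_stab z r"
  then show "\<exists>S. finite S \<and> (\<forall>g'\<in>carrier G. (\<forall>s\<in>S. g' s = g s) \<longrightarrow> g' \<in> ball_stab z r)"
    by (intro exI [of _ "{y. tdist z y \<le> r}"]) (simp add: ball_stab_def finite_ball)
qed (auto simp: ball_stab_def)

lemma ball_stab_basis:
  assumes "openin T V" "id \<in> V" shows "\<exists>n. ball_stab z (Suc n) \<subseteq> V"
proof -
  obtain S where S: "finite S" "\<And>g. g \<in> carrier G \<Longrightarrow> \<forall>s\<in>S. g s = id s \<Longrightarrow> g \<in> V"
    using assms unfolding openin_pointwise_topology by blast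
  define n where "n = (\<Sum>s\<in>S. tdist z s)"
  have "tdist z s \<le> Suc n" if "s \<in> S" for s
    using member_le_sum [OF that _ S(1), of "tdist z"] by (simp add: n_def)
  then have "ball_stab z (Suc n) \<subseteq> V" by (auto simp: ball_stab_def intro!: S(2))
  then show ?thesis by blast
qed

text \<open>Elements of the stabilizer preserve the distance from \<open>z\<close>, so they form a subset of a product of finite
  sets. This subset is closed: that a map is an isometry with local permutations in \<open>F\<close> and fixes the
  ball are conditions on finitely many values each, and an isometry that fixes \<open>z\<close> is surjective
  because it permutes the finite balls around \<open>z\<close>. The radius is positive in order that a map with these
  properties fixes an edge and so lies in \<open>U(F)\<^sup>+\<close> rather than only in \<open>U(F)\<close>.\<close>

lemma ball_stab_compactin:
  assumes d: "d \<ge> 1" shows "compactin T (ball_stab z (Suc r))"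
proof -
  let ?P = "product_topology (\<lambda>_::'v. discrete_topology (UNIV :: 'v set)) UNIV"
  let ?K = "ball_stab z (Suc r)"
  let ?B = "Pi\<^sub>E UNIV (\<lambda>y. {x. tdist z x \<le> tdist z y})"
  have fix_z: "g z = z" if "g \<in> ?K" for g using that by (simp add: ball_stab_def tdist_self)
  have iso: "tdist (g x) (g y) = tdist x y" if "g \<in> ?K" for g x y
    using that U_tdist [OF G_U] by (simp add: ball_stab_def)
  have sub: "?K \<subseteq> ?B"
  proof
    fix g assume g: "g \<in> ?K"
    then show "g \<in> ?B" using fix_z [OF g] iso [OF g, of z] by (auto simp: PiE_iff)
  qed
  have cpt: "compactin ?P ?B"
    by (simp add: compactin_PiE compactin_discrete_topology finite_ball)
  have "closedin ?P ?K"
  proof -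
    have "openin ?P (- ?K)"
      unfolding openin_product_discrete
    proof
      fix g assume g: "g \<in> - ?K"
      have "(\<exists>y. tdist z y \<le> Suc r \<and> g y \<noteq> y) \<or> (\<exists>x y. tdist (g x) (g y) \<noteq> tdist x y) \<or>
          (\<exists>x. \<not> (\<exists>f\<in>F. \<forall>c\<in>{1..d}. g (nb x c) = nb (g x) (f c)))"
      proof (rule ccontr)
        assume "\<not> ?thesis"
        then have fixed: "\<And>y. tdist z y \<le> Suc r \<Longrightarrow> g y = y" and iso: "\<And>x y. tdist (g x) (g y) = tdist x y"
          and loc: "\<And>x. \<exists>f\<in>F. \<forall>c\<in>{1..d}. g (nb x c) = nb (g x) (f c)" by blast+
        have gz: "g z = z" using fixed [of z] by (simp add: tdist_self)
        have inj: "inj g"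
        proof (rule injI)
          fix x y assume "g x = g y"
          then show "x = y" using iso [of x y] tdist_self [of "g x"] tdist_zero [of x y] by simp
        qed
        moreover have "surj g"
          unfolding surj_def
        proof
          fix y
          let ?S = "{x. tdist z x \<le> tdist z y}"
          have "g ` ?S \<subseteq> ?S" using iso [of z] gz by auto
          then have "g ` ?S = ?S"
            by (rule endo_inj_surj [OF finite_ball _ inj_on_subset [OF inj subset_UNIV]])
          then have "y \<in> g ` ?S" by simp
          then show "\<exists>x. y = g x" by blast
        qed
        ultimately have "g \<in> carrier U" using loc by (intro U_I) (auto simp: bij_def)
        moreover have "{z, nb z 1} \<in> E" using nb_edge(1) [of 1 z] d by simp
        moreover have "g (nb z 1) = nb z 1" using fixed [of "nb z 1"] tdist_nb_self [of 1 z] d by simp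
        ultimately have "g \<in> carrier G" using gz by (intro G_I [of g z "nb z 1"])
        then show False using g fixed by (simp add: ball_stab_def)
      qed
      then consider (1) y where "tdist z y \<le> Suc r" "g y \<noteq> y"
        | (2) x y where "tdist (g x) (g y) \<noteq> tdist x y"
        | (3) x where "\<not> (\<exists>f\<in>F. \<forall>c\<in>{1..d}. g (nb x c) = nb (g x) (f c))" by blast
      then show "\<exists>S. finite S \<and> (\<forall>g'. (\<forall>s\<in>S. g' s = g s) \<longrightarrow> g' \<in> - ?K)"
      proof cases
        case (1 y)
        then show ?thesis by (intro exI [of _ "{y}"]) (auto simp: ball_stab_def)
      next
        case (2 x y)
        have "g' \<notin> ?K" if "g' x = g x" "g' y = g y" for g'
          using iso [of g' x y] 2 that by auto
        then show ?thesis by (intro exI [of _ "{x, y}"]) auto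
      next
        case (3 x)
        have "g' \<notin> ?K" if s: "\<forall>s\<in>insert x (nb x ` {1..d}). g' s = g s" for g'
        proof
          assume "g' \<in> ?K"
          then have g': "g' \<in> carrier U" using G_U by (simp add: ball_stab_def)
          have "g (nb x c) = nb (g x) (lp g' x c)" if "c \<in> {1..d}" for c
            using U_nb [OF g' that, of x] s that by simp
          then show False using 3 U_lp [OF g', of x] by blast
        qed
        then show ?thesis by (intro exI [of _ "insert x (nb x ` {1..d})"]) auto
      qed
    qed
    then show ?thesis by (simp add: closedin_def Compl_eq_Diff_UNIV)
  qed
  then have "compactin ?P ?K" by (rule closed_compactin [OF cpt sub])
  then show ?thesis by (auto simp: pointwise_topology_def compactin_subtopology ball_stab_def)
qed

lemma coset_of_equal_inverses:
  assumes g: "g \<in> carrier G" and h: "h \<in> carrier G"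
    and eq: "\<And>y. tdist z y \<le> r \<Longrightarrow> inv' g y = inv' h y"
  shows "g \<in> ball_stab z r #>\<^bsub>G\<^esub> h"
proof -
  have "g \<circ> inv' h \<in> ball_stab z r"
    using eq G_apply_inv(1) [OF g] G_comp [OF g G_inv_closed [OF h]] by (simp add: ball_stab_def) metis
  moreover have "g = (g \<circ> inv' h) \<circ> h" using G_apply_inv(2) [OF h] by (auto simp: fun_eq_iff)
  ultimately show ?thesis unfolding r_coset_def G_simps by blast
qed

text \<open>The coset of \<open>g\<close> is determined by the values of \<open>g\<inverse>\<close> on a finite ball. For all of \<open>G\<close> this leaves
  countably many cosets, and for the elements of bounded displacement finitely many.\<close>

lemma coset_representatives:
  assumes "A \<subseteq> carrier G"
  shows "\<exists>C. C \<subseteq> A \<and> A \<subseteq> (\<Union>h\<in>C. ball_stab z r #>\<^bsub>G\<^esub> h) \<and> countable C \<and>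
    ((\<exists>B. finite B \<and> (\<forall>g\<in>A. \<forall>y. tdist z y \<le> r \<longrightarrow> inv' g y \<in> B)) \<longrightarrow> finite C)"
proof -
  obtain ys where ys: "set ys = {y. tdist z y \<le> r}" using finite_list [OF finite_ball] by blast
  define \<phi> where "\<phi> g = map (inv' g) ys" for g :: "'v \<Rightarrow> 'v"
  define C where "C = inv_into A \<phi> ` (\<phi> ` A)"
  show ?thesis
  proof (intro exI [of _ C] conjI impI)
    show "C \<subseteq> A" unfolding C_def by (auto intro: inv_into_into)
    show "A \<subseteq> (\<Union>h\<in>C. ball_stab z r #>\<^bsub>G\<^esub> h)"
    proof
      fix g assume g: "g \<in> A"
      define h where "h = inv_into A \<phi> (\<phi> g)"
      have h: "h \<in> A" "\<phi> h = \<phi> g" using g by (auto simp: h_def inv_into_into f_inv_into_f)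
      then have "inv' g y = inv' h y" if "tdist z y \<le> r" for y
        using that ys by (auto simp: \<phi>_def)
      then have "g \<in> ball_stab z r #>\<^bsub>G\<^esub> h" using g h assms by (intro coset_of_equal_inverses) auto
      then show "g \<in> (\<Union>h\<in>C. ball_stab z r #>\<^bsub>G\<^esub> h)" using g by (auto simp: C_def h_def)
    qed
    have "countable (lists (UNIV :: 'v set))" by (rule countable_lists [OF countable_vertices])
    then have "countable (\<phi> ` A)" by (rule countable_subset [rotated]) auto
    then show "countable C" unfolding C_def by (rule countable_image)
    assume "\<exists>B. finite B \<and> (\<forall>g\<in>A. \<forall>y. tdist z y \<le> r \<longrightarrow> inv' g y \<in> B)"
    then obtain B where B: "finite B" "\<forall>g\<in>A. \<forall>y. tdist z y \<le> r \<longrightarrow> inv' g y \<in> B" by blast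
    have "\<phi> ` A \<subseteq> {l. set l \<subseteq> B \<and> length l = length ys}" using B(2) ys by (auto simp: \<phi>_def)
    then have "finite (\<phi> ` A)" by (rule finite_subset) (rule finite_lists_length_eq [OF B(1)])
    then show "finite C" unfolding C_def by (rule finite_imageI)
  qed
qed

lemma tdlc:
  assumes d: "d \<ge> 1" shows "tdlc_group G T (\<lambda>n. ball_stab z (Suc n))"
proof -
  interpret group G by (rule G_group)
  show ?thesis
  proof (intro tdlc_group.intro tdlc_group_axioms.intro)
    show "group G" by (rule G_group)
    show "topspace T = carrier G" by (rule topspace_pointwise_topology)
    show "continuous_map (prod_topology T T) T (\<lambda>(x, y). x \<otimes>\<^bsub>G\<^esub> y)"
      using continuous_composition by (simp add: G_simps)
    show "continuous_map T T (m_inv G)" by (rule continuous_inverse)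
    show "subgroup (ball_stab z (Suc n)) G" "openin T (ball_stab z (Suc n))"
      "compactin T (ball_stab z (Suc n))" for n
      by (rule ball_stab_subgroup ball_stab_openin ball_stab_compactin [OF d])+
    show "decseq (\<lambda>n. ball_stab z (Suc n))" by (auto simp: decseq_def ball_stab_def)
    show "\<exists>n. ball_stab z (Suc n) \<subseteq> V" if "openin T V" "\<one>\<^bsub>G\<^esub> \<in> V" for V
      using that ball_stab_basis by (simp add: G_simps)
    show "\<exists>C. countable C \<and> C \<subseteq> carrier G \<and> carrier G = (\<Union>x\<in>C. ball_stab z (Suc n) #>\<^bsub>G\<^esub> x)" for n
    proof -
      obtain C where C: "C \<subseteq> carrier G" "carrier G \<subseteq> (\<Union>h\<in>C. ball_stab z (Suc n) #>\<^bsub>G\<^esub> h)" "countable C"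
        using coset_representatives [OF order_refl, of z "Suc n"] by iprover
      moreover have "(\<Union>h\<in>C. ball_stab z (Suc n) #>\<^bsub>G\<^esub> h) \<subseteq> carrier G"
      proof -
        have "ball_stab z (Suc n) \<subseteq> carrier G" by (auto simp: ball_stab_def)
        then show ?thesis using C(1) by (intro UN_least r_coset_subset_G) auto
      qed
      ultimately show ?thesis by blast
    qed
  qed
qed

lemma compact_displacement:
  assumes d: "d \<ge> 1"
  shows "\<exists>Q. compactin T Q \<and> (\<forall>g\<in>carrier G - Q. tdist z (g z) > n)"
proof -
  interpret tdlc_group G T "\<lambda>n. ball_stab z (Suc n)" by (rule tdlc [OF d])
  let ?A = "{g \<in> carrier G. tdist z (g z) \<le> n}"
  have A: "?A \<subseteq> carrier G" by auto
  obtain C where C: "C \<subseteq> ?A" "?A \<subseteq> (\<Union>h\<in>C. ball_stab z (Suc 0) #>\<^bsub>G\<^esub> h)"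
    "(\<exists>B. finite B \<and> (\<forall>g\<in>?A. \<forall>y. tdist z y \<le> Suc 0 \<longrightarrow> inv' g y \<in> B)) \<longrightarrow> finite C"
    using coset_representatives [OF A, of z "Suc 0"] by iprover
  have "tdist z (inv' g y) \<le> Suc n" if g: "g \<in> ?A" and y: "tdist z y \<le> Suc 0" for g y
  proof -
    have gU: "inv' g \<in> carrier U" using g G_inv_closed G_U by blast
    have "tdist z (inv' g z) = tdist (g z) z"
      using U_tdist [OF G_U, of g z "inv' g z"] g G_apply_inv(1) [of g z] by simp
    then have 0: "tdist z (inv' g z) \<le> n" using g tdist_sym [of z "g z"] by simp
    consider "y = z" | c where "c \<in> {1..d}" "y = nb z c"
    proof (cases "W z y")
      case Nil
      then show ?thesis using that(1) walk_W [of z y] by simp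
    next
      case (Cons c w)
      then have "W z y = [c]" using y by (simp add: tdist_def)
      then show ?thesis using that(2) [of c] walk_W [of z y] reduced_W [of z y] by (simp add: reduced_Cons)
    qed
    then show ?thesis
    proof cases
      case 2
      have "inv' g y = nb (inv' g z) (lp (inv' g) z c)" using U_nb [OF gU 2(1)] 2(2) by simp
      then show ?thesis
        using tdist_nb [OF F_image [OF U_lp [OF gU, of z] 2(1)], of z "inv' g z"] 0 by simp
    qed (use 0 in simp)
  qed
  then have fin: "finite C" using finite_ball [of z "Suc n"] by (intro C(3) [rule_format] exI [of _ "{y. tdist z y \<le> Suc n}"]) auto
  have "compactin T (\<Union>h\<in>C. ball_stab z (Suc 0) #>\<^bsub>G\<^esub> h)"
    using fin C(1) compactin_r_coset [OF K_compactin] by (intro compactin_Union) auto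
  then show ?thesis using C(2) by (intro exI [of _ "\<Union>h\<in>C. ball_stab z (Suc 0) #>\<^bsub>G\<^esub> h"]) force
qed

section \<open>The position of the translated end\<close>

lemma U_ray: assumes g: "g \<in> carrier U" and t: "t \<in> rays E" shows "g \<circ> t \<in> rays E"
proof -
  have "inj (g \<circ> t)" using t bij_is_inj [OF U_bij [OF g]] by (simp add: rays_def inj_compose)
  then show ?thesis using t U_edge [OF g] by (simp add: rays_def)
qed

text \<open>For \<open>P\<close> a half-tree and \<open>t\<close> a ray representing the end \<open>\<xi>\<close>, this says that the end \<open>g\<xi>\<close> lies in the
  boundary of \<open>P\<close>.\<close>

definition eventually_in :: "(nat \<Rightarrow> 'v) \<Rightarrow> 'v set \<Rightarrow> ('v \<Rightarrow> 'v) \<Rightarrow> bool"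
  where "eventually_in t P g \<longleftrightarrow> (\<exists>M. \<forall>m\<ge>M. g (t m) \<in> P)"

text \<open>A ray crosses the edge between \<open>x\<close> and \<open>nb x c\<close> at most once, so it stays on one side eventually.\<close>

lemma ray_eventually_half:
  assumes g: "g \<in> carrier U" and t: "t \<in> rays E" and c: "c \<in> {1..d}"
  shows "eventually_in t (half (nb x c) c) g \<longleftrightarrow> \<not> eventually_in t (half x c) g"
proof
  assume "eventually_in t (half (nb x c) c) g"
  then obtain M where M: "\<And>m. m \<ge> M \<Longrightarrow> g (t m) \<in> half (nb x c) c" by (auto simp: eventually_in_def)
  show "\<not> eventually_in t (half x c) g"
  proof
    assume "eventually_in t (half x c) g"
    then obtain M' where M': "\<And>m. m \<ge> M' \<Longrightarrow> g (t m) \<in> half x c" by (auto simp: eventually_in_def)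
    show False using M [of "max M M'"] M' [of "max M M'"] half_complement [OF c, of x] by simp
  qed
next
  assume never: "\<not> eventually_in t (half x c) g"
  have s: "g \<circ> t \<in> rays E" by (rule U_ray [OF g t])
  have inj: "inj (g \<circ> t)" using s by (simp add: rays_def)
  show "eventually_in t (half (nb x c) c) g"
  proof (cases "\<exists>n. g (t n) = nb x c")
    case True
    then obtain n where n: "g (t n) = nb x c" by blast
    obtain m where m: "m \<ge> Suc n" "g (t m) \<notin> half x c" using never by (auto simp: eventually_in_def)
    have "g (t (m + k)) \<in> half (nb x c) c" for k
    proof (induction k)
      case 0
      then show ?case using m half_complement [OF c, of x] by simp
    next
      case (Suc k)
      show ?case
      proof (rule ccontr)
        assume out: "g (t (m + Suc k)) \<notin> half (nb x c) c"
        obtain a where a: "a \<in> {1..d}" "g (t (Suc (m + k))) = nb (g (t (m + k))) a"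
          using ray_step [OF s, of "m + k"] by auto
        have "g (t (m + k)) = nb (nb x c) c" "a = c"
          using half_exit [OF Suc a(1)] out a(2) by auto
        then have "g (t (Suc (m + k))) = nb x c" using a(2) nb_nb [OF c, of "nb x c"] by simp
        then have "Suc (m + k) = n" using n inj by (metis comp_apply injD)
        then show False using m(1) by simp
      qed
    qed
    then show ?thesis unfolding eventually_in_def by (metis le_add_diff_inverse)
  next
    case False
    show ?thesis
    proof (rule ccontr)
      assume "\<not> eventually_in t (half (nb x c) c) g"
      then obtain m where m: "g (t m) \<in> half x c"
        using half_complement [OF c, of x] unfolding eventually_in_def by auto
      have "g (t (m + k)) \<in> half x c" for k
      proof (induction k)
        case (Suc k)
        obtain a where a: "a \<in> {1..d}" "g (t (Suc (m + k))) = nb (g (t (m + k))) a"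
          using ray_step [OF s, of "m + k"] by auto
        then show ?case using half_exit(1) [OF Suc a(1)] False by auto
      qed (use m in simp)
      then show False using never unfolding eventually_in_def by (metis le_add_diff_inverse)
    qed
  qed
qed

text \<open>Let \<open>g(t m)\<close> be in the half-tree for \<open>m \<ge> M\<close>. If a ray that starts at \<open>g(t M)\<close> leaves the half-tree,
  it does so at a time determined by the distance \<open>L\<close> of \<open>g(t M)\<close> from the boundary vertex. Therefore it
  suffices to prescribe the values of \<open>g'\<close> at \<open>t M\<close> and at \<open>t (Suc (M + L))\<close>.\<close>

lemma openin_eventually_half:
  assumes t: "t \<in> rays E" and c: "c \<in> {1..d}"
  shows "openin T {g \<in> carrier G. eventually_in t (half x c) g}"
  unfolding openin_pointwise_topology
proof (intro conjI ballI)
  fix g assume "g \<in> {g \<in> carrier G. eventually_in t (half x c) g}"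
  then obtain M where g: "g \<in> carrier G" and M: "\<And>m. m \<ge> M \<Longrightarrow> g (t m) \<in> half x c"
    by (auto simp: eventually_in_def)
  define L where "L = tdist (g (t M)) (nb x c)"
  have "eventually_in t (half x c) g'"
    if g': "g' \<in> carrier G" and eq: "g' (t M) = g (t M)" "g' (t (Suc (M + L))) = g (t (Suc (M + L)))" for g'
  proof -
    have s: "g' \<circ> t \<in> rays E" by (rule U_ray [OF G_U [OF g'] t])
    have "g' (t (M + k)) \<in> half x c" for k
    proof (induction k)
      case 0
      then show ?case using M [of M] eq by simp
    next
      case (Suc k)
      obtain a where a: "a \<in> {1..d}" "g' (t (Suc (M + k))) = nb (g' (t (M + k))) a"
        using ray_step [OF s, of "M + k"] by auto
      show ?case
      proof (rule ccontr)
        assume out: "g' (t (M + Suc k)) \<notin> half x c"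
        then have "g' (t (M + k)) = nb x c" using half_exit(1) [OF Suc a(1)] a(2) by simp
        then have "k = L" using ray_tdist [OF s, of M k] eq(1) by (simp add: L_def)
        then show False using out eq(2) M [of "Suc (M + L)"] by simp
      qed
    qed
    then show ?thesis unfolding eventually_in_def by (metis le_add_diff_inverse)
  qed
  then show "\<exists>S. finite S \<and> (\<forall>g'\<in>carrier G. (\<forall>s\<in>S. g' s = g s) \<longrightarrow>
      g' \<in> {g \<in> carrier G. eventually_in t (half x c) g})"
    by (intro exI [of _ "{t M, t (Suc (M + L))}"]) auto
qed auto

lemma eventually_in_stabilizer:
  assumes "\<exists>m n. \<forall>k. t (m + k) = h (t (n + k))"
  shows "eventually_in t P (g \<circ> h) \<longleftrightarrow> eventually_in t P g"
proof -
  obtain m n where mn: "\<And>k. h (t (n + k)) = t (m + k)" using assms by metis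
  show ?thesis
  proof
    assume "eventually_in t P (g \<circ> h)"
    then obtain M where M: "\<And>j. j \<ge> M \<Longrightarrow> g (h (t j)) \<in> P" by (auto simp: eventually_in_def)
    have "g (t j) \<in> P" if "j \<ge> m + M" for j
      using M [of "n + (j - m)"] mn [of "j - m"] that by simp
    then show "eventually_in t P g" by (auto simp: eventually_in_def)
  next
    assume "eventually_in t P g"
    then obtain M where M: "\<And>j. j \<ge> M \<Longrightarrow> g (t j) \<in> P" by (auto simp: eventually_in_def)
    have "g (h (t j)) \<in> P" if "j \<ge> n + M" for j
      using M [of "m + (j - n)"] mn [of "j - n"] that by simp
    then show "eventually_in t P (g \<circ> h)" by (auto simp: eventually_in_def)
  qed
qed

lemma end_ray:
  assumes "\<xi> \<in> ends E" "\<forall>h\<in>H. (\<lambda>r. h \<circ> r) ` \<xi> = \<xi>"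
  obtains t where "t \<in> rays E" "\<And>h. h \<in> H \<Longrightarrow> \<exists>m n. \<forall>k. t (m + k) = h (t (n + k))"
proof -
  obtain t where t: "t \<in> rays E" "\<xi> = cofinal_rel E `` {t}"
    using assms(1) unfolding ends_def by (auto elim: quotientE)
  have "t \<in> \<xi>" using t by (auto simp: cofinal_rel_def intro!: exI [of _ 0])
  have "\<exists>m n. \<forall>k. t (m + k) = h (t (n + k))" if "h \<in> H" for h
  proof -
    have "h \<circ> t \<in> \<xi>" using assms(2) that \<open>t \<in> \<xi>\<close> by blast
    then show ?thesis by (auto simp: t(2) cofinal_rel_def)
  qed
  then show ?thesis using that t(1) by blast
qed

section \<open>Vanishing of matrix coefficients for the universal group\<close>

text \<open>
  If \<open>g\<close> moves \<open>z\<close> far, then the edge in the middle of the geodesic from \<open>z\<close> to \<open>y = g\<inverse>z\<close> has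
  distance at least \<open>Suc r + 2p\<close> from both ends. The elements \<open>\<kappa> j\<close> fix a ball around \<open>z\<close> and separate
  the images of the half-tree containing \<open>y\<close>; the elements \<open>\<kappa>' j\<close> fix a ball around \<open>y\<close> and separate
  the images of the half-tree containing \<open>z\<close>. The cosets are divided according to the half-tree in which
  the translated end lies, and \<open>coef_decay\<close> applies.
\<close>

theorem induced_C0:
  assumes d: "d \<ge> 1" and prim: "primitive_perm_group d F"
    and \<xi>: "\<xi> \<in> ends E" "\<forall>h\<in>H. (\<lambda>r. h \<circ> r) ` \<xi> = \<xi>"
    and ind: "ind_rep G T (\<lambda>n. ball_stab z (Suc n)) H m\<^sub>G m\<^sub>H \<Delta>\<^sub>G \<Delta>\<^sub>H \<rho> \<mu> \<sigma> J \<pi>"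
  shows "C0_rep G T \<pi>"
proof -
  interpret I: ind_rep G T "\<lambda>n. ball_stab z (Suc n)" H m\<^sub>G m\<^sub>H \<Delta>\<^sub>G \<Delta>\<^sub>H \<rho> \<mu> \<sigma> J \<pi> by (rule ind)
  obtain t where t: "t \<in> rays E" and stab: "\<And>h. h \<in> H \<Longrightarrow> \<exists>m n. \<forall>k. t (m + k) = h (t (n + k))"
    using end_ray [OF \<xi>] by metis
  have ev_stab: "eventually_in t P (g \<circ> h) \<longleftrightarrow> eventually_in t P g" if "h \<in> H" for P g h
    by (rule eventually_in_stabilizer) (rule stab [OF that])
  \<comment> \<open>the cosets whose end lies in the half-tree behind the edge of colour \<open>c\<close> at \<open>x\<close>\<close>
  define D where "D x c = {X \<in> lcosets\<^bsub>G\<^esub> H. eventually_in t (half x c) (coset_rep X)}" for x c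
  have inv: "I.right_invariant (eventually_in t P)" for P
    unfolding I.right_invariant_def using ev_stab by (simp add: G_simps)
  have D_open: "openin I.GH (D x c)" if c: "c \<in> {1..d}" for x c
  proof -
    have "{g \<in> topspace T. g <#\<^bsub>G\<^esub> H \<in> D x c} = {g \<in> carrier G. eventually_in t (half x c) g}"
      using I.right_invariant_rep [OF inv] I.coset_in by (auto simp: D_def topspace_pointwise_topology)
    then show ?thesis
      using openin_eventually_half [OF t c] by (auto simp: openin_coset_topology D_def)
  qed
  have D_complement: "lcosets\<^bsub>G\<^esub> H - D (nb x c) c = D x c" if c: "c \<in> {1..d}" for x c
    using ray_eventually_half [OF G_U t c] I.coset_rep(1) by (auto simp: D_def)
  have D_disjoint: "u <#\<^bsub>G\<^esub> X \<noteq> v <#\<^bsub>G\<^esub> Y"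
    if u: "u \<in> carrier G" and v: "v \<in> carrier G" and disj: "u ` half x c \<inter> v ` half x c = {}"
      and X: "X \<in> D x c" and Y: "Y \<in> D x c" for u v X Y x c
  proof
    assume eq: "u <#\<^bsub>G\<^esub> X = v <#\<^bsub>G\<^esub> Y"
    define a b where "a = coset_rep X" and "b = coset_rep Y"
    have a: "a \<in> carrier G" "X = a <#\<^bsub>G\<^esub> H" and b: "b \<in> carrier G" "Y = b <#\<^bsub>G\<^esub> H"
      using I.coset_rep X Y by (auto simp: D_def a_def b_def)
    have "(v \<circ> b) <#\<^bsub>G\<^esub> H = (u \<circ> a) <#\<^bsub>G\<^esub> H"
      using eq I.translate_coset [OF u a(1)] I.translate_coset [OF v b(1)] a(2) b(2) by (simp add: G_simps)
    then obtain h where h: "h \<in> H" "v \<circ> b = (u \<circ> a) \<circ> h"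
      using I.coset_eqD [OF G_comp [OF u a(1)] _ G_comp [OF v b(1)]] by (auto simp: G_simps)
    have "eventually_in t (half x c) a" using X by (simp add: D_def a_def)
    then have "eventually_in t (u ` half x c) (u \<circ> a)" by (auto simp: eventually_in_def)
    then have "eventually_in t (u ` half x c) (v \<circ> b)"
      unfolding h(2) ev_stab [OF h(1)] .
    then obtain M where M: "\<And>m. m \<ge> M \<Longrightarrow> v (b (t m)) \<in> u ` half x c" by (auto simp: eventually_in_def)
    have "eventually_in t (half x c) b" using Y by (simp add: D_def b_def)
    then obtain M' where M': "\<And>m. m \<ge> M' \<Longrightarrow> b (t m) \<in> half x c" by (auto simp: eventually_in_def)
    show False using M [of "max M M'"] M' [of "max M M'"] disj by auto
  qed
  show ?thesis
  proof (rule I.C0_criterion)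
    fix C and e :: real
    assume C: "finite C" "C \<subseteq> carrier G" and e: "e > 0"
    show "\<exists>Q. compactin T Q \<and> (\<forall>g\<in>carrier G - Q. I.coef (I.core C) g \<le> ennreal e)"
    proof (cases movable)
      case False
      then have "carrier G = {id}" using primitive_dichotomy [OF prim] free_trivial by blast
      then show ?thesis by (intro exI [of _ "{id}"]) (simp add: topspace_pointwise_topology)
    next
      case mov: True
      obtain r where r: "\<And>k X. k \<in> ball_stab z (Suc r) \<Longrightarrow> X \<in> I.core C \<Longrightarrow> I.R k (coset_rep X) \<ge> 1 / 4"
        using I.R_near_identity [OF C] by blast
      define a where "a = measure \<mu> (I.core C)"
      obtain p where "7 * a / e < 2 ^ p" using real_arch_pow [of 2 "7 * a / e"] by auto
      then have p: "7 * a / 2 ^ p \<le> e" using e by (simp add: field_simps)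
      define j where "j = Suc r + 2 * p"
      obtain Q where Q: "compactin T Q" "\<And>g. g \<in> carrier G - Q \<Longrightarrow> tdist z (g z) > 2 * j + 1"
        using compact_displacement [OF d, where z = z and n = "2 * j + 1"] by blast
      have "I.coef (I.core C) g \<le> ennreal e" if gQ: "g \<in> carrier G - Q" for g
      proof -
        have g: "g \<in> carrier G" using gQ by simp
        define y where "y = inv' g z"
        define w where "w = W z y"
        have gy: "g y = z" by (simp add: y_def G_apply_inv(1) [OF g])
        have "tdist z y = tdist (g z) z" using U_tdist [OF G_U [OF g], of z y] gy by simp
        then have len: "length w > 2 * j + 1"
          using Q(2) [OF gQ] tdist_sym [of z "g z"] by (simp add: w_def tdist_def)
        define w1 c w2 where "w1 = take j w" and "c = w ! j" and "w2 = drop (Suc j) w"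
        have w: "w = w1 @ c # w2" unfolding w1_def c_def w2_def using len by (intro id_take_nth_drop) simp
        have l1: "Suc r + 2 * p \<le> length w1" "Suc r + 2 * p \<le> length (rev w2)"
          using len by (simp_all add: w1_def w2_def j_def)
        have red: "reduced (w1 @ c # w2)" using reduced_W [of z y] by (simp add: w [symmetric] w_def)
        then have red1: "reduced (w1 @ [c])" and c: "c \<in> {1..d}"
          by (auto simp: reduced_append reduced_Cons reduced_Nil)
        have "reduced (rev (c # w2))" using red by (simp only: reduced_rev reduced_append)
        then have red2: "reduced (rev w2 @ [c])" by simp
        let ?x = "walk z w1"
        have "y = walk (nb ?x c) w2" using walk_W [of z y] by (simp add: w_def [symmetric] w)
        then have walk_back: "walk y (rev w2) = nb ?x c"
          using walk_rev [OF reduced_set, of w2 "nb ?x c"] red by (simp add: reduced_append reduced_Cons)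
        obtain \<kappa> :: "nat \<Rightarrow> 'v \<Rightarrow> 'v" where
          \<kappa>1: "\<forall>j<2 ^ (2 * p). \<kappa> j \<in> carrier G \<and> (\<forall>v. tdist z v \<le> Suc r \<longrightarrow> \<kappa> j v = v)" and
          \<kappa>2: "\<forall>j<2 ^ (2 * p). \<forall>k<2 ^ (2 * p). j \<noteq> k \<longrightarrow> \<kappa> j ` half ?x c \<inter> \<kappa> k ` half ?x c = {}"
          using disjoint_half_translates [OF mov red1 l1(1), where z = z] by iprover
        obtain \<kappa>' :: "nat \<Rightarrow> 'v \<Rightarrow> 'v" where
          K1: "\<forall>j<2 ^ (2 * p). \<kappa>' j \<in> carrier G \<and> (\<forall>v. tdist y v \<le> Suc r \<longrightarrow> \<kappa>' j v = v)" and
          K2: "\<forall>j<2 ^ (2 * p). \<forall>k<2 ^ (2 * p). j \<noteq> k \<longrightarrow>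
            \<kappa>' j ` half (nb ?x c) c \<inter> \<kappa>' k ` half (nb ?x c) c = {}"
          using disjoint_half_translates [OF mov red2 l1(2), where z = y] unfolding walk_back by iprover
        have four: "(4::nat) ^ p = 2 ^ (2 * p)" by (simp add: power_mult)
        \<comment> \<open>\<open>\<kappa>' j\<close> fixes the ball around \<open>y = g\<inverse>z\<close>, so its conjugate by \<open>g\<close> fixes the ball around \<open>z\<close>\<close>
        have conj: "g \<circ> inv' (\<kappa>' j) \<circ> inv' g \<in> ball_stab z (Suc r)" if j: "j < 4 ^ p" for j
        proof -
          have \<kappa>': "\<kappa>' j \<in> carrier G" using K1 j by (simp add: four)
          have "g (inv' (\<kappa>' j) (inv' g v)) = v" if v: "tdist z v \<le> Suc r" for v
          proof -
            have "tdist y (inv' g v) = tdist z v"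
              using U_tdist [OF G_U [OF g], of y "inv' g v"] gy G_apply_inv(1) [OF g] by simp
            then have "\<kappa>' j (inv' g v) = inv' g v" using K1 j v by (simp add: four)
            then have "inv' (\<kappa>' j) (inv' g v) = inv' g v" by (metis G_apply_inv(2) [OF \<kappa>'])
            then show ?thesis by (simp add: G_apply_inv(1) [OF g])
          qed
          then show ?thesis
            using G_comp [OF G_comp [OF g G_inv_closed [OF \<kappa>']] G_inv_closed [OF g]]
            by (simp add: ball_stab_def)
        qed
        have "I.coef (I.core C) g \<le> ennreal (7 * measure \<mu> (I.core C) / 2 ^ p)"
        proof (rule I.coef_decay [OF C r g, where D = "D (nb ?x c) c" and u = \<kappa>' and w = \<kappa>])
          show "D (nb ?x c) c \<in> sets \<mu>" by (rule I.openin_mu [OF D_open [OF c]])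
          show \<kappa>'G: "\<kappa>' j \<in> carrier G" if "j < 4 ^ p" for j using K1 that by (simp add: four)
          show "g \<otimes>\<^bsub>G\<^esub> inv\<^bsub>G\<^esub> \<kappa>' j \<otimes>\<^bsub>G\<^esub> inv\<^bsub>G\<^esub> g \<in> ball_stab z (Suc r)" if "j < 4 ^ p" for j
            using conj [OF that] by (simp add: G_simps G_inv [OF g] G_inv [OF \<kappa>'G [OF that]])
          show "\<kappa>' j <#\<^bsub>G\<^esub> X \<noteq> \<kappa>' k <#\<^bsub>G\<^esub> Y"
            if "j < 4 ^ p" "k < 4 ^ p" "j \<noteq> k" "X \<in> D (nb ?x c) c" "Y \<in> D (nb ?x c) c" for j k X Y
            using that K2 by (intro D_disjoint [OF \<kappa>'G \<kappa>'G]) (simp_all add: four)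
          show "\<kappa> j \<in> ball_stab z (Suc r)" if "j < 4 ^ p" for j
            using \<kappa>1 that by (simp add: four ball_stab_def)
          show "\<kappa> j <#\<^bsub>G\<^esub> X \<noteq> \<kappa> k <#\<^bsub>G\<^esub> Y"
            if "j < 4 ^ p" "k < 4 ^ p" "j \<noteq> k" "X \<in> lcosets\<^bsub>G\<^esub> H - D (nb ?x c) c"
              "Y \<in> lcosets\<^bsub>G\<^esub> H - D (nb ?x c) c" for j k X Y
            using that \<kappa>1 \<kappa>2 unfolding D_complement [OF c]
            by (intro D_disjoint [of _ _ ?x c]) (simp_all add: four)
        qed
        also have "\<dots> \<le> ennreal e" using p by (intro ennreal_leI) (simp add: a_def)
        finally show ?thesis .
      qed
      then show ?thesis using Q(1) by blast
    qed
  qed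
qed

end

theorem theorem1p1:
  fixes d :: nat
    and E :: "'v set set"
    and i :: "'v set \<Rightarrow> nat"
    and F :: "(nat \<Rightarrow> nat) set"
    and \<xi> :: "(nat \<Rightarrow> 'v) set"
    and H :: "('v \<Rightarrow> 'v) set"
    and \<sigma> :: "('v \<Rightarrow> 'v) \<Rightarrow> 'k \<Rightarrow> 'k::complex_hilbert"
    and m\<^sub>G m\<^sub>H :: "('v \<Rightarrow> 'v) measure"
    and \<Delta>\<^sub>G \<Delta>\<^sub>H \<rho> :: "('v \<Rightarrow> 'v) \<Rightarrow> real"
    and \<mu> :: "('v \<Rightarrow> 'v) set measure"
    and J :: "(('v \<Rightarrow> 'v) \<Rightarrow> 'k) \<Rightarrow> 'h::complex_hilbert"
    and \<pi>\<^sub>\<sigma> :: "('v \<Rightarrow> 'v) \<Rightarrow> 'h \<Rightarrow> 'h"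
  defines "G \<equiv> universal_group_plus d E i F"
  defines "T \<equiv> pointwise_topology G"
  assumes "d \<ge> 3"
    and "regular_tree d E"
    and "legal_colouring d E i"
    and "primitive_perm_group d F"
    and "\<xi> \<in> ends E"
    and "subgroup H G"
    and "closedin T H"
    and "\<forall>h\<in>H. (\<lambda>r. h \<circ> r) ` \<xi> = \<xi>"
    and "unitary_rep (G\<lparr>carrier := H\<rparr>) (subtopology T H) \<sigma>"
    and "left_haar_measure G T m\<^sub>G"
    and "left_haar_measure (G\<lparr>carrier := H\<rparr>) (subtopology T H) m\<^sub>H"
    and "modular_function G m\<^sub>G \<Delta>\<^sub>G"
    and "modular_function (G\<lparr>carrier := H\<rparr>) m\<^sub>H \<Delta>\<^sub>H"
    and "rho_function G T H \<Delta>\<^sub>G \<Delta>\<^sub>H \<rho>"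
    and "rho_measure G T H m\<^sub>G m\<^sub>H \<rho> \<mu>"
    and "induced_rep G T H \<rho> \<mu> \<sigma> J \<pi>\<^sub>\<sigma>"
  shows "C0_rep G T \<pi>\<^sub>\<sigma>"
proof -
  have "subgroup F (sym_group d)"
    using \<open>primitive_perm_group d F\<close> by (simp add: primitive_perm_group_def)
  then interpret C: coloured_tree_group d E i F
    using \<open>regular_tree d E\<close> \<open>legal_colouring d E i\<close>
    by (intro coloured_tree_group.intro coloured_tree.intro coloured_tree_group_axioms.intro)
  have d: "d \<ge> 1" using \<open>d \<ge> 3\<close> by simp
  \<comment> \<open>the base vertex of the balls is arbitrary\<close>
  have "ind_rep G T (\<lambda>n. C.ball_stab undefined (Suc n)) H m\<^sub>G m\<^sub>H \<Delta>\<^sub>G \<Delta>\<^sub>H \<rho> \<mu> \<sigma> J \<pi>\<^sub>\<sigma>"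
  proof (intro ind_rep.intro rho_space.intro coset_space.intro ind_rep_axioms.intro
      rho_space_axioms.intro coset_space_axioms.intro)
    show "tdlc_group G T (\<lambda>n. C.ball_stab undefined (Suc n))"
      unfolding G_def T_def by (rule C.tdlc [OF d])
  qed (fact assms)+
  then show ?thesis
    unfolding G_def T_def
    by (rule C.induced_C0 [OF d \<open>primitive_perm_group d F\<close> \<open>\<xi> \<in> ends E\<close> \<open>\<forall>h\<in>H. (\<lambda>r. h \<circ> r) ` \<xi> = \<xi>\<close>])
qed

end
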